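(* Let $\mathbb{P}$ be a translation-invariant Gibbs random field on $\mathbb{Z}^d$, $d\ge2$, which is non-uniformly exponentially $\varphi$-mixing, and let $\mathbb{Q}$ be an ergodic random field on the same configuration space $\Omega$. Then there exists $\epsilon_0>0$ such that for all $\epsilon>\epsilon_0$, for $\mathbb{Q}\times\mathbb{P}$-almost every $(\xi,\sigma)$ one has, for all sufficiently large $n$ (depending on $(\xi,\sigma)$), $$-\epsilon\log n\le\log\left[(\mathbf{w}_n(\xi,\sigma))^d\ \mathbb{P}(\mathcal{C}(\xi_{C_n}))\right]\le\log\log n^{\epsilon}.$$ In particular $$\lim_{n\to\infty}\frac{d}{n^d}\log\mathbf{w}_n(\xi,\sigma)=s(\mathbb{Q})+s(\mathbb{Q}|\mathbb{P})\quad\text{for }\mathbb{Q}\times\mathbb{P}\text{-almost every }(\xi,\sigma).$$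
   Context: Setting. $\mathcal{A}$ is a finite set, $\Omega=\mathcal{A}^{\mathbb{Z}^d}$ with the product topology and its Borel sigma-field, $\mathcal{S}$ is the set of (nonempty) finite subsets of $\mathbb{Z}^d$, $|\mathbf{x}|=\sum_i|x_i|$, $d(A,B)=\min\{|\mathbf{x}-\mathbf{y}|:\mathbf{x}\in A,\mathbf{y}\in B\}$ for $A,B\in\mathcal{S}$. $\sigma_V$ is the restriction of $\sigma$ to $V$, $\Omega_V=\mathcal{A}^V$, $\mathcal{F}_V$ is the sigma-field generated by $\sigma(\mathbf{x})$, $\mathbf{x}\in V$, and $(\tau_{\mathbf{x}}\sigma)(\mathbf{y})=\sigma(\mathbf{x}+\mathbf{y})$. An ergodic random field is a probability measure on $\Omega$ invariant and ergodic under the translations $\tau_{\mathbf{x}}$, $\mathbf{x}\in\mathbb{Z}^d$. Patterns. $C_n=[0,n]^d\cap\mathbb{Z}^d$; for $A_n\in\Omega_{C_n}$, $\mathcal{C}(A_n)=\{\sigma:\sigma_{C_n}=A_n\}$. Waiting time: for $\xi,\sigma\in\Omega$, $\mathbf{w}_n(\xi,\sigma)$ is the minimal $k\in\mathbb{N}$ such that there is $\mathbf{x}\in\mathbb{Z}_+^d$ with $|\mathbf{x}|>0$, $0\le x_i\le k$ for all $i$, and $(\tau_{\mathbf{x}}\sigma)_{C_n}=\xi_{C_n}$. Entropies (sums over all $A_n\in\Omega_{C_n}$, with $\mathcal{C}_n=\mathcal{C}(A_n)$). $s(\mathbb{Q})=\lim_{n\to\infty}-\frac{1}{n^d}\sum_{\mathcal{C}_n}\mathbb{Q}(\mathcal{C}_n)\log\mathbb{Q}(\mathcal{C}_n)$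 and $s(\mathbb{Q}|\mathbb{P})=\lim_{n\to\infty}\frac{1}{n^d}\sum_{\mathcal{C}_n}\mathbb{Q}(\mathcal{C}_n)\log\frac{\mathbb{Q}(\mathcal{C}_n)}{\mathbb{P}(\mathcal{C}_n)}$. Gibbs fields. A translation-invariant interaction is $U:\mathcal{S}\times\Omega\to\mathbb{R}$ such that $U(A,\sigma)$ depends only on $\sigma_A$, $U(A+\mathbf{x},\tau_{-\mathbf{x}}\sigma)=U(A,\sigma)$, and $\sum_{A\ni 0}\sup_\sigma|U(A,\sigma)|<\infty$. Put $H^\zeta_\Lambda(\sigma)=\sum_{A\cap\Lambda\ne\emptyset}U(A,\sigma_\Lambda\zeta_{\Lambda^c})$. A translation-invariant Gibbs random field (with interaction $U$) is a translation-invariant probability measure $\mathbb{P}$ on $\Omega$ such that for every $\Lambda\in\mathcal{S}$ the conditional distribution of $\sigma_\Lambda$ given $\sigma_{\Lambda^c}=\zeta_{\Lambda^c}$ is, for $\mathbb{P}$-a.e. $\zeta$, proportional to $e^{-H^\zeta_\Lambda(\sigma)}$. Mixing. For $m>0$, $\varphi(m)=\sup\frac{1}{|A_1|}\left|\mathbb{P}(E_{A_1}\mid E_{A_2})-\mathbb{P}(E_{A_1})\right|$, the supremum over finite $A_1,A_2\subset\mathbb{Z}^d$ with $d(A_1,A_2)\ge m$ and $E_{A_i}\in\mathcal{F}_{A_i}$ with $\mathbb{P}(E_{A_2})>0$. $\mathbb{P}$ is non-uniformly exponentially $\varphi$-mixing if there are $C_1,C_2>0$ with $\varphi(m)\le C_1e^{-C_2m}$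 for all $m>0$. *)

theory Defs
  imports "HOL-Probability.Probability"
begin

text \<open>Sites of the lattice are vectors \<open>int ^ 'd\<close>, so the dimension is \<open>CARD('d)\<close>; the alphabet is
  a finite type.\<close>

type_synonym 'd site = "int ^ 'd"
type_synonym ('d, 'a) config = "int ^ 'd \<Rightarrow> 'a"

definition l1_norm :: "'d::finite site \<Rightarrow> int" where
  "l1_norm x = (\<Sum>i\<in>UNIV. \<bar>x $ i\<bar>)"

definition site_dist :: "'d::finite site set \<Rightarrow> 'd site set \<Rightarrow> int" where
  "site_dist A B = Min ((\<lambda>(x, y). l1_norm (x - y)) ` (A \<times> B))"

definition shift :: "'d::finite site \<Rightarrow> ('d, 'a) config \<Rightarrow> ('d, 'a) config" where
  "shift x \<sigma> = (\<lambda>y. \<sigma> (x + y))"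

definition config_space :: "('d::finite, 'a::finite) config measure" where
  "config_space = PiM UNIV (\<lambda>_. count_space UNIV)"

definition local_sigma :: "'d::finite site set \<Rightarrow> ('d, 'a::finite) config measure" where
  "local_sigma V = sigma UNIV {{\<sigma>. \<sigma> x = a} | x a. x \<in> V}"

definition random_field :: "('d::finite, 'a::finite) config measure \<Rightarrow> bool" where
  "random_field M \<longleftrightarrow> prob_space M \<and> sets M = sets config_space"

definition translation_invariant :: "('d::finite, 'a::finite) config measure \<Rightarrow> bool" where
  "translation_invariant M \<longleftrightarrow> (\<forall>x. distr M M (shift x) = M)"

definition ergodic_field :: "('d::finite, 'a::finite) config measure \<Rightarrow> bool" where
  "ergodic_field M \<longleftrightarrow> random_field M \<and> translation_invariant M \<and>
     (\<forall>E\<in>sets M. (\<forall>x. shift x -` E = E) \<longrightarrow> measure M E = 0 \<or> measure M E = 1)"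

text \<open>The supremum below is over finitely many values, because \<open>U A \<sigma>\<close> depends only on the
  restriction of \<open>\<sigma>\<close> to the finite set \<open>A\<close>.\<close>

definition interaction :: "('d::finite site set \<Rightarrow> ('d, 'a::finite) config \<Rightarrow> real) \<Rightarrow> bool" where
  "interaction U \<longleftrightarrow>
     (\<forall>A \<sigma> \<eta>. finite A \<and> A \<noteq> {} \<and> restrict \<sigma> A = restrict \<eta> A \<longrightarrow> U A \<sigma> = U A \<eta>) \<and>
     (\<forall>A x \<sigma>. finite A \<and> A \<noteq> {} \<longrightarrow> U ((\<lambda>y. y + x) ` A) (shift (- x) \<sigma>) = U A \<sigma>) \<and>
     (\<lambda>A. SUP \<sigma>. \<bar>U A \<sigma>\<bar>) summable_on {A. finite A \<and> 0 \<in> A}"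

definition hamiltonian ::
  "('d::finite site set \<Rightarrow> ('d, 'a::finite) config \<Rightarrow> real) \<Rightarrow> 'd site set \<Rightarrow>
   ('d, 'a) config \<Rightarrow> ('d, 'a) config \<Rightarrow> real" where
  "hamiltonian U \<Lambda> \<zeta> \<sigma> = (\<Sum>\<^sub>\<infinity>A\<in>{A. finite A \<and> A \<inter> \<Lambda> \<noteq> {}}. U A (override_on \<zeta> \<sigma> \<Lambda>))"

abbreviation patterns :: "'d::finite site set \<Rightarrow> ('d, 'a::finite) config set" where
  "patterns V \<equiv> V \<rightarrow>\<^sub>E UNIV"

definition cylinder :: "'d::finite site set \<Rightarrow> ('d, 'a::finite) config \<Rightarrow> ('d, 'a) config set" where
  "cylinder V a = {\<sigma>. restrict \<sigma> V = a}"

text \<open>The conditional distribution of \<open>\<sigma>\<close> restricted to \<open>\<Lambda>\<close>, given the configuration off \<open>\<Lambda>\<close>, is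
  determined by the conditional probabilities of the finitely many patterns on \<open>\<Lambda>\<close>.\<close>

definition gibbs_field ::
  "('d::finite site set \<Rightarrow> ('d, 'a::finite) config \<Rightarrow> real) \<Rightarrow> ('d, 'a) config measure \<Rightarrow> bool" where
  "gibbs_field U M \<longleftrightarrow> random_field M \<and> translation_invariant M \<and>
     (\<forall>\<Lambda>. finite \<Lambda> \<and> \<Lambda> \<noteq> {} \<longrightarrow>
       (AE \<zeta> in M. \<forall>a\<in>patterns \<Lambda>.
          real_cond_exp M (local_sigma (- \<Lambda>)) (indicator (cylinder \<Lambda> a)) \<zeta> =
          exp (- hamiltonian U \<Lambda> \<zeta> a) / (\<Sum>b\<in>patterns \<Lambda>. exp (- hamiltonian U \<Lambda> \<zeta> b))))"

text \<open>The set below is nonempty and bounded by 1 whenever \<open>M\<close> is a random field, so that the real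
  supremum is the genuine one.\<close>

definition phi_mix :: "('d::finite, 'a::finite) config measure \<Rightarrow> real \<Rightarrow> real" where
  "phi_mix M m = Sup {1 / real (card A1) * \<bar>\<P>(\<sigma> in M. \<sigma> \<in> E1 \<bar> \<sigma> \<in> E2) - measure M E1\<bar> | A1 A2 E1 E2.
     finite A1 \<and> A1 \<noteq> {} \<and> finite A2 \<and> A2 \<noteq> {} \<and> m \<le> real_of_int (site_dist A1 A2) \<and>
     E1 \<in> sets (local_sigma A1) \<and> E2 \<in> sets (local_sigma A2) \<and> measure M E2 > 0}"

definition exp_phi_mixing :: "('d::finite, 'a::finite) config measure \<Rightarrow> bool" where
  "exp_phi_mixing M \<longleftrightarrow> (\<exists>C1>0. \<exists>C2>0. \<forall>m>0. phi_mix M m \<le> C1 * exp (- C2 * m))"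

definition cube :: "nat \<Rightarrow> 'd::finite site set" where
  "cube n = {x. \<forall>i. 0 \<le> x $ i \<and> x $ i \<le> int n}"

text \<open>The waiting time is infinite if the pattern never reappears in the positive orthant.\<close>

definition waiting_time :: "nat \<Rightarrow> ('d::finite, 'a::finite) config \<Rightarrow> ('d, 'a) config \<Rightarrow> enat" where
  "waiting_time n \<xi> \<sigma> = Inf {enat k | k. \<exists>x. l1_norm x > 0 \<and> (\<forall>i. 0 \<le> x $ i \<and> x $ i \<le> int k) \<and>
     restrict (shift x \<sigma>) (cube n) = restrict \<xi> (cube n)}"

text \<open>The logarithm extended by \<open>log 0 = - \<infinity>\<close> and \<open>log \<infinity> = \<infinity>\<close>; note that \<open>ln 0 = 0\<close> on the reals.\<close>

definition ext_ln :: "ereal \<Rightarrow> ereal" where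
  "ext_ln x = (if x \<le> 0 then - \<infinity> else if x = \<infinity> then \<infinity> else ereal (ln (real_of_ereal x)))"

definition block_entropy :: "('d::finite, 'a::finite) config measure \<Rightarrow> nat \<Rightarrow> real" where
  "block_entropy Q n = - (1 / real n ^ CARD('d)) *
     (\<Sum>a\<in>patterns (cube n). measure Q (cylinder (cube n) a) * ln (measure Q (cylinder (cube n) a)))"

text \<open>With extended arithmetic the usual conventions \<open>0 log (0 / p) = 0\<close> and \<open>q log (q / 0) = \<infinity>\<close>
  for \<open>q > 0\<close> hold.\<close>

definition block_rel_entropy ::
  "('d::finite, 'a::finite) config measure \<Rightarrow> ('d, 'a) config measure \<Rightarrow> nat \<Rightarrow> ereal" where
  "block_rel_entropy Q P n = ereal (1 / real n ^ CARD('d)) *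
     (\<Sum>a\<in>patterns (cube n). ereal (measure Q (cylinder (cube n) a)) *
        ext_ln (ereal (measure Q (cylinder (cube n) a)) / ereal (measure P (cylinder (cube n) a))))"

definition entropy_rate :: "('d::finite, 'a::finite) config measure \<Rightarrow> real" where
  "entropy_rate Q = lim (block_entropy Q)"

definition rel_entropy_rate ::
  "('d::finite, 'a::finite) config measure \<Rightarrow> ('d, 'a) config measure \<Rightarrow> ereal" where
  "rel_entropy_rate Q P = lim (block_rel_entropy Q P)"

lemma sets_config_space_eq_borel:
  "sets (config_space :: ('d::finite, 'a::finite) config measure) =
     sigma_sets UNIV {S. openin (product_topology (\<lambda>_. discrete_topology UNIV) UNIV) S}"
    (is "_ = sigma_sets UNIV ?O")
proof
  have "{{\<sigma> \<in> UNIV \<rightarrow>\<^sub>E UNIV. \<sigma> i \<in> A} | i A. i \<in> UNIV \<and> A \<in> UNIV} \<subseteq> ?O"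
  proof clarify
    fix i :: "'d site" and A :: "'a set"
    have "openin (product_topology (\<lambda>_. discrete_topology UNIV) UNIV)
        {\<sigma> \<in> topspace (product_topology (\<lambda>_. discrete_topology UNIV) UNIV). \<sigma> i \<in> A}"
      by (rule openin_continuous_map_preimage[where Y = "discrete_topology UNIV"])
         (auto intro: continuous_map_product_projection)
    then show "openin (product_topology (\<lambda>_. discrete_topology UNIV) UNIV)
        {\<sigma> \<in> UNIV \<rightarrow>\<^sub>E UNIV. \<sigma> i \<in> A}" by simp
  qed
  then show "sets (config_space :: ('d, 'a) config measure) \<subseteq> sigma_sets UNIV ?O"
    unfolding config_space_def sets_PiM_single by (simp add: sigma_sets_mono')
next
  let ?F = "{X :: 'd site \<Rightarrow> 'a set. finite {i. X i \<noteq> UNIV}}"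
  have "inj_on (\<lambda>X. (\<lambda>i. (i, X i)) ` {i. X i \<noteq> UNIV}) ?F"
  proof (rule inj_onI)
    fix X Y :: "'d site \<Rightarrow> 'a set"
    assume eq: "(\<lambda>i. (i, X i)) ` {i. X i \<noteq> UNIV} = (\<lambda>i. (i, Y i)) ` {i. Y i \<noteq> UNIV}"
    show "X = Y"
    proof
      fix i
      have "(i, v) \<in> (\<lambda>i. (i, X i)) ` {i. X i \<noteq> UNIV} \<longleftrightarrow>
          (i, v) \<in> (\<lambda>i. (i, Y i)) ` {i. Y i \<noteq> UNIV}" for v
        by (simp only: eq)
      then have "v = X i \<and> X i \<noteq> UNIV \<longleftrightarrow> v = Y i \<and> Y i \<noteq> UNIV" for v
        by (simp add: image_iff conj_commute)
      from this[of "X i"] this[of "Y i"] show "X i = Y i" by metis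
    qed
  qed
  moreover have "countable ((\<lambda>X. (\<lambda>i. (i, X i)) ` {i. X i \<noteq> UNIV}) ` ?F)"
    by (rule countable_subset[OF _ countable_Collect_finite]) auto
  ultimately have cF: "countable ?F"
    by (rule countable_image_inj_on[rotated])
  have "S \<in> sets (config_space :: ('d, 'a) config measure)" if "S \<in> ?O" for S
  proof -
    let ?G = "{X \<in> ?F. Pi\<^sub>E UNIV X \<subseteq> S}"
    have "S = (\<Union>X\<in>?G. Pi\<^sub>E UNIV X)"
    proof
      show "S \<subseteq> (\<Union>X\<in>?G. Pi\<^sub>E UNIV X)"
      proof
        fix \<sigma> assume "\<sigma> \<in> S"
        moreover have "\<forall>x\<in>S. \<exists>X. finite {i. X i \<noteq> UNIV} \<and> x \<in> Pi\<^sub>E UNIV X \<and> Pi\<^sub>E UNIV X \<subseteq> S"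
          using that by (simp add: openin_product_topology_alt)
        ultimately obtain X where
          "finite {i. X i \<noteq> UNIV}" "\<sigma> \<in> Pi\<^sub>E UNIV X" "Pi\<^sub>E UNIV X \<subseteq> S" by meson
        then show "\<sigma> \<in> (\<Union>X\<in>?G. Pi\<^sub>E UNIV X)" by blast
      qed
    qed auto
    moreover have "countable ?G" by (rule countable_subset[OF _ cF]) auto
    moreover have "Pi\<^sub>E UNIV X \<in> sets (config_space :: ('d, 'a) config measure)" for X
      unfolding config_space_def by (rule sets_PiM_I_countable) auto
    ultimately show ?thesis
      using sets.countable_UN''[of ?G "Pi\<^sub>E UNIV" "config_space :: ('d, 'a) config measure"] by simp
  qed
  then have "?O \<subseteq> sets (config_space :: ('d, 'a) config measure)" by blast
  from sets.sigma_sets_subset[OF this]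
  show "sigma_sets UNIV ?O \<subseteq> sets (config_space :: ('d, 'a) config measure)"
    by (simp add: config_space_def space_PiM)
qed

end

theory Submission
  imports Defs
begin

text \<open>Write \<open>p\<close> for the \<open>P\<close>-measure of the pattern of \<open>\<xi>\<close> on \<open>cube n\<close>. The lower bound is a union
  bound over positions and Borel-Cantelli. For the upper bound, a box with at least \<open>1 / p\<close> positions
  contains an occurrence with probability at least \<open>1 / 3\<close>, by a second moment estimate: an overlapping
  translate of the pattern adds at least \<open>n + 1\<close> new sites (here \<open>d \<ge> 2\<close> enters), each of which
  costs a factor \<open>1 - \<delta>\<close> since conditional probabilities of single symbols are at least \<open>\<delta>\<close>, and
  distant pairs are decoupled by mixing. By mixing again, of the order of \<open>\<epsilon> log n\<close> well separated such
  boxes are all missed with a probability that is a large negative power of \<open>n\<close>.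

  As \<open>log n\<close> is negligible against \<open>n\<^sup>d\<close>, the limit theorem amounts to almost sure convergence of
  \<open>- log p / n\<^sup>d\<close>. By the Gibbs property, \<open>- log p\<close> is additive over tiles up to boundary terms, hence
  close to a spatial average of a local function, and the pointwise ergodic theorem applies.\<close>

section \<open>Patterns and shifts\<close>

text \<open>Under \<open>P\<close> every estimate fixes the pattern and is uniform over patterns; in
  the two-sided bounds \<open>Q\<close> merely weights the patterns, with total weight 1, and its
  ergodicity matters only for the limit. Waiting times are replaced by hitting events of finitely
  many positions, so only cylinders and their finite combinations are ever measured.

  The obstacle in the second moment is that \<open>p\<close> may be far smaller than any mixing
  error at distances of order n. Mixing is therefore used in conditional form, where its error is
  multiplied by a further factor \<open>p\<close>, and pairs closer than 2 d n are left to the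
  single-site bounds. The mixing coefficient is normalised by the size of one of the two sets only;
  always taking a single box as that set keeps the error the same however many boxes have already
  been missed.

  The limit is identified through block relative entropy being cross entropy minus entropy, so that
  s(Q) + s(Q|P) is the limit of the \<open>Q\<close>-mean of \<open>- log p / n^d\<close>. Entropy
  converges by subadditivity, cross entropy together with the almost sure limit.\<close>

definition agree :: "'i set \<Rightarrow> ('i \<Rightarrow> 'a) \<Rightarrow> ('i \<Rightarrow> 'a) set" where
  "agree V b = {\<sigma>. \<forall>y\<in>V. \<sigma> y = b y}"

lemma agree_empty [simp]: "agree {} b = UNIV"
  by (simp add: agree_def)

lemma agree_Un: "agree (V \<union> W) b = agree V b \<inter> agree W b"
  by (auto simp: agree_def)

lemma agree_insert: "agree (insert x V) b = {\<sigma>. \<sigma> x = b x} \<inter> agree V b"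
  by (auto simp: agree_def)

lemma agree_cong: "(\<And>y. y \<in> V \<Longrightarrow> b y = c y) \<Longrightarrow> agree V b = agree V c"
  by (auto simp: agree_def)

lemma restrict_eq_iff: "restrict f V = restrict g V \<longleftrightarrow> (\<forall>y\<in>V. f y = g y)"
  by (auto simp: restrict_def fun_eq_iff)

text \<open>Patterns are handled as total configurations that are read only on V, so that unions and
  translates of V need no change of the pattern. This is the passage back to the extensional
  patterns of \<open>cylinder\<close>.\<close>

lemma cylinder_restrict: "cylinder V (restrict \<xi> V) = agree V \<xi>"
  by (auto simp: cylinder_def agree_def restrict_eq_iff)

lemma cylinder_pattern: "a \<in> patterns V \<Longrightarrow> cylinder V a = agree V a"
  using cylinder_restrict[of V a] by (simp add: restrict_PiE_iff PiE_restrict)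

lemma finite_patterns: "finite V \<Longrightarrow> finite (V \<rightarrow>\<^sub>E (UNIV :: 'a::finite set))"
  by (simp add: finite_PiE)

lemma restrict_in_patterns [simp]: "restrict \<xi> V \<in> patterns V"
  by auto

lemma space_local_sigma [simp]: "space (local_sigma V) = UNIV"
  by (simp add: local_sigma_def)

lemma sets_local_sigma:
  "sets (local_sigma V) = sigma_sets UNIV {{\<sigma>. \<sigma> x = a} | x a. x \<in> V}"
  by (simp add: local_sigma_def)

lemma UNIV_local_sigma [simp]: "UNIV \<in> sets (local_sigma V)"
  using sets.top[of "local_sigma V"] by simp

lemma site_in_local_sigma: "x \<in> V \<Longrightarrow> {\<sigma>. \<sigma> x = a} \<in> sets (local_sigma V)"
  by (auto simp: sets_local_sigma)

lemma local_sigma_mono: "V \<subseteq> W \<Longrightarrow> sets (local_sigma V) \<subseteq> sets (local_sigma W)"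
  unfolding sets_local_sigma by (rule sigma_sets_mono') auto

lemma agree_in_local_sigma:
  assumes "finite D" "D \<subseteq> V" shows "agree D b \<in> sets (local_sigma V)"
  using assms
proof (induction rule: finite_induct)
  case empty
  then show ?case by simp
next
  case (insert x F)
  then show ?case by (auto simp: agree_insert intro!: sets.Int site_in_local_sigma)
qed

lemma space_config_space [simp]: "space config_space = UNIV"
  by (simp add: config_space_def space_PiM)

lemma site_in_config_space:
  "{\<sigma> :: ('d::finite, 'a::finite) config. \<sigma> x = a} \<in> sets config_space"
proof -
  have "(\<lambda>\<sigma>. \<sigma> x) \<in> measurable (config_space :: ('d, 'a) config measure) (count_space UNIV)"
    unfolding config_space_def by (rule measurable_component_singleton) simp
  from measurable_sets[OF this, of "{a}"] show ?thesis by (simp add: vimage_def)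
qed

lemma local_sigma_subset_config_space: "sets (local_sigma V) \<subseteq> sets config_space"
  unfolding sets_local_sigma
  by (rule sets.sigma_sets_subset[of _ config_space, simplified]) (auto simp: site_in_config_space)

lemma agree_in_config_space: "finite D \<Longrightarrow> agree D b \<in> sets config_space"
  using agree_in_local_sigma[of D UNIV b] local_sigma_subset_config_space by auto

section \<open>Translations and lattice geometry\<close>

lemma shift_shift: "shift x (shift y \<sigma>) = shift (x + y) \<sigma>"
  by (simp add: shift_def add_ac)

lemma shift_0 [simp]: "shift 0 \<sigma> = \<sigma>"
  by (simp add: shift_def)

lemma shift_measurable: "shift x \<in> measurable config_space config_space"
  unfolding config_space_def
proof (rule measurable_PiM_single')
  show "(\<lambda>\<omega>. shift x \<omega> i) \<in> measurable (\<Pi>\<^sub>M i\<in>UNIV. count_space UNIV) (count_space UNIV)" for i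
    unfolding shift_def by (rule measurable_component_singleton) simp
qed auto

lemma vimage_shift_agree: "shift x -` agree V b = agree ((+) x ` V) (\<lambda>y. b (y - x))"
  by (auto simp: agree_def shift_def)

lemma agree_translate: "agree ((+) x ` V) \<xi> = shift x -` agree V (shift x \<xi>)"
  by (auto simp: agree_def shift_def)

lemma cube_conv_image: "cube n = (\<lambda>f. \<chi> i. f i) ` (UNIV \<rightarrow>\<^sub>E {0..int n})"
proof
  show "cube n \<subseteq> (\<lambda>f. \<chi> i. f i) ` (UNIV \<rightarrow>\<^sub>E {0..int n})"
  proof
    fix x :: "int ^ 'd" assume "x \<in> cube n"
    then have "x = (\<chi> i. (\<lambda>i. x $ i) i)" "(\<lambda>i. x $ i) \<in> UNIV \<rightarrow>\<^sub>E {0..int n}"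
      by (auto simp: cube_def)
    then show "x \<in> (\<lambda>f. \<chi> i. f i) ` (UNIV \<rightarrow>\<^sub>E {0..int n})" by blast
  qed
qed (auto simp: cube_def)

lemma finite_cube [simp]: "finite (cube n)"
  unfolding cube_conv_image by (intro finite_imageI finite_PiE) auto

lemma card_cube: "card (cube n :: 'd::finite site set) = (n + 1) ^ CARD('d)"
proof -
  have "card (cube n :: 'd site set) = card ((UNIV :: 'd set) \<rightarrow>\<^sub>E {0..int n})"
    unfolding cube_conv_image by (rule card_image) (auto simp: inj_on_def vec_eq_iff)
  also have "\<dots> = (n + 1) ^ CARD('d)"
    by (subst card_PiE) (auto simp: nat_add_distrib)
  finally show ?thesis .
qed

lemma zero_in_cube [simp]: "0 \<in> cube n"
  by (simp add: cube_def)

lemma cube_mono: "m \<le> n \<Longrightarrow> cube m \<subseteq> cube n"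
  by (auto simp: cube_def intro: order_trans)

lemma card_translate [simp]: "card ((+) (x :: 'd::finite site) ` V) = card V"
  by (rule card_image) simp

lemma l1_norm_nonneg: "0 \<le> l1_norm x"
  by (simp add: l1_norm_def sum_nonneg)

lemma abs_le_l1_norm: "\<bar>x $ i\<bar> \<le> l1_norm x"
  unfolding l1_norm_def by (rule member_le_sum) auto

lemma l1_norm_pos_iff: "l1_norm x > 0 \<longleftrightarrow> x \<noteq> 0"
proof
  assume "x \<noteq> 0"
  then obtain i where "x $ i \<noteq> 0" by (auto simp: vec_eq_iff)
  then show "l1_norm x > 0" using abs_le_l1_norm[of x i] by linarith
qed (auto simp: l1_norm_def)

lemma l1_norm_triangle: "l1_norm (x + y) \<le> l1_norm x + l1_norm y"
  by (simp add: l1_norm_def flip: sum.distrib) (intro sum_mono abs_triangle_ineq)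

lemma l1_norm_minus_commute: "l1_norm (x - y) = l1_norm (y - x)"
  by (simp add: l1_norm_def abs_minus_commute)

lemma l1_norm_cube_diff:
  assumes "x \<in> cube n" "y \<in> cube n"
  shows "l1_norm (x - y :: 'd::finite site) \<le> int CARD('d) * int n"
proof -
  have "l1_norm (x - y) \<le> (\<Sum>i\<in>(UNIV :: 'd set). int n)"
    unfolding l1_norm_def
  proof (rule sum_mono)
    fix i
    have "0 \<le> x $ i \<and> x $ i \<le> int n" "0 \<le> y $ i \<and> y $ i \<le> int n"
      using assms by (auto simp: cube_def)
    then show "\<bar>(x - y) $ i\<bar> \<le> int n" by simp linarith
  qed
  then show ?thesis by simp
qed

lemma le_site_distI:
  assumes "finite A" "A \<noteq> {}" "finite B" "B \<noteq> {}"
    and "\<And>x y. x \<in> A \<Longrightarrow> y \<in> B \<Longrightarrow> m \<le> real_of_int (l1_norm (x - y))"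
  shows "m \<le> real_of_int (site_dist A B)"
proof -
  have "site_dist A B \<in> (\<lambda>(x, y). l1_norm (x - y)) ` (A \<times> B)"
    unfolding site_dist_def by (rule Min_in) (use assms in auto)
  then show ?thesis using assms(5) by auto
qed

lemma card_box_le:
  fixes S :: "'d::finite site set"
  assumes "\<And>z i. z \<in> S \<Longrightarrow> \<bar>z $ i - x $ i\<bar> \<le> int r"
  shows "finite S" "card S \<le> (2 * r + 1) ^ CARD('d)"
proof -
  let ?t = "x - (\<chi> i. int r)"
  have sub: "S \<subseteq> (+) ?t ` cube (2 * r)"
  proof
    fix z assume "z \<in> S"
    then have "z - ?t \<in> cube (2 * r)"
      using assms[OF \<open>z \<in> S\<close>] by (auto simp: cube_def abs_le_iff algebra_simps)
    then have "?t + (z - ?t) \<in> (+) ?t ` cube (2 * r)" by (rule imageI)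
    then show "z \<in> (+) ?t ` cube (2 * r)" by simp
  qed
  show "finite S" by (rule finite_subset[OF sub]) simp
  have "card S \<le> card ((+) ?t ` cube (2 * r))" by (rule card_mono[OF _ sub]) simp
  then show "card S \<le> (2 * r + 1) ^ CARD('d)" by (simp add: card_cube)
qed

section \<open>Translation-invariant fields and functions of finitely many sites\<close>

locale shift_field =
  fixes M :: "('d::finite, 'a::finite) config measure"
  assumes random_field: "random_field M" and invariant: "translation_invariant M"
begin

sublocale prob_space M
  using random_field by (simp add: random_field_def)

lemma sets_M [measurable_cong]: "sets M = sets config_space"
  using random_field by (simp add: random_field_def)

lemma space_M [simp]: "space M = UNIV"
  using sets_eq_imp_space_eq[OF sets_M] by simp

lemma agree_sets [simp]: "finite D \<Longrightarrow> agree D b \<in> sets M"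
  by (simp add: sets_M agree_in_config_space)

lemma local_sigma_sets: "E \<in> sets (local_sigma V) \<Longrightarrow> E \<in> sets M"
  using local_sigma_subset_config_space by (auto simp: sets_M)

lemma shift_measurable_M [measurable]: "shift x \<in> measurable M M"
  using shift_measurable measurable_cong_sets[OF sets_M sets_M] by blast

lemma distr_shift: "distr M M (shift x) = M"
  using invariant by (simp add: translation_invariant_def)

lemma measure_vimage_shift:
  assumes "E \<in> sets M" shows "prob (shift x -` E) = prob E"
  using measure_distr[OF shift_measurable_M assms, of x] distr_shift[of x] by simp

lemma integral_shift:
  fixes f :: "('d, 'a) config \<Rightarrow> real"
  assumes [measurable]: "f \<in> borel_measurable M"
  shows "(\<integral>\<omega>. f (shift x \<omega>) \<partial>M) = (\<integral>\<omega>. f \<omega> \<partial>M)"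
  using integral_distr[OF shift_measurable_M assms, of x] distr_shift[of x] by simp

lemma measure_agree_translate:
  "finite V \<Longrightarrow> prob (agree ((+) x ` V) \<xi>) = prob (agree V (shift x \<xi>))"
  by (simp add: agree_translate measure_vimage_shift)

text \<open>The cylinders over the patterns on V partition the space, so f is a finite combination
  of indicators. Entropies thereby become finite sums.\<close>

lemma pattern_measurable:
  fixes f :: "('d, 'a) config \<Rightarrow> real"
  assumes "finite V" and "\<And>\<xi> \<eta>. (\<And>y. y \<in> V \<Longrightarrow> \<xi> y = \<eta> y) \<Longrightarrow> f \<xi> = f \<eta>"
  shows "f \<xi> = (\<Sum>a\<in>patterns V. f a * indicator (agree V a) \<xi>)" "f \<in> borel_measurable M"
proof -
  have *: "f \<xi> = (\<Sum>a\<in>patterns V. f a * indicator (agree V a) \<xi>)" for \<xi>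
  proof -
    have "(\<Sum>a\<in>patterns V. f a * indicator (agree V a) \<xi>) =
        (\<Sum>a\<in>patterns V. if a = restrict \<xi> V then f a else 0)"
    proof (rule sum.cong[OF refl])
      fix a :: "('d, 'a) config" assume "a \<in> patterns V"
      then have "\<xi> \<in> agree V a \<longleftrightarrow> a = restrict \<xi> V"
        by (auto simp: agree_def fun_eq_iff PiE_def extensional_def)
      then show "f a * indicator (agree V a) \<xi> = (if a = restrict \<xi> V then f a else 0)"
        by (cases "a = restrict \<xi> V") (simp_all only: indicator_simps if_True if_False simp_thms mult_1_right mult_zero_right)
    qed
    also have "\<dots> = f (restrict \<xi> V)"
      by (simp only: sum.delta'[OF finite_patterns[OF assms(1)]] restrict_in_patterns if_True sum.delta[OF finite_patterns[OF assms(1)]])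
    also have "\<dots> = f \<xi>" by (rule assms(2)) simp
    finally show ?thesis by simp
  qed
  show "f \<xi> = (\<Sum>a\<in>patterns V. f a * indicator (agree V a) \<xi>)" by (rule *)
  have "(\<lambda>\<xi>. \<Sum>a\<in>patterns V. f a * indicator (agree V a) \<xi>) \<in> borel_measurable M"
    by (intro borel_measurable_sum borel_measurable_times borel_measurable_indicator
        borel_measurable_const agree_sets assms)
  then show "f \<in> borel_measurable M" by (subst (asm) *[symmetric])
qed

lemma pattern_integral:
  fixes f :: "('d, 'a) config \<Rightarrow> real"
  assumes "finite V" and "\<And>\<xi> \<eta>. (\<And>y. y \<in> V \<Longrightarrow> \<xi> y = \<eta> y) \<Longrightarrow> f \<xi> = f \<eta>"
  shows "integrable M f" "(\<integral>\<xi>. f \<xi> \<partial>M) = (\<Sum>a\<in>patterns V. f a * prob (agree V a))"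
proof -
  have f: "f = (\<lambda>\<xi>. \<Sum>a\<in>patterns V. f a * indicator (agree V a) \<xi>)"
    using pattern_measurable(1)[of V f, OF assms] by (rule ext)
  have int: "integrable M (\<lambda>\<xi>. f a * indicator (agree V a) \<xi> :: real)" for a
    using assms(1) by (intro integrable_mult_right integrable_real_indicator) (auto simp: emeasure_eq_measure)
  show "integrable M f" by (subst f) (rule Bochner_Integration.integrable_sum, rule int)
  show "(\<integral>\<xi>. f \<xi> \<partial>M) = (\<Sum>a\<in>patterns V. f a * prob (agree V a))"
    by (subst f, subst Bochner_Integration.integral_sum[OF int]) (simp add: assms(1))
qed

end

section \<open>Tilings and entropy density\<close>

text \<open>Only the splitting off of a block is assumed, not subadditivity for all pairs of sets:
  for a Gibbs field the error e is governed by the boundary of the block alone, while the remaining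
  set may be arbitrarily irregular. One error is paid per block.\<close>

lemma blocks_subadditive:
  fixes F :: "'i set \<Rightarrow> real"
  assumes split: "\<And>x D. finite D \<Longrightarrow> D \<inter> B x = {} \<Longrightarrow> F (B x \<union> D) \<le> F (B x) + F D + e"
    and fin: "\<And>x. finite (B x)"
    and "finite X" "disjoint_family_on B X" "finite R" "R \<inter> (\<Union>x\<in>X. B x) = {}"
  shows "F ((\<Union>x\<in>X. B x) \<union> R) \<le> (\<Sum>x\<in>X. F (B x) + e) + F R"
  using assms(3-6)
proof (induction X rule: finite_induct)
  case (insert x X)
  let ?U = "\<Union>x\<in>X. B x"
  have "F (B x \<union> (?U \<union> R)) \<le> F (B x) + F (?U \<union> R) + e"
  proof (rule split)
    show "finite (?U \<union> R)" using insert fin by auto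
    have "?U \<inter> B x = {}"
      using insert.prems(1) insert.hyps(2) unfolding disjoint_family_on_def by fastforce
    then show "(?U \<union> R) \<inter> B x = {}" using insert.prems by blast
  qed
  moreover have "F (?U \<union> R) \<le> (\<Sum>x\<in>X. F (B x) + e) + F R"
    by (rule insert.IH) (use insert.prems in \<open>auto simp: disjoint_family_on_def\<close>)
  moreover have "(\<Union>x\<in>insert x X. B x) \<union> R = B x \<union> (?U \<union> R)" by auto
  ultimately show ?case using insert.hyps by simp
qed simp

lemma translated_cube_subset:
  assumes "L > 0" "L \<le> n + 1" "x \<in> cube (n + 1 - L)"
  shows "(+) x ` cube (L - 1) \<subseteq> cube n"
proof
  fix y assume "y \<in> (+) x ` cube (L - 1)"
  then obtain z where z: "z \<in> cube (L - 1)" "y = x + z" by auto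
  have "0 \<le> y $ i \<and> y $ i \<le> int n" for i
  proof -
    have "0 \<le> x $ i" "x $ i \<le> int (n + 1 - L)" "0 \<le> z $ i" "z $ i \<le> int (L - 1)"
      using z assms by (auto simp: cube_def)
    then show ?thesis using assms(1,2) z by (auto simp: of_nat_diff)
  qed
  then show "y \<in> cube n" by (simp add: cube_def)
qed

text \<open>Overlapping translates differ by less than L in each coordinate, and a multiple of L
  that small is 0. Each residue class modulo L is thus one offset of the tiling.\<close>

lemma congruent_cubes_disjoint:
  assumes "L > 0" "\<And>i. x $ i mod int L = y $ i mod int L" "x \<noteq> y"
  shows "(+) x ` cube (L - 1) \<inter> (+) y ` cube (L - 1) = {}"
proof (rule ccontr)
  assume "(+) x ` cube (L - 1) \<inter> (+) y ` cube (L - 1) \<noteq> {}"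
  then obtain u w where uw: "u \<in> cube (L - 1)" "w \<in> cube (L - 1)" "x + u = y + w" by auto
  have "x $ i = y $ i" for i
  proof -
    have "x $ i + u $ i = y $ i + w $ i" using uw(3) by (metis vector_add_component)
    moreover have "0 \<le> u $ i" "u $ i \<le> int (L - 1)" "0 \<le> w $ i" "w $ i \<le> int (L - 1)"
      using uw by (auto simp: cube_def)
    ultimately have "\<bar>x $ i - y $ i\<bar> < int L" using assms(1) by (auto simp: of_nat_diff)
    moreover have "int L dvd x $ i - y $ i" using assms(2) by (simp add: mod_eq_dvd_iff)
    ultimately show ?thesis using zdvd_imp_le[of "int L" "\<bar>x $ i - y $ i\<bar>"] by fastforce
  qed
  then show False using assms(3) by (simp add: vec_eq_iff)
qed

text \<open>The offset of the tiling by translates of \<open>cube (L - 1)\<close> is averaged over all its \<open>L\<^sup>d\<close>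
  values, which turns the sum over tiles into a sum over all translates.\<close>

lemma cube_tiling:
  fixes F :: "'d::finite site set \<Rightarrow> real"
  assumes L: "L > 0" "L \<le> n + 1"
    and split: "\<And>x D. finite D \<Longrightarrow> D \<inter> (+) x ` cube (L - 1) = {} \<Longrightarrow>
      F ((+) x ` cube (L - 1) \<union> D) \<le> F ((+) x ` cube (L - 1)) + F D + e"
    and triv: "\<And>D. finite D \<Longrightarrow> F D \<le> K * real (card D)"
  shows "real L ^ CARD('d) * F (cube n) \<le> (\<Sum>x\<in>cube (n + 1 - L). F ((+) x ` cube (L - 1)) + e) +
    K * real L ^ CARD('d) * (real (n + 1) ^ CARD('d) - real (n + 2 - L) ^ CARD('d))"
proof -
  let ?N = "CARD('d)" and ?S = "cube (n + 1 - L) :: 'd site set"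
  define B where "B x = (+) x ` (cube (L - 1) :: 'd site set)" for x
  define X where "X v = {x \<in> ?S. (\<chi> i. x $ i mod int L) = v}" for v :: "'d site"
  have fX: "finite (X v)" for v by (simp add: X_def)
  have fB: "finite (B x)" for x by (simp add: B_def)
  have cB: "card (B x) = L ^ ?N" for x using L by (simp add: B_def card_cube)
  have dis: "disjoint_family_on B (X v)" for v
    unfolding disjoint_family_on_def B_def
  proof (intro ballI impI congruent_cubes_disjoint[OF L(1)])
    fix x y i assume "x \<in> X v" "y \<in> X v"
    then have "(\<chi> i. x $ i mod int L) = (\<chi> i. y $ i mod int L)" by (simp add: X_def)
    then show "x $ i mod int L = y $ i mod int L" by (simp add: vec_eq_iff)
  qed
  \<comment> \<open>For a fixed offset v the tiles inside \<open>cube n\<close> are split off one by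
    one, and each uncovered site is charged K.\<close>
  have one: "F (cube n) \<le> (\<Sum>x\<in>X v. F (B x) + e) + (K * real (n + 1) ^ ?N - (\<Sum>x\<in>X v. K * real L ^ ?N))" for v
  proof -
    let ?U = "\<Union>x\<in>X v. B x"
    have sub: "?U \<subseteq> cube n"
      unfolding B_def X_def using translated_cube_subset[OF L] by blast
    have fU: "finite ?U" by (rule finite_subset[OF sub]) simp
    have cU: "card ?U = card (X v) * L ^ ?N"
      by (subst card_UN_disjoint)
        (use dis[of v] fX in \<open>simp_all only: cB fB disjoint_family_on_def sum_constant of_nat_id\<close>, auto)
    have "card (cube n - ?U) = (n + 1) ^ ?N - card (X v) * L ^ ?N"
      by (subst card_Diff_subset[OF fU sub]) (simp add: cU card_cube)
    moreover have "card (X v) * L ^ ?N \<le> (n + 1) ^ ?N"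
      using card_mono[OF finite_cube sub] by (simp add: cU card_cube)
    ultimately have "real (card (cube n - ?U)) = real (n + 1) ^ ?N - real (card (X v)) * real L ^ ?N"
      by (simp only: of_nat_diff of_nat_power of_nat_mult)
    then have "F (cube n - ?U) \<le> K * (real (n + 1) ^ ?N - real (card (X v)) * real L ^ ?N)"
      using triv[of "cube n - ?U"] by simp
    moreover have "F (?U \<union> (cube n - ?U)) \<le> (\<Sum>x\<in>X v. F (B x) + e) + F (cube n - ?U)"
      by (rule blocks_subadditive) (use split dis[of v] fX fB in \<open>auto simp: B_def[abs_def]\<close>)
    moreover have "?U \<union> (cube n - ?U) = cube n" using sub by blast
    ultimately show ?thesis by (simp add: algebra_simps)
  qed
  have grp: "(\<Sum>v\<in>cube (L - 1). \<Sum>x\<in>X v. g x) = (\<Sum>x\<in>?S. g x)" for g :: "'d site \<Rightarrow> real"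
    unfolding X_def
  proof (rule sum.group)
    show "(\<lambda>x. \<chi> i. x $ i mod int L) ` ?S \<subseteq> cube (L - 1)"
      using L by (auto simp: cube_def of_nat_diff pos_mod_bound zle_diff1_eq)
  qed auto
  have "real L ^ ?N * F (cube n) = (\<Sum>v\<in>(cube (L - 1) :: 'd site set). F (cube n))"
    using L by (simp add: card_cube)
  also have "\<dots> \<le> (\<Sum>v\<in>cube (L - 1). (\<Sum>x\<in>X v. F (B x) + e) +
      (K * real (n + 1) ^ ?N - (\<Sum>x\<in>X v. K * real L ^ ?N)))"
    by (rule sum_mono) (rule one)
  also have "\<dots> = (\<Sum>x\<in>?S. F (B x) + e) + (real L ^ ?N * (K * real (n + 1) ^ ?N) - (\<Sum>x\<in>?S. K * real L ^ ?N))"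
    using L by (simp only: sum.distrib sum_subtractf grp) (simp add: card_cube)
  also have "(\<Sum>x\<in>?S. K * real L ^ ?N) = real (n + 2 - L) ^ ?N * (K * real L ^ ?N)"
    using L by (simp add: card_cube Suc_diff_le)
  finally show ?thesis by (simp add: B_def algebra_simps)
qed

text \<open>For 1 \<le> L \<le> n + 1 this is the number of translates of
  \<open>cube (L - 1)\<close> inside \<open>cube n\<close>, divided by n^d. As \<open>cube n\<close>
  has side n + 1, the value L = 1 corrects the normalisation from n^d to (n + 1)^d. The type
  argument carries the dimension.\<close>

definition vol_ratio :: "'d::finite itself \<Rightarrow> nat \<Rightarrow> nat \<Rightarrow> real" where
  "vol_ratio _ L n = real (n + 2 - L) ^ CARD('d) / real n ^ CARD('d)"

lemma vol_ratio_tendsto: "vol_ratio TYPE('d::finite) L \<longlonglongrightarrow> 1"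
proof -
  have "(\<lambda>n. real (n + 2 - L) / real n) \<longlonglongrightarrow> 1"
  proof (rule Lim_transform_eventually)
    show "(\<lambda>n. 1 + (2 - real L) * (1 / real n)) \<longlonglongrightarrow> 1"
      using tendsto_add[OF tendsto_const[of 1] tendsto_mult[OF tendsto_const[of "2 - real L"] lim_1_over_n]] by simp
    show "\<forall>\<^sub>F n in sequentially. 1 + (2 - real L) * (1 / real n) = real (n + 2 - L) / real n"
      using eventually_gt_at_top[of L] by eventually_elim (auto simp: of_nat_diff field_simps)
  qed
  from tendsto_power[OF this, of "CARD('d)"] show ?thesis
    by (simp add: vol_ratio_def[abs_def] power_divide)
qed

lemma cube_tiling_density:
  fixes F :: "'d::finite site set \<Rightarrow> real"
  assumes L: "L > 0" "L \<le> n + 1" and n: "n > 0"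
    and split: "\<And>x D. finite D \<Longrightarrow> D \<inter> (+) x ` cube (L - 1) = {} \<Longrightarrow>
      F ((+) x ` cube (L - 1) \<union> D) \<le> F ((+) x ` cube (L - 1)) + F D + e"
    and triv: "\<And>D. finite D \<Longrightarrow> F D \<le> K * real (card D)"
  shows "F (cube n) / real n ^ CARD('d) \<le>
    (\<Sum>x\<in>cube (n + 1 - L). F ((+) x ` cube (L - 1))) / (real L ^ CARD('d) * real n ^ CARD('d)) +
    e / real L ^ CARD('d) * vol_ratio TYPE('d) L n +
    K * (vol_ratio TYPE('d) 1 n - vol_ratio TYPE('d) L n)"
proof -
  let ?N = "CARD('d)"
  let ?S = "\<Sum>x\<in>cube (n + 1 - L). F ((+) x ` cube (L - 1))"
  have pos: "real L ^ ?N > 0" "real n ^ ?N > 0" using L n by auto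
  have "(\<Sum>x\<in>cube (n + 1 - L). F ((+) x ` cube (L - 1)) + e) = ?S + real (n + 2 - L) ^ ?N * e"
    using L by (simp add: sum.distrib card_cube Suc_diff_le)
  then have "real L ^ ?N * F (cube n) \<le> ?S + real (n + 2 - L) ^ ?N * e +
    K * real L ^ ?N * (real (n + 1) ^ ?N - real (n + 2 - L) ^ ?N)"
    using cube_tiling[OF L split triv] by simp
  then have "F (cube n) / real n ^ ?N \<le> (?S + real (n + 2 - L) ^ ?N * e +
    K * real L ^ ?N * (real (n + 1) ^ ?N - real (n + 2 - L) ^ ?N)) / (real L ^ ?N * real n ^ ?N)"
    using pos by (simp add: divide_simps mult.commute mult.left_commute)
  also have "\<dots> = ?S / (real L ^ ?N * real n ^ ?N) + e / real L ^ ?N * vol_ratio TYPE('d) L n +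
    K * (vol_ratio TYPE('d) 1 n - vol_ratio TYPE('d) L n)"
    using pos by (simp add: vol_ratio_def field_simps)
  finally show ?thesis .
qed

text \<open>Fekete's lemma for cubes, with limit the infimum of
  \<open>F (cube (L - 1)) / L^d\<close>: tiling bounds the limit superior by every member of this
  family.\<close>

lemma subadditive_density_convergent:
  fixes F :: "'d::finite site set \<Rightarrow> real"
  assumes sub: "\<And>V W. finite V \<Longrightarrow> finite W \<Longrightarrow> V \<inter> W = {} \<Longrightarrow> F (V \<union> W) \<le> F V + F W"
    and transl: "\<And>x V. finite V \<Longrightarrow> F ((+) x ` V) = F V"
    and bds: "\<And>V. finite V \<Longrightarrow> 0 \<le> F V" "\<And>V. finite V \<Longrightarrow> F V \<le> K * real (card V)"
  shows "convergent (\<lambda>n. F (cube n) / real n ^ CARD('d))"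
proof -
  let ?N = "CARD('d)" and ?u = "\<lambda>n. F (cube n) / real n ^ CARD('d)"
  define c where "c L = F (cube (L - 1)) / real L ^ ?N" for L
  have up: "\<forall>\<^sub>F n in sequentially. ?u n \<le> c L * vol_ratio TYPE('d) L n +
      K * (vol_ratio TYPE('d) 1 n - vol_ratio TYPE('d) L n)" if L: "L > 0" for L
    using eventually_ge_at_top[of "max 1 L"]
  proof eventually_elim
    case (elim n)
    have "?u n \<le> (\<Sum>x\<in>cube (n + 1 - L). F ((+) x ` cube (L - 1))) / (real L ^ ?N * real n ^ ?N) +
        0 / real L ^ ?N * vol_ratio TYPE('d) L n + K * (vol_ratio TYPE('d) 1 n - vol_ratio TYPE('d) L n)"
      by (rule cube_tiling_density) (use L elim sub bds in \<open>auto simp: Int_commute\<close>)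
    also have "(\<Sum>x\<in>cube (n + 1 - L). F ((+) x ` cube (L - 1))) = real (n + 2 - L) ^ ?N * F (cube (L - 1))"
      using elim by (simp add: transl card_cube Suc_diff_le)
    finally show ?case by (simp add: c_def vol_ratio_def mult.commute)
  qed
  let ?I = "INF L\<in>{1..}. c L"
  have bdd: "bdd_below (c ` {1..})" by (rule bdd_belowI[of _ 0]) (auto simp: c_def bds)
  have "?u \<longlonglongrightarrow> ?I"
  proof (rule LIMSEQ_I)
    fix r :: real assume "r > 0"
    then obtain L where L: "L \<ge> 1" "c L < ?I + r / 2"
      using cINF_less_iff[OF _ bdd, of "?I + r / 2"] by auto
    have "(\<lambda>n. c L * vol_ratio TYPE('d) L n + K * (vol_ratio TYPE('d) 1 n - vol_ratio TYPE('d) L n))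
        \<longlonglongrightarrow> c L * 1 + K * (1 - 1)"
      by (intro tendsto_intros vol_ratio_tendsto)
    then have "\<forall>\<^sub>F n in sequentially. c L * vol_ratio TYPE('d) L n +
        K * (vol_ratio TYPE('d) 1 n - vol_ratio TYPE('d) L n) < c L + r / 2"
      by (rule order_tendstoD) (use \<open>r > 0\<close> in simp)
    moreover have "\<forall>\<^sub>F n in sequentially. ?I \<le> ?u n"
      using eventually_gt_at_top[of 0]
    proof eventually_elim
      \<comment> \<open>The cube itself is the member L = n + 1 of the family; passing from the
        divisor (n + 1)^d to n^d only enlarges the quotient, as F is nonnegative.\<close>
      case (elim n)
      have "?I \<le> c (n + 1)" by (rule cINF_lower[OF bdd]) simp
      also have "\<dots> \<le> ?u n"
        using elim bds(1)[of "cube n"] power_mono[of "real n" "1 + real n" ?N]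
        unfolding c_def by (intro frac_le) auto
      finally show ?case .
    qed
    moreover have "L > 0" using L by simp
    note up[OF this]
    ultimately have "\<forall>\<^sub>F n in sequentially. norm (?u n - ?I) < r"
    proof eventually_elim
      case (elim n)
      have "?u n < ?I + r" using elim(1,3) L(2) by linarith
      then show ?case using elim(2) by simp
    qed
    then show "\<exists>no. \<forall>n\<ge>no. norm (?u n - ?I) < r" by (simp add: eventually_sequentially)
  qed
  then show ?thesis by (auto simp: convergent_def)
qed

text \<open>For each L the sequence x eventually stays within about b L of c L, so it is Cauchy, and
  its limit is within b L of c L. The limit is therefore also that of c, which makes it
  deterministic when x depends on a configuration and c does not.\<close>

lemma tendsto_from_approximations:
  fixes x c b :: "nat \<Rightarrow> real"
  assumes approx: "\<And>L \<eta>. \<eta> > 0 \<Longrightarrow> \<forall>\<^sub>F n in sequentially. \<bar>x n - c L\<bar> \<le> b L + \<eta>"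
    and b: "b \<longlonglongrightarrow> 0"
  shows "\<exists>l. c \<longlonglongrightarrow> l \<and> x \<longlonglongrightarrow> l"
proof -
  have "Cauchy x"
  proof (rule metric_CauchyI)
    fix r :: real assume "r > 0"
    then have "\<forall>\<^sub>F L in sequentially. b L < r / 4" by (intro order_tendstoD[OF b]) simp
    then obtain L where "b L < r / 4" by (auto simp: eventually_sequentially)
    moreover obtain M where "\<forall>n\<ge>M. \<bar>x n - c L\<bar> \<le> b L + r / 4"
      using approx[of "r / 4" L] \<open>r > 0\<close> by (auto simp: eventually_sequentially)
    ultimately have "\<forall>n\<ge>M. \<bar>x n - c L\<bar> < r / 2" by fastforce
    then have "\<forall>m\<ge>M. \<forall>n\<ge>M. dist (x m) (x n) < r"
      unfolding dist_real_def by (smt (verit) field_sum_of_halves)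
    then show "\<exists>M. \<forall>m\<ge>M. \<forall>n\<ge>M. dist (x m) (x n) < r" by blast
  qed
  then obtain l where l: "x \<longlonglongrightarrow> l" using Cauchy_convergent convergent_def by blast
  have "\<bar>l - c L\<bar> \<le> b L" for L
  proof (rule field_le_epsilon)
    fix \<eta> :: real assume "\<eta> > 0"
    have "(\<lambda>n. \<bar>x n - c L\<bar>) \<longlonglongrightarrow> \<bar>l - c L\<bar>" by (intro tendsto_intros l)
    then show "\<bar>l - c L\<bar> \<le> b L + \<eta>"
      by (rule tendsto_upperbound[OF _ approx[OF \<open>\<eta> > 0\<close>]]) simp
  qed
  then have "\<forall>\<^sub>F L in sequentially. norm (c L - l) \<le> b L"
    by (simp add: abs_minus_commute)
  then have "(\<lambda>L. c L - l) \<longlonglongrightarrow> 0"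
    using b by (rule Lim_null_comparison)
  then show ?thesis using l by (auto simp: LIM_zero_iff)
qed

section \<open>Shannon entropy of finite blocks\<close>

context shift_field
begin

definition shannon :: "'d site set \<Rightarrow> real" where
  "shannon V = (\<integral>\<xi>. - ln (prob (agree V \<xi>)) \<partial>M)"

lemma measure_agree_cong: "(\<And>y. y \<in> V \<Longrightarrow> \<xi> y = \<eta> y) \<Longrightarrow> prob (agree V \<xi>) = prob (agree V \<eta>)"
  using agree_cong[of V \<xi> \<eta>] by simp

lemma sum_patterns: "finite V \<Longrightarrow> (\<Sum>a\<in>patterns V. prob (agree V a)) = 1"
  using pattern_integral(2)[of V "\<lambda>_. 1"] prob_space by simp

lemma shannon_eq:
  assumes "finite V"
  shows "shannon V = (\<Sum>a\<in>patterns V. - ln (prob (agree V a)) * prob (agree V a))"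
  unfolding shannon_def
  by (rule pattern_integral(2)[OF assms], rule arg_cong[OF measure_agree_cong, where f = "\<lambda>q. - ln q"])

lemma shannon_integrable:
  assumes "finite V"
  shows "integrable M (\<lambda>\<xi>. - ln (prob (agree V \<xi>)))"
  by (rule pattern_integral(1)[OF assms], rule arg_cong[OF measure_agree_cong, where f = "\<lambda>q. - ln q"])

lemma measure_ln_le: "ln (prob A) \<le> 0"
  using prob_le_1[of A] ln_le_minus_one[of "prob A"]
  by (cases "prob A = 0") (auto simp: zero_less_measure_iff)

lemma shannon_nonneg: "finite V \<Longrightarrow> 0 \<le> shannon V"
  unfolding shannon_def by (intro Bochner_Integration.integral_nonneg) (auto simp: measure_ln_le)

text \<open>A pattern on the union is determined by its two restrictions, and the product weights of
  all pairs of patterns sum to 1.\<close>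

lemma sum_pattern_products_le:
  assumes "finite V" "finite W" "V \<inter> W = {}"
  shows "(\<Sum>c\<in>patterns (V \<union> W). prob (agree V c) * prob (agree W c)) \<le> 1"
proof -
  let ?r = "\<lambda>c :: ('d, 'a) config. (restrict c V, restrict c W)"
  have inj: "inj_on ?r (patterns (V \<union> W))"
  proof (rule inj_onI)
    fix c c' :: "('d, 'a) config"
    assume c: "c \<in> patterns (V \<union> W)" "c' \<in> patterns (V \<union> W)" "?r c = ?r c'"
    then have "\<forall>y\<in>V \<union> W. c y = c' y" by (auto simp: restrict_eq_iff)
    then show "c = c'" using c by (intro PiE_ext) auto
  qed
  have eq: "prob (agree V c) * prob (agree W c) =
      (case ?r c of (a, b) \<Rightarrow> prob (agree V a) * prob (agree W b))" for c
    using measure_agree_cong[of V c "restrict c V"] measure_agree_cong[of W c "restrict c W"] by simp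
  have "(\<Sum>c\<in>patterns (V \<union> W). prob (agree V c) * prob (agree W c)) =
      (\<Sum>(a, b)\<in>?r ` patterns (V \<union> W). prob (agree V a) * prob (agree W b))"
    by (subst sum.reindex[OF inj]) (simp add: eq)
  also have "\<dots> \<le> (\<Sum>(a, b)\<in>patterns V \<times> patterns W. prob (agree V a) * prob (agree W b))"
    by (rule sum_mono2) (auto intro!: finite_cartesian_product finite_patterns assms)
  also have "\<dots> = 1"
    by (simp add: sum_product[symmetric] sum.cartesian_product[symmetric] sum_patterns assms)
  finally show ?thesis .
qed

text \<open>Nonnegativity of the relative entropy of the joint law on V and W with respect to the
  product of its marginals, by ln t \<le> t - 1. Patterns of joint probability 0 add nothing to the
  entropy side and only lower the other.\<close>

lemma shannon_subadditive:
  assumes "finite V" "finite W" "V \<inter> W = {}"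
  shows "shannon (V \<union> W) \<le> shannon V + shannon W"
proof -
  let ?q = "\<lambda>V \<xi>. prob (agree V \<xi>)"
  have "shannon V + shannon W - shannon (V \<union> W) =
      (\<integral>\<xi>. (- ln (?q V \<xi>) + - ln (?q W \<xi>)) - - ln (?q (V \<union> W) \<xi>) \<partial>M)"
    unfolding shannon_def using shannon_integrable assms by simp
  also have "\<dots> = (\<Sum>c\<in>patterns (V \<union> W). ((- ln (?q V c) + - ln (?q W c)) - - ln (?q (V \<union> W) c)) * ?q (V \<union> W) c)"
  proof (rule pattern_integral(2))
    fix \<xi> \<eta> :: "('d, 'a) config"
    assume "\<And>y. y \<in> V \<union> W \<Longrightarrow> \<xi> y = \<eta> y"
    then have "?q V \<xi> = ?q V \<eta>" "?q W \<xi> = ?q W \<eta>" "?q (V \<union> W) \<xi> = ?q (V \<union> W) \<eta>"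
      by (auto intro!: measure_agree_cong)
    then show "(- ln (?q V \<xi>) + - ln (?q W \<xi>)) - - ln (?q (V \<union> W) \<xi>) =
        (- ln (?q V \<eta>) + - ln (?q W \<eta>)) - - ln (?q (V \<union> W) \<eta>)" by simp
  qed (use assms in simp)
  also have "\<dots> \<ge> (\<Sum>c\<in>patterns (V \<union> W). ?q (V \<union> W) c - ?q V c * ?q W c)"
  proof (rule sum_mono)
    fix c
    let ?a = "?q V c" and ?b = "?q W c" and ?c = "?q (V \<union> W) c"
    show "?c - ?a * ?b \<le> ((- ln ?a + - ln ?b) - - ln ?c) * ?c"
    proof (cases "?c = 0")
      case False
      then have c: "?c > 0" by (simp add: zero_less_measure_iff)
      have le: "?c \<le> ?a" "?c \<le> ?b"
        using assms by (auto intro!: finite_measure_mono simp: agree_Un)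
      with c have pos: "?a > 0" "?b > 0" by linarith+
      have "ln (?a * ?b / ?c) \<le> ?a * ?b / ?c - 1"
        by (rule ln_le_minus_one) (use c pos in simp)
      then have "ln ?a + ln ?b - ln ?c \<le> ?a * ?b / ?c - 1"
        using c pos by (simp add: ln_div ln_mult)
      then have "(ln ?a + ln ?b - ln ?c) * ?c \<le> (?a * ?b / ?c - 1) * ?c"
        by (rule mult_right_mono) simp
      also have "\<dots> = ?a * ?b - ?c" using c by (simp add: field_simps)
      finally show ?thesis by (simp add: algebra_simps)
    qed simp
  qed
  moreover have "(\<Sum>c\<in>patterns (V \<union> W). ?q (V \<union> W) c - ?q V c * ?q W c) \<ge> 0"
    using sum_pattern_products_le[OF assms] sum_patterns[of "V \<union> W"] assms by (simp add: sum_subtractf)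
  ultimately show ?thesis by linarith
qed

text \<open>Each term - q ln q is at most 1, a crude bound for one site that subadditivity carries
  to V. Only linearity in the number of sites matters.\<close>

lemma shannon_le:
  assumes "finite V" shows "shannon V \<le> real CARD('a) * real (card V)"
  using assms
proof (induction V rule: finite_induct)
  case empty
  then show ?case by (simp add: shannon_def prob_space[unfolded space_M])
next
  case (insert x V)
  have "shannon {x} \<le> (\<Sum>a\<in>(patterns {x} :: ('d, 'a) config set). 1)"
    unfolding shannon_eq[OF finite.insertI[OF finite.emptyI]]
  proof (intro sum_mono)
    fix a :: "('d, 'a) config"
    let ?q = "prob (agree {x} a)"
    show "- ln ?q * ?q \<le> 1"
    proof (cases "?q = 0")
      case False
      then have q: "?q > 0" by (simp add: zero_less_measure_iff)
      have "ln (1 / ?q) \<le> 1 / ?q - 1" by (rule ln_le_minus_one) (use q in simp)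
      then have "- ln ?q * ?q \<le> (1 / ?q - 1) * ?q"
        using q by (intro mult_right_mono) (simp_all add: ln_div)
      also have "\<dots> \<le> 1" using q by (simp add: field_simps)
      finally show ?thesis .
    qed simp
  qed
  also have "\<dots> = real CARD('a)" by (simp add: card_PiE)
  finally show ?case
    using shannon_subadditive[of "{x}" V] insert by (simp add: algebra_simps)
qed

lemma shannon_translate:
  assumes "finite V" shows "shannon ((+) x ` V) = shannon V"
  unfolding shannon_def measure_agree_translate[OF assms]
  by (rule integral_shift[where f = "\<lambda>\<xi>. - ln (prob (agree V \<xi>))"])
    (rule borel_measurable_integrable[OF shannon_integrable[OF assms]])

lemma shannon_density_convergent: "convergent (\<lambda>n. shannon (cube n) / real n ^ CARD('d))"
  by (rule subadditive_density_convergent[where K = "real CARD('a)"])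
    (auto intro: shannon_subadditive shannon_nonneg shannon_le simp: shannon_translate)

lemma block_entropy_eq: "block_entropy M n = shannon (cube n) / real n ^ CARD('d)"
proof -
  have "(\<Sum>a\<in>patterns (cube n). prob (cylinder (cube n) a) * ln (prob (cylinder (cube n) a))) =
      - shannon (cube n)"
    unfolding shannon_eq[OF finite_cube] sum_negf[symmetric]
    by (rule sum.cong) (auto simp: cylinder_pattern)
  then show ?thesis by (simp add: block_entropy_def)
qed

end

section \<open>The pointwise ergodic theorem for cubes\<close>

text \<open>Greedy selection: take the largest cube and discard all x whose cube meets it. Since
  cubes extend from their corner in the positive directions, the discarded corners lie within r of
  the chosen one in each coordinate, so there are at most (2 r + 1)^d \<le> 2^d (r + 1)^d of them.
  The cubes kept are disjoint.\<close>

lemma vitali_covering_sum: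
  fixes \<phi> :: "'d::finite site \<Rightarrow> real" and r :: "'d site \<Rightarrow> nat"
  assumes "finite E" and nonneg: "\<And>x. \<phi> x \<ge> 0" and "\<alpha> \<ge> 0"
    and large: "\<And>x. x \<in> E \<Longrightarrow> \<alpha> * real (r x + 1) ^ CARD('d) \<le> (\<Sum>y\<in>(+) x ` cube (r x). \<phi> y)"
  shows "\<alpha> * real (card E) \<le> 2 ^ CARD('d) * (\<Sum>y\<in>(\<Union>x\<in>E. (+) x ` cube (r x)). \<phi> y)"
  using assms(1) large
proof (induction E rule: finite_psubset_induct)
  case (psubset E)
  define B where "B x = (+) x ` (cube (r x) :: 'd site set)" for x
  have fB: "finite (B x)" for x by (simp add: B_def)
  show ?case
  proof (cases "E = {}")
    case False
    have "Max (r ` E) \<in> r ` E" using psubset.hyps False by (intro Max_in) auto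
    then obtain x where x: "x \<in> E" "r x = Max (r ` E)" by auto
    have max: "r y \<le> r x" if "y \<in> E" for y
      unfolding x(2) by (rule Max_ge) (use that psubset.hyps in auto)
    define E' where "E' = {y \<in> E. B y \<inter> B x = {}}"
    have "x \<in> B x" by (auto simp: B_def intro!: image_eqI[of _ _ 0])
    then have "x \<notin> E'" by (auto simp: E'_def)
    then have "E' \<subset> E" using x by (auto simp: E'_def)
    then have IH: "\<alpha> * real (card E') \<le> 2 ^ CARD('d) * (\<Sum>y\<in>(\<Union>x\<in>E'. B x). \<phi> y)"
      unfolding B_def by (rule psubset.IH) (use psubset.prems in \<open>auto simp: E'_def\<close>)
    have near: "\<bar>y $ i - x $ i\<bar> \<le> int (r x)" if "y \<in> E - E'" for y i
    proof -
      from that obtain z where "z \<in> B y" "z \<in> B x" by (auto simp: E'_def)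
      then obtain u w where "u \<in> cube (r y)" "w \<in> cube (r x)" "y + u = x + w"
        unfolding B_def by blast
      moreover from this(3) have "y $ i + u $ i = x $ i + w $ i" by (metis vector_add_component)
      ultimately have "0 \<le> u $ i" "u $ i \<le> int (r y)" "0 \<le> w $ i" "w $ i \<le> int (r x)"
          "y $ i + u $ i = x $ i + w $ i" by (auto simp: cube_def)
      moreover have "r y \<le> r x" using max that by blast
      ultimately show ?thesis by linarith
    qed
    have "card (E - E') \<le> (2 * r x + 1) ^ CARD('d)" by (rule card_box_le) (rule near)
    also have "\<dots> \<le> (2 * (r x + 1)) ^ CARD('d)" by (rule power_mono) auto
    finally have "real (card (E - E')) \<le> real ((2 * (r x + 1)) ^ CARD('d))"
      by (simp only: of_nat_le_iff)
    then have "real (card (E - E')) \<le> 2 ^ CARD('d) * real (r x + 1) ^ CARD('d)"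
      by (simp only: of_nat_power of_nat_mult of_nat_numeral power_mult_distrib)
    then have "\<alpha> * real (card (E - E')) \<le> 2 ^ CARD('d) * (\<alpha> * real (r x + 1) ^ CARD('d))"
      using mult_left_mono[OF _ \<open>\<alpha> \<ge> 0\<close>] by (simp only: mult.left_commute mult.assoc)
    also have "\<dots> \<le> 2 ^ CARD('d) * (\<Sum>y\<in>B x. \<phi> y)"
      unfolding B_def by (rule mult_left_mono[OF psubset.prems[OF x(1)]]) simp
    finally have "\<alpha> * real (card (E - E')) \<le> 2 ^ CARD('d) * (\<Sum>y\<in>B x. \<phi> y)" .
    moreover have "real (card E) = real (card E') + real (card (E - E'))"
      using card_Diff_subset[of E' E] card_mono[of E E'] psubset.hyps \<open>E' \<subset> E\<close>
      by (simp add: of_nat_diff finite_subset psubset_imp_subset)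
    ultimately have "\<alpha> * real (card E) \<le> 2 ^ CARD('d) * ((\<Sum>y\<in>(\<Union>x\<in>E'. B x). \<phi> y) + (\<Sum>y\<in>B x. \<phi> y))"
      using IH by (simp add: algebra_simps)
    also have "(\<Sum>y\<in>(\<Union>x\<in>E'. B x). \<phi> y) + (\<Sum>y\<in>B x. \<phi> y) = (\<Sum>y\<in>(\<Union>x\<in>E'. B x) \<union> B x. \<phi> y)"
      by (rule sum.union_disjoint[symmetric])
        (use fB finite_subset[OF psubset_imp_subset[OF \<open>E' \<subset> E\<close>] psubset.hyps] in \<open>auto simp: E'_def\<close>)
    also have "\<dots> \<le> (\<Sum>y\<in>(\<Union>x\<in>E. B x). \<phi> y)"
      by (rule sum_mono2) (use fB psubset.hyps nonneg x(1) in \<open>auto simp: E'_def\<close>)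
    finally show ?thesis by (simp add: B_def)
  qed simp
qed

definition box_average :: "nat \<Rightarrow> (('d::finite, 'a) config \<Rightarrow> real) \<Rightarrow> ('d, 'a) config \<Rightarrow> real" where
  "box_average n f \<omega> = (\<Sum>x\<in>cube n. f (shift x \<omega>)) / real (n + 1) ^ CARD('d)"

lemma sum_diff_overlap_le:
  fixes f :: "'i \<Rightarrow> real"
  assumes "finite A" "finite B" "card A = card B" "S \<subseteq> A" "S \<subseteq> B" "\<And>x. \<bar>f x\<bar> \<le> K"
  shows "\<bar>sum f A - sum f B\<bar> \<le> 2 * K * (real (card A) - real (card S))"
proof -
  have fS: "finite S" using assms finite_subset by blast
  have c: "\<bar>sum f (C - S)\<bar> \<le> K * (real (card A) - real (card S))"
    if "finite C" "card C = card A" "S \<subseteq> C" for C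
  proof -
    have "\<bar>sum f (C - S)\<bar> \<le> real (card (C - S)) * K"
      using sum_norm_bound[of "C - S" f K] assms(6) by simp
    also have "real (card (C - S)) = real (card A) - real (card S)"
      using that fS card_mono[of C S] by (simp add: card_Diff_subset of_nat_diff)
    finally show ?thesis by (simp add: mult.commute)
  qed
  have "sum f A = sum f (A - S) + sum f S" "sum f B = sum f (B - S) + sum f S"
    by (rule sum.subset_diff[OF assms(4,1)], rule sum.subset_diff[OF assms(5,2)])
  then show ?thesis using c[OF assms(1) refl assms(4)] c[OF assms(2) assms(3)[symmetric] assms(5)] by linarith
qed

lemma box_average_shift:
  fixes g :: "('d::finite, 'a) config \<Rightarrow> real"
  assumes bd: "\<And>\<omega>. \<bar>g \<omega>\<bar> \<le> K"
  shows "(\<lambda>n. box_average n g \<omega> - box_average n (\<lambda>\<omega>. g (shift x \<omega>)) \<omega>) \<longlonglongrightarrow> 0"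
proof -
  define m where "m = nat (l1_norm x)"
  have m: "\<bar>x $ i\<bar> \<le> int m" for i
    using abs_le_l1_norm[of x i] l1_norm_nonneg[of x] by (simp add: m_def)
  \<comment> \<open>Moving a smaller cube by the positive part of x places it in
    \<open>cube n\<close> and in the translate of \<open>cube n\<close> by x at once.\<close>
  define t :: "'d site" where "t = (\<chi> i. max 0 (x $ i))"
  have bound: "norm (box_average n g \<omega> - box_average n (\<lambda>\<omega>. g (shift x \<omega>)) \<omega>) \<le>
      2 * K * (1 - vol_ratio TYPE('d) (m + 2) (Suc n))" if n: "n \<ge> m" for n
  proof -
    let ?S = "(+) t ` cube (n - m)"
    have S: "?S \<subseteq> cube n" "?S \<subseteq> (+) x ` cube n"
    proof -
      have tc: "t + c \<in> cube n \<and> t + c - x \<in> cube n" if "c \<in> cube (n - m)" for c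
      proof -
        have "0 \<le> (t + c) $ i \<and> (t + c) $ i \<le> int n \<and> 0 \<le> (t + c - x) $ i \<and> (t + c - x) $ i \<le> int n" for i
        proof -
          have "0 \<le> c $ i" "c $ i \<le> int n - int m"
            using that n by (auto simp: cube_def of_nat_diff)
          then show ?thesis using m[of i] by (simp add: t_def max_def abs_le_iff)
        qed
        then show ?thesis by (simp add: cube_def)
      qed
      then show "?S \<subseteq> cube n" by blast
      show "?S \<subseteq> (+) x ` cube n"
      proof
        fix y assume "y \<in> ?S"
        then have "y - x \<in> cube n" using tc by blast
        then show "y \<in> (+) x ` cube n" by (rule rev_image_eqI) simp
      qed
    qed
    have "(\<Sum>y\<in>cube n. g (shift x (shift y \<omega>))) = (\<Sum>y\<in>(+) x ` cube n. g (shift y \<omega>))"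
      by (subst sum.reindex) (auto simp: shift_shift)
    then have "norm (box_average n g \<omega> - box_average n (\<lambda>\<omega>. g (shift x \<omega>)) \<omega>) =
        \<bar>(\<Sum>y\<in>cube n. g (shift y \<omega>)) - (\<Sum>y\<in>(+) x ` cube n. g (shift y \<omega>))\<bar> / real (n + 1) ^ CARD('d)"
      by (simp add: box_average_def diff_divide_distrib[symmetric] abs_divide)
    also have "\<dots> \<le> 2 * K * (real (card (cube n :: 'd site set)) - real (card ?S)) / real (n + 1) ^ CARD('d)"
      by (intro divide_right_mono sum_diff_overlap_le S bd) auto
    also have "card ?S = (n - m + 1) ^ CARD('d)" by (simp add: card_cube)
    also have "2 * K * (real (card (cube n :: 'd site set)) - real ((n - m + 1) ^ CARD('d))) / real (n + 1) ^ CARD('d) =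
        2 * K * (1 - vol_ratio TYPE('d) (m + 2) (Suc n))"
      using n by (simp add: card_cube vol_ratio_def field_simps Suc_diff_le)
    finally show ?thesis .
  qed
  have "(\<lambda>n. 2 * K * (1 - vol_ratio TYPE('d) (m + 2) (Suc n))) \<longlonglongrightarrow> 2 * K * (1 - 1)"
    by (intro tendsto_intros LIMSEQ_Suc vol_ratio_tendsto)
  then have lim: "(\<lambda>n. 2 * K * (1 - vol_ratio TYPE('d) (m + 2) (Suc n))) \<longlonglongrightarrow> 0" by simp
  have "\<forall>\<^sub>F n in sequentially. norm (box_average n g \<omega> - box_average n (\<lambda>\<omega>. g (shift x \<omega>)) \<omega>) \<le>
      2 * K * (1 - vol_ratio TYPE('d) (m + 2) (Suc n))"
    using eventually_ge_at_top[of m] by (rule eventually_mono) (rule bound)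
  then show ?thesis using lim by (rule Lim_null_comparison)
qed

text \<open>The dyadic convex combinations of translates of f. Midpoints are all that the
  parallelogram identity asks for, and the inductive form avoids coefficients. Members share the
  mean and the bound of f, and their box averages differ from those of f by a sequence tending to
  0.\<close>

inductive_set translate_hull :: "(('d::finite, 'a) config \<Rightarrow> real) \<Rightarrow> (('d, 'a) config \<Rightarrow> real) set"
  for f where
  base: "f \<in> translate_hull f"
| shift: "g \<in> translate_hull f \<Longrightarrow> (\<lambda>\<omega>. g (shift x \<omega>)) \<in> translate_hull f"
| midpoint: "g \<in> translate_hull f \<Longrightarrow> h \<in> translate_hull f \<Longrightarrow> (\<lambda>\<omega>. (g \<omega> + h \<omega>) / 2) \<in> translate_hull f"

lemma hull_bounded:
  assumes "g \<in> translate_hull f" "\<And>\<omega>. \<bar>f \<omega>\<bar> \<le> K" shows "\<bar>g \<omega>\<bar> \<le> K"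
  using assms(1)
proof (induction arbitrary: \<omega>)
  case (midpoint g h)
  have "\<bar>g \<omega>\<bar> \<le> K" "\<bar>h \<omega>\<bar> \<le> K" by (rule midpoint.IH)+
  then show ?case by (auto simp: abs_le_iff field_simps)
qed (use assms(2) in auto)

lemma hull_average:
  assumes "g \<in> translate_hull f" and bd: "\<And>\<omega>. \<bar>f \<omega>\<bar> \<le> K"
  shows "(\<lambda>n. box_average n f \<omega> - box_average n g \<omega>) \<longlonglongrightarrow> 0"
  using assms(1)
proof induction
  case (shift g x)
  from tendsto_add[OF shift.IH box_average_shift[of g K \<omega> x, OF hull_bounded[OF shift.hyps bd]]]
  show ?case by simp
next
  case (midpoint g h)
  have eq: "box_average n (\<lambda>\<omega>. (g \<omega> + h \<omega>) / 2) \<omega> = (box_average n g \<omega> + box_average n h \<omega>) / 2" for n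
    by (simp add: box_average_def add_divide_distrib sum.distrib flip: sum_divide_distrib)
  have "box_average n f \<omega> - box_average n (\<lambda>\<omega>. (g \<omega> + h \<omega>) / 2) \<omega> =
      (box_average n f \<omega> - box_average n g \<omega>) / 2 + (box_average n f \<omega> - box_average n h \<omega>) / 2" for n
    unfolding eq by (simp add: field_simps)
  then show ?case
    using tendsto_add[OF tendsto_divide[OF midpoint.IH(1) tendsto_const[of 2]]
        tendsto_divide[OF midpoint.IH(2) tendsto_const[of 2]]] by simp
qed simp

context shift_field
begin

lemma bounded_integrable:
  fixes f :: "('d, 'a) config \<Rightarrow> real"
  assumes "f \<in> borel_measurable M" "\<And>\<omega>. \<bar>f \<omega>\<bar> \<le> K"
  shows "integrable M f"
  by (rule integrable_const_bound[where B = K]) (use assms in auto)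

text \<open>Transference: the covering lemma is applied along the orbit of each configuration, to
  the positions in \<open>cube N\<close> at which some average is large, and the result is
  integrated using invariance. The covering costs 2^d, and enlarging \<open>cube N\<close> to hold
  all cubes another 2^d.\<close>

lemma maximal_inequality_upto:
  fixes h :: "('d, 'a) config \<Rightarrow> real"
  assumes [measurable]: "h \<in> borel_measurable M" and bd: "\<And>\<omega>. \<bar>h \<omega>\<bar> \<le> K"
    and nonneg: "\<And>\<omega>. 0 \<le> h \<omega>" and \<alpha>: "\<alpha> > 0"
  shows "prob {\<omega>. \<exists>n\<le>N. box_average n h \<omega> > \<alpha>} \<le> 4 ^ CARD('d) / \<alpha> * (\<integral>\<omega>. h \<omega> \<partial>M)"
proof -
  let ?d = "CARD('d)"
  define B where "B = {\<omega>. \<exists>n\<le>N. box_average n h \<omega> > \<alpha>}"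
  have "{\<omega> \<in> space M. \<exists>n\<le>N. box_average n h \<omega> > \<alpha>} \<in> sets M"
    unfolding box_average_def by measurable
  then have B[measurable]: "B \<in> sets M" by (simp add: B_def)
  have pointwise: "\<alpha> * (\<Sum>x\<in>cube N. indicator B (shift x \<omega>)) \<le> 2 ^ ?d * (\<Sum>y\<in>cube (2 * N). h (shift y \<omega>))" for \<omega>
  proof -
    define E where "E = {x \<in> cube N. shift x \<omega> \<in> B}"
    have "\<forall>x\<in>E. \<exists>n\<le>N. box_average n h (shift x \<omega>) > \<alpha>" by (auto simp: E_def B_def)
    then obtain r where r: "\<And>x. x \<in> E \<Longrightarrow> r x \<le> N" "\<And>x. x \<in> E \<Longrightarrow> box_average (r x) h (shift x \<omega>) > \<alpha>"
      by metis
    have fE: "finite E" by (simp add: E_def)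
    have "\<alpha> * real (card E) \<le> 2 ^ ?d * (\<Sum>y\<in>(\<Union>x\<in>E. (+) x ` cube (r x)). h (shift y \<omega>))"
    proof (rule vitali_covering_sum)
      fix x assume x: "x \<in> E"
      have "(\<Sum>y\<in>(+) x ` cube (r x). h (shift y \<omega>)) = (\<Sum>y\<in>cube (r x). h (shift y (shift x \<omega>)))"
        by (subst sum.reindex) (auto simp: shift_shift add.commute)
      then show "\<alpha> * real (r x + 1) ^ ?d \<le> (\<Sum>y\<in>(+) x ` cube (r x). h (shift y \<omega>))"
        using r(2)[OF x] by (simp add: box_average_def field_simps)
    qed (use fE nonneg \<alpha> in auto)
    also have "\<dots> \<le> 2 ^ ?d * (\<Sum>y\<in>cube (2 * N). h (shift y \<omega>))"
    proof (intro mult_left_mono sum_mono2)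
      show "(\<Union>x\<in>E. (+) x ` cube (r x)) \<subseteq> cube (2 * N)"
      proof clarify
        fix x y :: "'d site" assume xy: "x \<in> E" "y \<in> cube (r x)"
        have "0 \<le> (x + y) $ i \<and> (x + y) $ i \<le> int (2 * N)" for i
        proof -
          have "0 \<le> x $ i" "x $ i \<le> int N" "0 \<le> y $ i" "y $ i \<le> int (r x)"
            using xy by (auto simp: E_def cube_def)
          then show ?thesis using r(1)[OF xy(1)] by simp
        qed
        then show "x + y \<in> cube (2 * N)" by (simp add: cube_def)
      qed
    qed (use nonneg in auto)
    also have "real (card E) = (\<Sum>x\<in>cube N. indicator B (shift x \<omega>))"
      by (simp add: E_def indicator_def sum.If_cases Int_def)
    finally show ?thesis .
  qed
  have int: "integrable M (\<lambda>\<omega>. h (shift x \<omega>))" for x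
    by (rule bounded_integrable[of _ K]) (auto simp: bd)
  have intB: "integrable M (\<lambda>\<omega>. indicator B (shift x \<omega>) :: real)" for x
    by (rule bounded_integrable[of _ 1]) (auto simp: indicator_def)
  have "(\<integral>\<omega>. indicator B (shift x \<omega>) \<partial>M) = prob B" for x
    using integral_shift[of "indicator B" x] by simp
  then have "\<alpha> * (real (N + 1) ^ ?d * prob B) = (\<integral>\<omega>. \<alpha> * (\<Sum>x\<in>cube N. indicator B (shift x \<omega>)) \<partial>M)"
    by (simp add: intB card_cube)
  also have "\<dots> \<le> (\<integral>\<omega>. 2 ^ ?d * (\<Sum>y\<in>cube (2 * N). h (shift y \<omega>)) \<partial>M)"
  proof (rule integral_mono)
    show "integrable M (\<lambda>\<omega>. \<alpha> * (\<Sum>x\<in>cube N. indicator B (shift x \<omega>)))"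
      by (rule integrable_mult_right, rule Bochner_Integration.integrable_sum, rule intB)
    show "integrable M (\<lambda>\<omega>. 2 ^ ?d * (\<Sum>y\<in>cube (2 * N). h (shift y \<omega>)))"
      by (rule integrable_mult_right, rule Bochner_Integration.integrable_sum, rule int)
  qed (rule pointwise)
  also have "\<dots> = 2 ^ ?d * (real (2 * N + 1) ^ ?d * (\<integral>\<omega>. h \<omega> \<partial>M))"
    by (simp add: int card_cube integral_shift)
  \<comment> \<open>The larger cube has 2 N + 1 sites per side, at most twice N + 1; the second
    factor 2^d arises here.\<close>
  also have "\<dots> \<le> 2 ^ ?d * ((2 * real (N + 1)) ^ ?d * (\<integral>\<omega>. h \<omega> \<partial>M))"
    by (intro mult_left_mono mult_right_mono power_mono Bochner_Integration.integral_nonneg nonneg) auto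
  also have "\<dots> = real (N + 1) ^ ?d * (4 ^ ?d * (\<integral>\<omega>. h \<omega> \<partial>M))"
  proof -
    have "(4 :: real) ^ ?d = 2 ^ ?d * 2 ^ ?d" by (simp flip: power_mult_distrib)
    then show ?thesis by (simp only: power_mult_distrib mult_ac)
  qed
  finally have "real (N + 1) ^ ?d * (\<alpha> * prob B) \<le> real (N + 1) ^ ?d * (4 ^ ?d * (\<integral>\<omega>. h \<omega> \<partial>M))"
    by (simp only: mult.left_commute)
  then have "\<alpha> * prob B \<le> 4 ^ ?d * (\<integral>\<omega>. h \<omega> \<partial>M)"
    by (rule mult_left_le_imp_le) simp
  then show ?thesis using \<alpha> by (simp add: B_def field_simps)
qed

lemma maximal_inequality:
  fixes h :: "('d, 'a) config \<Rightarrow> real"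
  assumes meas[measurable]: "h \<in> borel_measurable M" and bd: "\<And>\<omega>. \<bar>h \<omega>\<bar> \<le> K"
    and nonneg: "\<And>\<omega>. 0 \<le> h \<omega>" and \<alpha>: "\<alpha> > 0"
  shows "{\<omega>. \<exists>n. box_average n h \<omega> > \<alpha>} \<in> sets M"
    and "prob {\<omega>. \<exists>n. box_average n h \<omega> > \<alpha>} \<le> 4 ^ CARD('d) / \<alpha> * (\<integral>\<omega>. h \<omega> \<partial>M)"
proof -
  define B where "B N = {\<omega>. \<exists>n\<le>N. box_average n h \<omega> > \<alpha>}" for N
  have "{\<omega> \<in> space M. \<exists>n\<le>N. box_average n h \<omega> > \<alpha>} \<in> sets M" for N
    unfolding box_average_def by measurable
  then have B: "range B \<subseteq> sets M" by (auto simp: B_def)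
  have U: "{\<omega>. \<exists>n. box_average n h \<omega> > \<alpha>} = (\<Union>N. B N)" by (auto simp: B_def)
  show "{\<omega>. \<exists>n. box_average n h \<omega> > \<alpha>} \<in> sets M" unfolding U using B by auto
  have "incseq B" by (auto simp: B_def incseq_def intro: order_trans)
  from finite_Lim_measure_incseq[OF B this]
  show "prob {\<omega>. \<exists>n. box_average n h \<omega> > \<alpha>} \<le> 4 ^ CARD('d) / \<alpha> * (\<integral>\<omega>. h \<omega> \<partial>M)"
    unfolding U
    by (rule LIMSEQ_le_const2) (use maximal_inequality_upto[OF meas bd nonneg \<alpha>] in \<open>auto simp: B_def\<close>)
qed

lemma hull_measurable:
  assumes "g \<in> translate_hull f" "f \<in> borel_measurable M" shows "g \<in> borel_measurable M"
  using assms(1)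
proof induction
  case (shift g x)
  then show ?case using measurable_compose[OF shift_measurable_M] by blast
next
  case (midpoint g h)
  note [measurable] = midpoint.IH
  show ?case by measurable
qed (rule assms(2))

lemma hull_integral:
  fixes f :: "('d, 'a) config \<Rightarrow> real"
  assumes "g \<in> translate_hull f" "f \<in> borel_measurable M" "\<And>\<omega>. \<bar>f \<omega>\<bar> \<le> K"
  shows "(\<integral>\<omega>. g \<omega> \<partial>M) = (\<integral>\<omega>. f \<omega> \<partial>M)"
  using assms(1)
proof induction
  case (shift g x)
  then show ?case using integral_shift[OF hull_measurable[OF shift.hyps assms(2)]] by simp
next
  case (midpoint g h)
  have "integrable M u" if "u \<in> translate_hull f" for u
    by (rule bounded_integrable[OF hull_measurable[OF that assms(2)] hull_bounded[OF that assms(3)]])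
  from this[OF midpoint.hyps(1)] this[OF midpoint.hyps(2)] show ?case using midpoint.IH by simp
qed simp

text \<open>The integral of the series is finite by monotone convergence, so the series is finite
  almost surely. It turns geometrically small L^1 distances into almost sure convergence without
  passing to a subsequence.\<close>

lemma AE_summable_of_integral:
  fixes u :: "nat \<Rightarrow> ('d, 'a) config \<Rightarrow> real"
  assumes [measurable]: "\<And>k. u k \<in> borel_measurable M" and nonneg: "\<And>k \<omega>. 0 \<le> u k \<omega>"
    and int: "\<And>k. integrable M (u k)" and le: "\<And>k. (\<integral>\<omega>. u k \<omega> \<partial>M) \<le> C * (1 / 4) ^ k"
  shows "AE \<omega> in M. summable (\<lambda>k. u k \<omega>)"
proof -
  have "(\<integral>\<^sup>+\<omega>. (\<Sum>k. ennreal (u k \<omega>)) \<partial>M) = (\<Sum>k. \<integral>\<^sup>+\<omega>. ennreal (u k \<omega>) \<partial>M)"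
    by (rule nn_integral_suminf) simp
  also have "\<dots> = (\<Sum>k. ennreal (\<integral>\<omega>. u k \<omega> \<partial>M))"
    by (simp add: nn_integral_eq_integral[OF int] nonneg)
  also have "\<dots> \<noteq> \<top>"
  proof (rule ennreal_suminf_neq_top)
    show "summable (\<lambda>k. \<integral>\<omega>. u k \<omega> \<partial>M)"
      by (rule summable_comparison_test'[where N = 0 and g = "\<lambda>k. C * (1 / 4) ^ k"])
        (use le nonneg in \<open>auto intro!: summable_mult summable_geometric simp: abs_of_nonneg Bochner_Integration.integral_nonneg\<close>)
  qed (simp add: nonneg Bochner_Integration.integral_nonneg)
  finally have "AE \<omega> in M. (\<Sum>k. ennreal (u k \<omega>)) \<noteq> \<infinity>"
    by (intro nn_integral_PInf_AE) auto
  then show ?thesis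
    by eventually_elim (auto intro!: summable_suminf_not_top nonneg)
qed

end

section \<open>Mean and pointwise convergence for ergodic fields\<close>

locale ergodic_field_locale =
  fixes M :: "('d::finite, 'a::finite) config measure"
  assumes ergodic_field: "ergodic_field M"
begin

sublocale shift_field M
  using ergodic_field by unfold_locales (auto simp: ergodic_field_def)

lemma zero_one: "E \<in> sets M \<Longrightarrow> (\<And>x. shift x -` E = E) \<Longrightarrow> prob E = 0 \<or> prob E = 1"
  using ergodic_field by (auto simp: ergodic_field_def)

text \<open>The parallelogram identity makes a sequence in the hull that minimises the \<open>L\<^sup>2\<close> norm converge
  almost surely to an invariant limit, which ergodicity forces to vanish.\<close>

lemma mean_ergodic:
  fixes f :: "('d, 'a) config \<Rightarrow> real"
  assumes meas: "f \<in> borel_measurable M" and bd: "\<And>\<omega>. \<bar>f \<omega>\<bar> \<le> K"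
    and mean: "(\<integral>\<omega>. f \<omega> \<partial>M) = 0" and "\<epsilon> > 0"
  shows "\<exists>g\<in>translate_hull f. (\<integral>\<omega>. \<bar>g \<omega>\<bar> \<partial>M) < \<epsilon>"
proof -
  let ?H = "translate_hull f"
  have Hmeas: "g \<in> borel_measurable M" if "g \<in> ?H" for g by (rule hull_measurable[OF that meas])
  have Hbd: "\<bar>g \<omega>\<bar> \<le> K" if "g \<in> ?H" for g \<omega> by (rule hull_bounded[OF that bd])
  have sq_bd: "\<bar>(g \<omega>)\<^sup>2\<bar> \<le> K\<^sup>2" if "g \<in> ?H" for g \<omega>
    using power_mono[OF Hbd[OF that], of \<omega> 2] by simp
  have Hint: "integrable M g" "integrable M (\<lambda>\<omega>. (g \<omega>)\<^sup>2)" if "g \<in> ?H" for g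
  proof -
    note [measurable] = Hmeas[OF that]
    show "integrable M g" by (rule bounded_integrable[of g K, OF _ Hbd[OF that]]) measurable
    show "integrable M (\<lambda>\<omega>. (g \<omega>)\<^sup>2)"
      by (rule bounded_integrable[of "\<lambda>\<omega>. (g \<omega>)\<^sup>2" "K\<^sup>2", OF _ sq_bd[OF that]]) measurable
  qed
  define n2 where "n2 g = (\<integral>\<omega>. (g \<omega>)\<^sup>2 \<partial>M)" for g :: "('d, 'a) config \<Rightarrow> real"
  define I where "I = (INF g\<in>?H. n2 g)"
  have bdd: "bdd_below (n2 ` ?H)" by (rule bdd_belowI[of _ 0]) (auto simp: n2_def)
  have I_le: "I \<le> n2 g" if "g \<in> ?H" for g unfolding I_def by (rule cINF_lower[OF bdd that])
  \<comment> \<open>Squared norms within (1 / 16)^k of the infimum give distances of order (1 /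
    4)^k, which are summable.\<close>
  have "\<exists>g\<in>?H. n2 g < I + (1 / 16) ^ k" for k
    using cINF_less_iff[OF _ bdd, of "I + (1 / 16) ^ k"] translate_hull.base[of f] by (auto simp: I_def)
  then obtain g where g: "\<And>k. g k \<in> ?H" "\<And>k. n2 (g k) < I + (1 / 16) ^ k" by metis
  have close: "(\<integral>\<omega>. \<bar>u \<omega> - v \<omega>\<bar> \<partial>M) \<le> 3 * (1 / 4) ^ k"
    if uv: "u \<in> ?H" "v \<in> ?H" "n2 u < I + (1 / 16) ^ k" "n2 v < I + (1 / 16) ^ k" for u v k
  proof -
    define s where "s = (1 / 4 :: real) ^ k"
    define w where "w \<omega> = (u \<omega> + v \<omega>) / 2" for \<omega>
    have s: "s > 0" by (simp add: s_def)
    have "(1 / 16 :: real) ^ k = s * s" by (simp add: s_def flip: power_mult_distrib)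
    note uv' = uv(3,4)[unfolded this]
    have w: "w \<in> ?H" unfolding w_def[abs_def] by (rule translate_hull.midpoint[OF uv(1,2)])
    note i1 = integrable_mult_right[OF Hint(2)[OF uv(1)], of 2]
      and i2 = integrable_mult_right[OF Hint(2)[OF uv(2)], of 2]
      and i3 = integrable_mult_right[OF Hint(2)[OF w], of 4]
    define D where "D \<omega> = 2 * (u \<omega>)\<^sup>2 + 2 * (v \<omega>)\<^sup>2 - 4 * (w \<omega>)\<^sup>2" for \<omega>
    have D_int: "integrable M D" unfolding D_def[abs_def]
      by (rule Bochner_Integration.integrable_diff[OF Bochner_Integration.integrable_add[OF i1 i2] i3])
    have D: "(\<integral>\<omega>. D \<omega> \<partial>M) = 2 * n2 u + 2 * n2 v - 4 * n2 w"
      unfolding D_def Bochner_Integration.integral_diff[OF Bochner_Integration.integrable_add[OF i1 i2] i3]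
        Bochner_Integration.integral_add[OF i1 i2] n2_def by simp
    \<comment> \<open>D is the square of u - v by the parallelogram identity. The pointwise
      inequality t \<le> t^2 / (2 s) + s / 2, with s of the size of the expected distance, takes the
      place of Cauchy-Schwarz.\<close>
    have ineq: "\<bar>u \<omega> - v \<omega>\<bar> \<le> D \<omega> / (2 * s) + s / 2" for \<omega>
    proof -
      have "D \<omega> = (u \<omega> - v \<omega>)\<^sup>2"
        by (simp add: D_def w_def power2_eq_square field_simps)
      moreover have "0 \<le> (\<bar>u \<omega> - v \<omega>\<bar> - s)\<^sup>2" by simp
      then have "2 * s * \<bar>u \<omega> - v \<omega>\<bar> \<le> (u \<omega> - v \<omega>)\<^sup>2 + s * s"
        by (simp add: power2_eq_square algebra_simps)
      ultimately show ?thesis using s by (simp add: field_simps)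
    qed
    have "(\<integral>\<omega>. \<bar>u \<omega> - v \<omega>\<bar> \<partial>M) \<le> (\<integral>\<omega>. D \<omega> / (2 * s) + s / 2 \<partial>M)"
    proof (rule integral_mono)
      show "integrable M (\<lambda>\<omega>. \<bar>u \<omega> - v \<omega>\<bar>)"
        by (rule integrable_abs[OF Bochner_Integration.integrable_diff[OF Hint(1)[OF uv(1)] Hint(1)[OF uv(2)]]])
      show "integrable M (\<lambda>\<omega>. D \<omega> / (2 * s) + s / 2)"
        by (rule Bochner_Integration.integrable_add[OF integrable_divide[OF D_int] integrable_const])
    qed (rule ineq)
    also have "\<dots> = (2 * n2 u + 2 * n2 v - 4 * n2 w) / (2 * s) + s / 2"
      using D_int by (simp add: D prob_space[unfolded space_M])
    also have "\<dots> \<le> (4 * (s * s)) / (2 * s) + s / 2"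
      using uv' I_le[OF w] s by (intro add_right_mono divide_right_mono) auto
    also have "\<dots> \<le> 3 * s" using s by (simp add: field_simps)
    finally show ?thesis by (simp add: s_def)
  qed
  have n2_shift: "n2 (\<lambda>\<omega>. u (shift x \<omega>)) = n2 u" if "u \<in> ?H" for u x
    unfolding n2_def by (rule integral_shift[where f = "\<lambda>\<omega>. (u \<omega>)\<^sup>2"]) (use Hmeas[OF that] in measurable)
  have gm[measurable]: "g k \<in> borel_measurable M" for k by (rule Hmeas[OF g(1)])
  have g_shift: "(\<lambda>\<omega>. g k (shift x \<omega>)) \<in> ?H" for k x by (rule translate_hull.shift[OF g(1)])
  define G where "G \<omega> = lim (\<lambda>k. g k \<omega>)" for \<omega>
  \<comment> \<open>\<open>zero_one\<close> asks for exact invariance, whereas G is invariant only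
    almost surely. The supremum over all translates is invariant at every configuration and almost
    surely equal to G.\<close>
  define S where "S \<omega> = (SUP x. limsup (\<lambda>k. ereal (g k (shift x \<omega>))))" for \<omega>
  have "AE \<omega> in M. summable (\<lambda>k. \<bar>g (Suc k) \<omega> - g k \<omega>\<bar>)"
  proof (rule AE_summable_of_integral[where C = 3])
    show "(\<integral>\<omega>. \<bar>g (Suc k) \<omega> - g k \<omega>\<bar> \<partial>M) \<le> 3 * (1 / 4) ^ k" for k
    proof (rule close[OF g(1) g(1) _ g(2)])
      have "(1 / 16 :: real) ^ Suc k \<le> (1 / 16) ^ k" by (rule power_decreasing) auto
      then show "n2 (g (Suc k)) < I + (1 / 16) ^ k" using g(2)[of "Suc k"] by linarith
    qed
    show "integrable M (\<lambda>\<omega>. \<bar>g (Suc k) \<omega> - g k \<omega>\<bar>)" for k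
      by (intro integrable_abs Bochner_Integration.integrable_diff Hint(1)[OF g(1)])
  qed auto
  \<comment> \<open>A translate of \<open>g k\<close> has the same norm, hence is as nearly minimal
    as \<open>g k\<close> and close to it. This makes the limit invariant.\<close>
  moreover have "AE \<omega> in M. \<forall>x. summable (\<lambda>k. \<bar>g k \<omega> - g k (shift x \<omega>)\<bar>)"
    unfolding AE_all_countable
  proof
    fix x :: "'d site"
    show "AE \<omega> in M. summable (\<lambda>k. \<bar>g k \<omega> - g k (shift x \<omega>)\<bar>)"
    proof (rule AE_summable_of_integral[where C = 3])
      show "(\<integral>\<omega>. \<bar>g k \<omega> - g k (shift x \<omega>)\<bar> \<partial>M) \<le> 3 * (1 / 4) ^ k" for k
        by (rule close[OF g(1) g_shift g(2)]) (simp add: n2_shift[OF g(1)] g(2))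
      show "integrable M (\<lambda>\<omega>. \<bar>g k \<omega> - g k (shift x \<omega>)\<bar>)" for k
        by (intro integrable_abs Bochner_Integration.integrable_diff Hint(1)[OF g(1)] Hint(1)[OF g_shift])
    qed auto
  qed
  ultimately have conv: "AE \<omega> in M. (\<lambda>k. g k \<omega>) \<longlonglongrightarrow> G \<omega> \<and> S \<omega> = ereal (G \<omega>)"
  proof eventually_elim
    case (elim \<omega>)
    have "summable (\<lambda>k. g (Suc k) \<omega> - g k \<omega>)" using elim(1) by (rule summable_rabs_cancel)
    then have "convergent (\<lambda>n. (\<Sum>k<n. g (Suc k) \<omega> - g k \<omega>) + g 0 \<omega>)"
      by (intro convergent_add) (auto simp: summable_iff_convergent convergent_const)
    then have "convergent (\<lambda>k. g k \<omega>)" by (simp add: sum_lessThan_telescope[of "\<lambda>k. g k \<omega>"])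
    then have lim: "(\<lambda>k. g k \<omega>) \<longlonglongrightarrow> G \<omega>" by (simp add: G_def convergent_LIMSEQ_iff)
    have "limsup (\<lambda>k. ereal (g k (shift x \<omega>))) = ereal (G \<omega>)" for x
    proof -
      have "(\<lambda>k. \<bar>g k \<omega> - g k (shift x \<omega>)\<bar>) \<longlonglongrightarrow> 0" using elim(2) summable_LIMSEQ_zero by blast
      then have "(\<lambda>k. g k \<omega> - g k (shift x \<omega>)) \<longlonglongrightarrow> 0" by (rule tendsto_rabs_zero_cancel)
      from tendsto_diff[OF lim this] have "(\<lambda>k. g k (shift x \<omega>)) \<longlonglongrightarrow> G \<omega>" by simp
      then show ?thesis by (intro lim_imp_Limsup tendsto_ereal) simp
    qed
    then show ?case using lim by (simp add: S_def)
  qed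
  have Gm[measurable]: "G \<in> borel_measurable M" unfolding G_def[abs_def] by measurable
  have Sm[measurable]: "S \<in> borel_measurable M" unfolding S_def[abs_def]
  proof (intro borel_measurable_SUP borel_measurable_limsup borel_measurable_ereal)
    show "(\<lambda>\<omega>. g k (shift x \<omega>)) \<in> borel_measurable M" for k x by (rule Hmeas[OF g_shift])
  qed simp
  have dom: "integrable M G" "(\<lambda>k. \<integral>\<omega>. g k \<omega> \<partial>M) \<longlonglongrightarrow> (\<integral>\<omega>. G \<omega> \<partial>M)"
  proof -
    have lim: "AE \<omega> in M. (\<lambda>k. g k \<omega>) \<longlonglongrightarrow> G \<omega>" using conv by eventually_elim simp
    have le: "AE \<omega> in M. norm (g k \<omega>) \<le> K" for k using Hbd[OF g(1)] by simp
    show "integrable M G"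
      by (rule integrable_dominated_convergence[OF Gm gm _ lim le]) simp
    show "(\<lambda>k. \<integral>\<omega>. g k \<omega> \<partial>M) \<longlonglongrightarrow> (\<integral>\<omega>. G \<omega> \<partial>M)"
      by (rule integral_dominated_convergence[OF Gm gm _ lim le]) simp
  qed
  have mean_g: "(\<integral>\<omega>. g k \<omega> \<partial>M) = 0" for k unfolding hull_integral[OF g(1) meas bd] by (rule mean)
  have G0: "(\<integral>\<omega>. G \<omega> \<partial>M) = 0"
    using dom(2) unfolding mean_g by (simp add: LIMSEQ_const_iff)
  define E where "E = {\<omega>. S \<omega> > 0}"
  have "{\<omega> \<in> space M. S \<omega> > 0} \<in> sets M" by measurable
  then have E[measurable]: "E \<in> sets M" by (simp add: E_def)
  have "S (shift x \<omega>) = S \<omega>" for x \<omega>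
  proof -
    have "S (shift x \<omega>) = (SUP y. limsup (\<lambda>k. ereal (g k (shift (y + x) \<omega>))))"
      by (simp add: S_def shift_shift)
    also have "\<dots> = (SUP z\<in>range (\<lambda>y. y + x). limsup (\<lambda>k. ereal (g k (shift z \<omega>))))"
      by (simp only: image_image)
    also have "range (\<lambda>y. y + x) = UNIV" by (rule surjI[of _ "\<lambda>y. y - x"]) simp
    finally show ?thesis by (simp add: S_def)
  qed
  then have "shift x -` E = E" for x by (auto simp: E_def)
  \<comment> \<open>If E had full measure, G would be positive almost surely although its mean is 0.
    So G is at most 0 almost surely, and mean 0 then forces G = 0.\<close>
  from zero_one[OF E this] have "prob E = 0"
  proof
    assume "prob E = 1"
    then have "AE \<omega> in M. \<omega> \<in> E" using E by (simp add: AE_in_set_eq_1)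
    with conv have pos: "AE \<omega> in M. G \<omega> > 0" by eventually_elim (auto simp: E_def)
    then have "AE \<omega> in M. 0 \<le> G \<omega>" by eventually_elim simp
    from integral_nonneg_eq_0_iff_AE[OF dom(1) this] have "AE \<omega> in M. G \<omega> = 0" using G0 by simp
    with pos have "AE \<omega> in M. False" by eventually_elim simp
    then show ?thesis by simp
  qed
  then have "AE \<omega> in M. \<omega> \<notin> E" using prob_eq_0[OF E] by simp
  with conv have "AE \<omega> in M. - G \<omega> \<ge> 0" by eventually_elim (auto simp: E_def)
  moreover have "integrable M (\<lambda>\<omega>. - G \<omega>)" using dom(1) by simp
  ultimately have "(\<integral>\<omega>. - G \<omega> \<partial>M) = 0 \<longleftrightarrow> (AE \<omega> in M. - G \<omega> = 0)"
    by (intro integral_nonneg_eq_0_iff_AE)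
  then have "AE \<omega> in M. - G \<omega> = 0" using G0 by simp
  with conv have lim0: "AE \<omega> in M. (\<lambda>k. \<bar>g k \<omega>\<bar>) \<longlonglongrightarrow> 0"
    by eventually_elim (auto intro: tendsto_rabs_zero)
  have "(\<lambda>k. \<integral>\<omega>. \<bar>g k \<omega>\<bar> \<partial>M) \<longlonglongrightarrow> (\<integral>\<omega>. 0 \<partial>M)"
    by (rule integral_dominated_convergence[where w = "\<lambda>_. K"]) (use lim0 Hbd[OF g(1)] in auto)
  then have "\<forall>\<^sub>F k in sequentially. (\<integral>\<omega>. \<bar>g k \<omega>\<bar> \<partial>M) < \<epsilon>"
    by (intro order_tendstoD) (use \<open>\<epsilon> > 0\<close> in auto)
  then obtain k where "(\<integral>\<omega>. \<bar>g k \<omega>\<bar> \<partial>M) < \<epsilon>" by (auto simp: eventually_sequentially)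
  then show ?thesis using g(1) by blast
qed

text \<open>The centred function has asymptotically the same box averages as any member g of its
  hull. With g of tiny L^1 norm, the maximal inequality for its absolute value controls all averages
  of g at once; this replaces the splitting into invariant functions and coboundaries.\<close>

theorem pointwise_ergodic:
  fixes f :: "('d, 'a) config \<Rightarrow> real"
  assumes meas: "f \<in> borel_measurable M" and bd: "\<And>\<omega>. \<bar>f \<omega>\<bar> \<le> K"
  shows "AE \<omega> in M. (\<lambda>n. box_average n f \<omega>) \<longlonglongrightarrow> (\<integral>\<omega>. f \<omega> \<partial>M)"
proof -
  let ?c = "\<integral>\<omega>. f \<omega> \<partial>M"
  define f0 where "f0 \<omega> = f \<omega> - ?c" for \<omega>
  have m0: "f0 \<in> borel_measurable M" unfolding f0_def[abs_def] using meas by measurable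
  have b0: "\<bar>f0 \<omega>\<bar> \<le> K + \<bar>?c\<bar>" for \<omega> using bd[of \<omega>] by (simp add: f0_def)
  have "(\<integral>\<omega>. f0 \<omega> \<partial>M) = 0"
    using bounded_integrable[OF meas bd] by (simp add: f0_def prob_space[unfolded space_M])
  then have "\<forall>j. \<exists>g\<in>translate_hull f0. (\<integral>\<omega>. \<bar>g \<omega>\<bar> \<partial>M) < inverse (real (Suc j))"
    using mean_ergodic[OF m0 b0] by simp
  then obtain g where g: "\<And>j. g j \<in> translate_hull f0" "\<And>j. (\<integral>\<omega>. \<bar>g j \<omega>\<bar> \<partial>M) < inverse (real (Suc j))"
    by metis
  have small: "AE \<omega> in M. \<forall>\<^sub>F n in sequentially. \<bar>box_average n f0 \<omega>\<bar> \<le> 2 * \<alpha>" if \<alpha>: "\<alpha> > 0" for \<alpha>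
  proof -
    define B where "B j = {\<omega>. \<exists>n. box_average n (\<lambda>\<omega>. \<bar>g j \<omega>\<bar>) \<omega> > \<alpha>}" for j
    have meas_g: "(\<lambda>\<omega>. \<bar>g j \<omega>\<bar>) \<in> borel_measurable M" for j
      using hull_measurable[OF g(1) m0] by measurable
    have bd_g: "\<bar>\<bar>g j \<omega>\<bar>\<bar> \<le> K + \<bar>?c\<bar>" for j \<omega> using hull_bounded[OF g(1) b0] by simp
    have B: "B j \<in> sets M" for j
      unfolding B_def by (rule maximal_inequality(1)[OF meas_g bd_g _ \<alpha>]) simp
    have le: "prob (B j) \<le> 4 ^ CARD('d) / \<alpha> * inverse (real (Suc j))" for j
    proof -
      have "prob (B j) \<le> 4 ^ CARD('d) / \<alpha> * (\<integral>\<omega>. \<bar>g j \<omega>\<bar> \<partial>M)"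
        unfolding B_def by (rule maximal_inequality(2)[OF meas_g bd_g _ \<alpha>]) simp
      also have "\<dots> \<le> 4 ^ CARD('d) / \<alpha> * inverse (real (Suc j))"
        by (rule mult_left_mono) (use g(2)[of j] \<alpha> in auto)
      finally show ?thesis .
    qed
    have "(\<Inter>j. B j) \<in> sets M" using B by auto
    \<comment> \<open>The probabilities of the B j tend to 0, so almost every configuration escapes
      at least one of them; which one may depend on the configuration.\<close>
    moreover have "prob (\<Inter>j. B j) = 0"
    proof (rule antisym)
      have "prob (\<Inter>j. B j) \<le> 4 ^ CARD('d) / \<alpha> * inverse (real (Suc j))" for j
        by (rule order_trans[OF finite_measure_mono le]) (use B in auto)
      moreover have "(\<lambda>j. 4 ^ CARD('d) / \<alpha> * inverse (real (Suc j))) \<longlonglongrightarrow> 4 ^ CARD('d) / \<alpha> * 0"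
        by (intro tendsto_intros LIMSEQ_inverse_real_of_nat)
      ultimately show "prob (\<Inter>j. B j) \<le> 0" by (simp add: LIMSEQ_le_const)
    qed simp
    ultimately have "AE \<omega> in M. \<omega> \<notin> (\<Inter>j. B j)" using prob_eq_0 by blast
    then show ?thesis
    proof eventually_elim
      case (elim \<omega>)
      then obtain j where "\<omega> \<notin> B j" by auto
      then have le_\<alpha>: "box_average n (\<lambda>\<omega>. \<bar>g j \<omega>\<bar>) \<omega> \<le> \<alpha>" for n by (auto simp: B_def not_less)
      have abs_le: "\<bar>box_average n (g j) \<omega>\<bar> \<le> \<alpha>" for n
      proof -
        have "\<bar>box_average n (g j) \<omega>\<bar> \<le> box_average n (\<lambda>\<omega>. \<bar>g j \<omega>\<bar>) \<omega>"
          by (simp add: box_average_def abs_divide divide_right_mono sum_abs)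
        then show ?thesis using le_\<alpha>[of n] by linarith
      qed
      have "\<forall>\<^sub>F n in sequentially. norm (box_average n f0 \<omega> - box_average n (g j) \<omega>) < \<alpha>"
        using hull_average[OF g(1)[of j] b0, of \<omega>] \<alpha> by (auto simp: tendsto_iff dist_norm)
      then show ?case
      proof eventually_elim
        case (elim n)
        then show ?case using abs_le[of n] by simp
      qed
    qed
  qed
  have "AE \<omega> in M. \<forall>k. \<forall>\<^sub>F n in sequentially. \<bar>box_average n f0 \<omega>\<bar> \<le> 2 * inverse (real (Suc k))"
    unfolding AE_all_countable using small by simp
  then show ?thesis
  proof eventually_elim
    case (elim \<omega>)
    have "(\<lambda>n. box_average n f0 \<omega>) \<longlonglongrightarrow> 0"
    proof (rule tendstoI)
      fix e :: real assume "e > 0"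
      then obtain k where "inverse (real (Suc k)) < e / 2" using reals_Archimedean[of "e / 2"] by auto
      then have k: "2 * inverse (real (Suc k)) < e" by simp
      from elim have "\<forall>\<^sub>F n in sequentially. \<bar>box_average n f0 \<omega>\<bar> \<le> 2 * inverse (real (Suc k))" by blast
      then show "\<forall>\<^sub>F n in sequentially. dist (box_average n f0 \<omega>) 0 < e"
        by (rule eventually_mono) (use k in \<open>simp add: dist_norm\<close>)
    qed
    moreover have "box_average n f0 \<omega> = box_average n f \<omega> - ?c" for n
      by (simp add: box_average_def f0_def sum_subtractf card_cube diff_divide_distrib)
    ultimately show ?case by (simp add: LIM_zero_iff)
  qed
qed

end

section \<open>Gibbs fields\<close>

lemma infsum_UN_le:
  fixes f :: "'i \<Rightarrow> real"
  assumes "finite I" and "\<And>i. i \<in> I \<Longrightarrow> f summable_on S i" and nonneg: "\<And>x. 0 \<le> f x"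
  shows "f summable_on (\<Union>i\<in>I. S i)" "infsum f (\<Union>i\<in>I. S i) \<le> (\<Sum>i\<in>I. infsum f (S i))"
proof -
  have "f summable_on (\<Union>i\<in>I. S i) \<and> infsum f (\<Union>i\<in>I. S i) \<le> (\<Sum>i\<in>I. infsum f (S i))"
    using assms(1,2)
  proof (induction I rule: finite_induct)
    case (insert i I)
    let ?R = "\<Union>i\<in>I. S i"
    have IH: "f summable_on ?R" "infsum f ?R \<le> (\<Sum>i\<in>I. infsum f (S i))" and Si: "f summable_on S i"
      using insert by auto
    have sD: "f summable_on (?R - S i)" by (rule summable_on_subset_banach[OF IH(1)]) auto
    have eq: "(\<Union>i\<in>insert i I. S i) = S i \<union> (?R - S i)" by auto
    have "infsum f (S i \<union> (?R - S i)) = infsum f (S i) + infsum f (?R - S i)"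
      by (rule infsum_Un_disjoint[OF Si sD]) auto
    moreover have "infsum f (?R - S i) \<le> infsum f ?R"
      by (rule infsum_mono2[OF sD IH(1)]) (auto simp: nonneg)
    moreover have "f summable_on (S i \<union> (?R - S i))"
      by (rule summable_on_Un_disjoint[OF Si sD]) auto
    ultimately show ?case unfolding eq using IH(2) insert.hyps by simp
  qed simp
  then show "f summable_on (\<Union>i\<in>I. S i)" "infsum f (\<Union>i\<in>I. S i) \<le> (\<Sum>i\<in>I. infsum f (S i))"
    by auto
qed

section \<open>Interaction strength and boundary terms\<close>

locale gibbs =
  fixes U :: "'d::finite site set \<Rightarrow> ('d, 'a::finite) config \<Rightarrow> real" and M
  assumes interaction: "interaction U" and gibbs_field: "gibbs_field U M"
begin

sublocale shift_field M
  using gibbs_field by unfold_locales (auto simp: gibbs_field_def)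

text \<open>The value 0 off the nonempty finite sets, where U is unconstrained, makes this
  nonnegative on all sets, as the infinite sums below require.\<close>

definition U_norm :: "'d site set \<Rightarrow> real" where
  "U_norm A = (if finite A \<and> A \<noteq> {} then SUP \<sigma>. \<bar>U A \<sigma>\<bar> else 0)"

lemma U_local: "finite A \<Longrightarrow> A \<noteq> {} \<Longrightarrow> (\<And>y. y \<in> A \<Longrightarrow> \<sigma> y = \<eta> y) \<Longrightarrow> U A \<sigma> = U A \<eta>"
  using conjunct1[OF interaction[unfolded interaction_def restrict_eq_iff], rule_format, of A \<sigma> \<eta>] by simp

lemma U_le_norm:
  assumes "finite A" "A \<noteq> {}" shows "\<bar>U A \<sigma>\<bar> \<le> U_norm A"
proof -
  have "range (\<lambda>\<sigma>. \<bar>U A \<sigma>\<bar>) \<subseteq> (\<lambda>\<sigma>. \<bar>U A \<sigma>\<bar>) ` patterns A"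
  proof clarify
    fix \<sigma>
    have "U A \<sigma> = U A (restrict \<sigma> A)" by (rule U_local[OF assms]) simp
    then show "\<bar>U A \<sigma>\<bar> \<in> (\<lambda>\<sigma>. \<bar>U A \<sigma>\<bar>) ` patterns A"
      by (intro image_eqI[of _ _ "restrict \<sigma> A"]) auto
  qed
  then have "finite (range (\<lambda>\<sigma>. \<bar>U A \<sigma>\<bar>))"
    using finite_patterns[OF assms(1)] finite_surj by blast
  then have "bdd_above (range (\<lambda>\<sigma>. \<bar>U A \<sigma>\<bar>))" by (rule bdd_above_finite)
  then show ?thesis using cSUP_upper[OF UNIV_I, of "\<lambda>\<sigma>. \<bar>U A \<sigma>\<bar>" \<sigma>] assms by (simp add: U_norm_def)
qed

definition sets_at :: "'d site \<Rightarrow> 'd site set set" where "sets_at x = {A. finite A \<and> x \<in> A}"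

lemma U_norm_translate:
  assumes "A \<in> sets_at 0" shows "U_norm ((+) x ` A) = U_norm A"
proof -
  have "(\<lambda>y. y + x) ` A = (+) x ` A" by (simp add: add.commute)
  moreover have A: "finite A \<and> A \<noteq> {}" using assms by (auto simp: sets_at_def)
  ultimately have inv: "U ((+) x ` A) (shift (- x) \<sigma>) = U A \<sigma>" for \<sigma>
    using conjunct1[OF conjunct2[OF interaction[unfolded interaction_def]], rule_format, of A x \<sigma>] by simp
  have eq: "U ((+) x ` A) \<sigma> = U A (shift x \<sigma>)" for \<sigma>
    using inv[of "shift x \<sigma>"] by (simp add: shift_shift)
  have "range (\<lambda>\<sigma>. \<bar>U ((+) x ` A) \<sigma>\<bar>) = range (\<lambda>\<sigma>. \<bar>U A \<sigma>\<bar>)"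
  proof (intro subset_antisym image_subsetI)
    show "\<bar>U ((+) x ` A) \<sigma>\<bar> \<in> range (\<lambda>\<sigma>. \<bar>U A \<sigma>\<bar>)" for \<sigma> by (simp add: eq)
    show "\<bar>U A \<sigma>\<bar> \<in> range (\<lambda>\<sigma>. \<bar>U ((+) x ` A) \<sigma>\<bar>)" for \<sigma>
      by (rule image_eqI[of _ _ "shift (- x) \<sigma>"]) (simp_all add: eq shift_shift)
  qed
  then show ?thesis using A by (simp add: U_norm_def)
qed

lemma sets_at_translate: "sets_at x = image ((+) x) ` sets_at 0"
proof
  show "sets_at x \<subseteq> image ((+) x) ` sets_at 0"
  proof
    fix A assume A: "A \<in> sets_at x"
    have "A = (+) x ` ((+) (- x) ` A)" by (simp add: image_image)
    moreover have "(+) (- x) ` A \<in> sets_at 0"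
      using A by (auto simp: sets_at_def intro!: image_eqI[of _ _ x])
    ultimately show "A \<in> image ((+) x) ` sets_at 0" by blast
  qed
qed (auto simp: sets_at_def intro!: image_eqI[of _ _ 0])

lemma inj_translate_sets: "inj_on (image ((+) (x :: 'd site))) S"
  by (rule inj_onI) (simp add: inj_image_eq_iff)

lemma U_norm_nonneg: "0 \<le> U_norm A"
  using order_trans[OF abs_ge_zero U_le_norm[of A undefined]] by (cases "finite A \<and> A \<noteq> {}") (auto simp: U_norm_def)

lemma summable_sets_at: "U_norm summable_on sets_at x"
proof -
  have "(\<lambda>A. SUP \<sigma>. \<bar>U A \<sigma>\<bar>) summable_on sets_at 0"
    using interaction by (simp add: interaction_def sets_at_def)
  then have "U_norm summable_on sets_at 0"
    by (rule summable_on_cong[THEN iffD1, rotated]) (auto simp: U_norm_def sets_at_def)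
  then have "(U_norm \<circ> image ((+) x)) summable_on sets_at 0"
    by (rule summable_on_cong[THEN iffD1, rotated]) (simp add: U_norm_translate)
  then show ?thesis
    unfolding sets_at_translate[of x] using summable_on_reindex[OF inj_translate_sets] by blast
qed

text \<open>Strength of the coupling of x to the complement of V. With V empty it is the full
  strength at x.\<close>

definition tail :: "'d site \<Rightarrow> 'd site set \<Rightarrow> real" where
  "tail x V = infsum U_norm {A \<in> sets_at x. \<not> A \<subseteq> V}"

lemma tail_summable: "U_norm summable_on {A \<in> sets_at x. \<not> A \<subseteq> V}"
  by (rule summable_on_subset_banach[OF summable_sets_at]) auto

lemma tail_translate: "tail (x + y) ((+) x ` V) = tail y V"
proof -
  have S: "{A \<in> sets_at (x + y). \<not> A \<subseteq> (+) x ` V} = image ((+) x) ` {A \<in> sets_at y. \<not> A \<subseteq> V}"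
  proof (intro subset_antisym subsetI)
    fix A assume A: "A \<in> {A \<in> sets_at (x + y). \<not> A \<subseteq> (+) x ` V}"
    have eq: "A = (+) x ` ((+) (- x) ` A)" by (simp add: image_image)
    moreover have "(+) (- x) ` A \<in> sets_at y"
      using A by (auto simp: sets_at_def intro!: image_eqI[of _ _ "x + y"])
    moreover have "\<not> (+) (- x) ` A \<subseteq> V"
    proof
      assume "(+) (- x) ` A \<subseteq> V"
      then have "(+) x ` ((+) (- x) ` A) \<subseteq> (+) x ` V" by (rule image_mono)
      then show False using A unfolding eq[symmetric] by blast
    qed
    ultimately show "A \<in> image ((+) x) ` {A \<in> sets_at y. \<not> A \<subseteq> V}" by blast
  qed (auto simp: sets_at_def)
  have "(U_norm \<circ> image ((+) x)) A = U_norm A" if "A \<in> sets_at y" for A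
  proof -
    have "A \<in> image ((+) y) ` sets_at 0" using that unfolding sets_at_translate[of y] .
    then obtain B where B: "B \<in> sets_at 0" "A = (+) y ` B" by (rule imageE) simp
    then have "(+) x ` A = (+) (x + y) ` B" by (simp add: image_image add.assoc)
    then show ?thesis using U_norm_translate[OF B(1)] B(2) by simp
  qed
  then show ?thesis
    unfolding tail_def S infsum_reindex[OF inj_translate_sets] by (intro infsum_cong) simp
qed

lemma tail_antimono: "V \<subseteq> W \<Longrightarrow> tail x W \<le> tail x V"
  unfolding tail_def by (rule infsum_mono2[OF tail_summable tail_summable]) (auto simp: U_norm_nonneg)

definition energy :: real where "energy = tail 0 {}"

lemma tail_le_energy: "tail x V \<le> energy"
  using tail_antimono[of "{}" V x] tail_translate[of x 0 "{}"] by (simp add: energy_def)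

lemma tail_nonneg: "0 \<le> tail x V"
  unfolding tail_def by (rule infsum_nonneg) (rule U_norm_nonneg)

definition sym_box :: "nat \<Rightarrow> 'd site set" where "sym_box r = {z. \<forall>i. \<bar>z $ i\<bar> \<le> int r}"

text \<open>Up to \<eta> the convergent sum is carried by finitely many finite sets, and their union
  lies in some box.\<close>

lemma tail_box_small:
  assumes "\<eta> > 0" shows "\<exists>r. tail 0 (sym_box r) \<le> \<eta>"
proof -
  obtain F where F: "finite F" "F \<subseteq> sets_at 0" "dist (sum U_norm F) (infsum U_norm (sets_at 0)) \<le> \<eta>"
    using infsum_finite_approximation[OF summable_sets_at assms] by blast
  have "finite (\<Union>F)" using F by (auto simp: sets_at_def)
  define r where "r = nat (\<Sum>z\<in>\<Union>F. l1_norm z)"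
  have r: "int r = (\<Sum>z\<in>\<Union>F. l1_norm z)"
    by (simp add: r_def sum_nonneg l1_norm_nonneg)
  have "z \<in> sym_box r" if "z \<in> \<Union>F" for z
  proof -
    have "l1_norm z \<le> (\<Sum>z\<in>\<Union>F. l1_norm z)"
      by (rule member_le_sum[OF that]) (use \<open>finite (\<Union>F)\<close> l1_norm_nonneg in auto)
    then have "\<bar>z $ i\<bar> \<le> int r" for i
      unfolding r by (rule order_trans[OF abs_le_l1_norm])
    then show ?thesis by (simp add: sym_box_def)
  qed
  then have sub: "{A \<in> sets_at 0. \<not> A \<subseteq> sym_box r} \<subseteq> sets_at 0 - F" by blast
  have sD: "U_norm summable_on (sets_at 0 - F)" by (rule summable_on_subset_banach[OF summable_sets_at]) auto
  have "infsum U_norm (F \<union> (sets_at 0 - F)) = infsum U_norm F + infsum U_norm (sets_at 0 - F)"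
    by (rule infsum_Un_disjoint[OF _ sD]) (use F in auto)
  moreover have "F \<union> (sets_at 0 - F) = sets_at 0" using F by auto
  ultimately have "infsum U_norm (sets_at 0 - F) \<le> \<eta>" using F by (simp add: dist_real_def)
  moreover have "tail 0 (sym_box r) \<le> infsum U_norm (sets_at 0 - F)"
    unfolding tail_def by (rule infsum_mono2[OF tail_summable sD sub]) (rule U_norm_nonneg)
  ultimately show ?thesis by (intro exI[of _ r]) linarith
qed

text \<open>Bounds the total strength of the sets that meet both V and its complement, each counted
  once for every site it has in V. As a sum over sites it can be estimated according to the depth of
  the site.\<close>

definition boundary :: "'d site set \<Rightarrow> real" where
  "boundary V = (\<Sum>x\<in>V. tail x V)"

lemma boundary_translate: "boundary ((+) x ` V) = boundary V"
  unfolding boundary_def by (subst sum.reindex) (simp_all add: tail_translate)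

lemma boundary_cube_tendsto: "(\<lambda>L. boundary (cube (L - 1)) / real L ^ CARD('d)) \<longlonglongrightarrow> 0"
proof (rule LIMSEQ_I)
  fix \<eta> :: real assume \<eta>: "\<eta> > 0"
  obtain r where r: "tail 0 (sym_box r) \<le> \<eta> / 2" using tail_box_small[OF half_gt_zero[OF \<eta>]] by blast
  let ?t = "tail 0 (sym_box r)"
  \<comment> \<open>Sites at depth at least r have tail at most that of the box of radius r, the
    remaining shell at most \<open>energy\<close> each. The ratio equals (L - 2 r)^d / L^d, the
    share of the deep sites.\<close>
  have bound: "boundary (cube (L - 1)) / real L ^ CARD('d) \<le> ?t + energy * (1 - vol_ratio TYPE('d) (2 * r + 2) L)"
    if L: "L > 2 * r" for L
  proof -
    define c :: "'d site" where "c = (\<chi> i. int r)"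
    let ?V = "cube (L - 1) :: 'd site set" and ?I = "(+) c ` cube (L - 1 - 2 * r) :: 'd site set"
    have c: "c $ i = int r" for i by (simp add: c_def)
    have sub: "?I \<subseteq> ?V"
    proof clarify
      fix z :: "'d site" assume "z \<in> cube (L - 1 - 2 * r)"
      then have z: "0 \<le> z $ i" "z $ i \<le> int (L - 1 - 2 * r)" for i by (auto simp: cube_def)
      have "int (L - 1 - 2 * r) = int L - 1 - 2 * int r" using L by (simp add: of_nat_diff)
      moreover have "int (L - 1) = int L - 1" using L by (simp add: of_nat_diff)
      ultimately have "0 \<le> (c + z) $ i \<and> (c + z) $ i \<le> int (L - 1)" for i
        unfolding vector_add_component c using z[of i] by linarith
      then show "c + z \<in> cube (L - 1)" by (simp add: cube_def)
    qed
    have "tail x ?V \<le> ?t" if "x \<in> ?I" for x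
    proof -
      from that obtain z where z: "z \<in> cube (L - 1 - 2 * r)" "x = c + z" by (rule imageE) simp
      have "(+) x ` sym_box r \<subseteq> ?V"
      proof clarify
        fix w :: "'d site" assume w: "w \<in> sym_box r"
        have "0 \<le> (x + w) $ i \<and> (x + w) $ i \<le> int (L - 1)" for i
        proof -
          have "0 \<le> z $ i" "z $ i \<le> int (L - 1 - 2 * r)" "\<bar>w $ i\<bar> \<le> int r"
            using z w by (auto simp: cube_def sym_box_def)
          moreover have "int (L - 1 - 2 * r) = int L - 1 - 2 * int r" using L by (simp add: of_nat_diff)
          moreover have "int (L - 1) = int L - 1" using L by (simp add: of_nat_diff)
          ultimately show ?thesis unfolding z(2) vector_add_component c abs_le_iff by linarith
        qed
        then show "x + w \<in> cube (L - 1)" by (simp add: cube_def)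
      qed
      then have "tail x ?V \<le> tail x ((+) x ` sym_box r)" by (rule tail_antimono)
      then show ?thesis using tail_translate[of x 0 "sym_box r"] by simp
    qed
    then have inner: "(\<Sum>x\<in>?I. tail x ?V) \<le> real (card ?I) * ?t" by (intro sum_bounded_above)
    have outer: "(\<Sum>x\<in>?V - ?I. tail x ?V) \<le> real (card (?V - ?I)) * energy"
      by (intro sum_bounded_above tail_le_energy)
    have split: "boundary ?V = (\<Sum>x\<in>?V - ?I. tail x ?V) + (\<Sum>x\<in>?I. tail x ?V)"
      unfolding boundary_def by (rule sum.subset_diff[OF sub]) simp
    have "L - 1 - 2 * r + 1 = L - 2 * r" using L by simp
    then have cI: "card ?I = (L - 2 * r) ^ CARD('d)" by (simp only: card_translate card_cube)
    have cV: "card ?V = L ^ CARD('d)" using L by (simp add: card_cube)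
    have "card (?V - ?I) = card ?V - card ?I" by (rule card_Diff_subset[OF _ sub]) simp
    moreover have "card ?I \<le> card ?V" by (rule card_mono[OF _ sub]) simp
    ultimately have cD: "real (card (?V - ?I)) = real L ^ CARD('d) - real (L - 2 * r) ^ CARD('d)"
      unfolding cI cV by (simp only: of_nat_diff of_nat_power)
    have "boundary ?V \<le> (real L ^ CARD('d) - real (L - 2 * r) ^ CARD('d)) * energy +
        real (L - 2 * r) ^ CARD('d) * ?t"
      using inner outer split unfolding cD cI of_nat_power by linarith
    also have "\<dots> \<le> (real L ^ CARD('d) - real (L - 2 * r) ^ CARD('d)) * energy + real L ^ CARD('d) * ?t"
      by (intro add_left_mono mult_right_mono power_mono tail_nonneg) auto
    finally have "boundary ?V / real L ^ CARD('d) \<le>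
        ((real L ^ CARD('d) - real (L - 2 * r) ^ CARD('d)) * energy + real L ^ CARD('d) * ?t) / real L ^ CARD('d)"
      by (rule divide_right_mono) simp
    also have "\<dots> = ?t + energy * (1 - vol_ratio TYPE('d) (2 * r + 2) L)"
    proof -
      have "L + 2 - (2 * r + 2) = L - 2 * r" by simp
      moreover have "real L ^ CARD('d) > 0" using L by simp
      ultimately show ?thesis unfolding vol_ratio_def by (simp add: field_simps)
    qed
    finally show ?thesis .
  qed
  have "(\<lambda>L. ?t + energy * (1 - vol_ratio TYPE('d) (2 * r + 2) L)) \<longlonglongrightarrow> ?t + energy * (1 - 1)"
    by (intro tendsto_intros vol_ratio_tendsto)
  then have "\<forall>\<^sub>F L in sequentially. ?t + energy * (1 - vol_ratio TYPE('d) (2 * r + 2) L) < \<eta>"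
    by (rule order_tendstoD) (use r \<eta> in simp)
  with eventually_gt_at_top[of "2 * r"]
  have "\<forall>\<^sub>F L in sequentially. norm (boundary (cube (L - 1)) / real L ^ CARD('d) - 0) < \<eta>"
  proof eventually_elim
    case (elim L)
    have "0 \<le> boundary (cube (L - 1))" unfolding boundary_def by (intro sum_nonneg tail_nonneg)
    then show ?case using bound[OF elim(1)] elim(2) by simp
  qed
  then show "\<exists>no. \<forall>L\<ge>no. norm (boundary (cube (L - 1)) / real L ^ CARD('d) - 0) < \<eta>"
    by (simp add: eventually_sequentially)
qed

section \<open>Hamiltonians and Gibbs weights\<close>

definition touching :: "'d site set \<Rightarrow> 'd site set set" where
  "touching V = {A. finite A \<and> A \<inter> V \<noteq> {}}"

lemma touching_eq: "touching V = (\<Union>x\<in>V. sets_at x)"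
  by (auto simp: touching_def sets_at_def)

lemma touching_summable: "finite V \<Longrightarrow> U_norm summable_on touching V"
  unfolding touching_eq by (rule infsum_UN_le(1)) (auto simp: summable_sets_at U_norm_nonneg)

lemma hamiltonian_summable:
  assumes "finite V"
  shows "(\<lambda>A. U A (override_on \<zeta> \<sigma> V)) summable_on touching V"
  by (rule Infinite_Sum.abs_summable_summable,
      rule Infinite_Sum.abs_summable_on_comparison_test'[OF touching_summable[OF assms]])
    (auto simp: touching_def intro!: U_le_norm)

lemma hamiltonian_eq: "hamiltonian U V \<zeta> \<sigma> = (\<Sum>\<^sub>\<infinity>A\<in>touching V. U A (override_on \<zeta> \<sigma> V))"
  by (simp add: hamiltonian_def touching_def)

lemma hamiltonian_abs_le:
  assumes "finite V" shows "\<bar>hamiltonian U V \<zeta> \<sigma>\<bar> \<le> real (card V) * energy"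
proof -
  have "norm (hamiltonian U V \<zeta> \<sigma>) \<le> infsum U_norm (touching V)"
    unfolding hamiltonian_eq
    by (rule norm_infsum_le[OF has_sum_infsum[OF hamiltonian_summable[OF assms]] has_sum_infsum[OF touching_summable[OF assms]]])
      (auto simp: touching_def intro!: U_le_norm)
  also have "\<dots> \<le> (\<Sum>x\<in>V. infsum U_norm (sets_at x))"
    unfolding touching_eq by (rule infsum_UN_le(2)) (auto simp: assms summable_sets_at U_norm_nonneg)
  also have "\<dots> = (\<Sum>x\<in>V. tail x {})"
    by (intro sum.cong refl) (auto simp: tail_def sets_at_def intro!: arg_cong[where f = "infsum U_norm"])
  also have "\<dots> \<le> real (card V) * energy" by (intro sum_bounded_above tail_le_energy)
  finally show ?thesis by simp
qed

text \<open>Sets contained in V do not see the boundary condition, so only those leaving V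
  contribute to the difference, each by at most twice its norm.\<close>

lemma hamiltonian_boundary:
  assumes "finite V" shows "\<bar>hamiltonian U V \<zeta> \<sigma> - hamiltonian U V \<zeta>' \<sigma>\<bar> \<le> 2 * boundary V"
proof -
  let ?D = "\<lambda>A. U A (override_on \<zeta> \<sigma> V) - U A (override_on \<zeta>' \<sigma> V)"
  let ?B = "\<Union>x\<in>V. {A \<in> sets_at x. \<not> A \<subseteq> V}"
  have sB: "U_norm summable_on ?B" by (rule infsum_UN_le(1)) (auto simp: assms tail_summable U_norm_nonneg)
  have sD: "?D summable_on touching V"
    using summable_on_add[OF hamiltonian_summable[OF assms] summable_on_uminus[THEN iffD2, OF hamiltonian_summable[OF assms]]]
    by simp
  have zero: "?D A = 0" if "A \<in> touching V - ?B" for A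
  proof -
    have "A \<subseteq> V" "finite A" "A \<noteq> {}" using that by (auto simp: touching_def sets_at_def)
    then have "U A (override_on \<zeta> \<sigma> V) = U A (override_on \<zeta>' \<sigma> V)"
      by (intro U_local) (auto simp: override_on_def)
    then show ?thesis by simp
  qed
  have "hamiltonian U V \<zeta> \<sigma> - hamiltonian U V \<zeta>' \<sigma> = infsum ?D (touching V)"
    unfolding hamiltonian_eq
    using infsum_add[OF hamiltonian_summable[OF assms] summable_on_uminus[THEN iffD2, OF hamiltonian_summable[OF assms]]]
    by (simp add: infsum_uminus)
  also have "\<dots> = infsum ?D ?B"
    by (rule infsum_cong_neutral) (use zero in \<open>auto simp: touching_def sets_at_def\<close>)
  finally have eq: "hamiltonian U V \<zeta> \<sigma> - hamiltonian U V \<zeta>' \<sigma> = infsum ?D ?B" .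
  have sDB: "?D summable_on ?B"
    by (rule summable_on_subset_banach[OF sD]) (auto simp: touching_def sets_at_def)
  have "norm (infsum ?D ?B) \<le> infsum (\<lambda>A. 2 * U_norm A) ?B"
  proof (rule norm_infsum_le[OF has_sum_infsum[OF sDB] has_sum_infsum[OF summable_on_cmult_right[OF sB]]])
    fix A assume "A \<in> ?B"
    then have "finite A" "A \<noteq> {}" by (auto simp: sets_at_def)
    then show "norm (?D A) \<le> 2 * U_norm A"
      using U_le_norm[of A "override_on \<zeta> \<sigma> V"] U_le_norm[of A "override_on \<zeta>' \<sigma> V"] by simp
  qed
  also have "\<dots> = 2 * infsum U_norm ?B" by (rule infsum_cmult_right) (use sB in simp)
  also have "infsum U_norm ?B \<le> boundary V"
    unfolding boundary_def tail_def
    by (rule infsum_UN_le(2)) (auto simp: assms tail_summable U_norm_nonneg)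
  finally show ?thesis unfolding eq by simp
qed

definition weight :: "'d site set \<Rightarrow> ('d, 'a) config \<Rightarrow> ('d, 'a) config \<Rightarrow> real" where
  "weight V b \<zeta> = exp (- hamiltonian U V \<zeta> b) / (\<Sum>c\<in>patterns V. exp (- hamiltonian U V \<zeta> c))"

lemma partition_pos: "finite V \<Longrightarrow> (\<Sum>c\<in>patterns V. exp (- hamiltonian U V \<zeta> c)) > 0"
  by (rule sum_pos) (simp_all add: PiE_eq_empty_iff finite_patterns)

text \<open>One factor \<open>exp (2 * boundary V)\<close> comes from the numerator and one from the
  partition function.\<close>

lemma weight_ratio:
  assumes "finite V" shows "weight V b \<zeta> \<le> exp (4 * boundary V) * weight V b \<zeta>'"
proof -
  let ?e = "exp (2 * boundary V)" and ?Z = "\<lambda>\<zeta>. \<Sum>c\<in>patterns V. exp (- hamiltonian U V \<zeta> c)"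
  have cmp: "exp (- hamiltonian U V \<zeta> c) \<le> ?e * exp (- hamiltonian U V \<zeta>' c)" for \<zeta> \<zeta>' c
    using hamiltonian_boundary[OF assms, of \<zeta> c \<zeta>'] by (simp flip: exp_add)
  have "?Z \<zeta>' \<le> ?e * ?Z \<zeta>" unfolding sum_distrib_left by (intro sum_mono cmp)
  then have Z: "1 / ?Z \<zeta> \<le> ?e / ?Z \<zeta>'"
    using partition_pos[OF assms, of \<zeta>] partition_pos[OF assms, of \<zeta>'] by (simp add: field_simps)
  have "weight V b \<zeta> = exp (- hamiltonian U V \<zeta> b) * (1 / ?Z \<zeta>)" by (simp add: weight_def)
  also have "\<dots> \<le> (?e * exp (- hamiltonian U V \<zeta>' b)) * (?e / ?Z \<zeta>')"
    by (intro mult_mono cmp Z) (use partition_pos[OF assms, of \<zeta>] in auto)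
  also have "\<dots> = exp (4 * boundary V) * weight V b \<zeta>'"
    by (simp add: weight_def flip: exp_add)
  finally show ?thesis .
qed

lemma weight_lower:
  assumes "finite V" shows "exp (- 2 * real (card V) * energy) / real (CARD('a) ^ card V) \<le> weight V b \<zeta>"
proof -
  let ?k = "real (card V) * energy"
  have "(\<Sum>c\<in>patterns V. exp (- hamiltonian U V \<zeta> c)) \<le> (\<Sum>c\<in>(patterns V :: ('d, 'a) config set). exp ?k)"
  proof (intro sum_mono)
    show "exp (- hamiltonian U V \<zeta> c) \<le> exp ?k" for c
      using hamiltonian_abs_le[OF assms, of \<zeta> c] by simp
  qed
  also have "\<dots> = real (CARD('a) ^ card V) * exp ?k" by (simp add: card_PiE assms)
  finally have Z: "(\<Sum>c\<in>patterns V. exp (- hamiltonian U V \<zeta> c)) \<le> real (CARD('a) ^ card V) * exp ?k" .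
  have "exp (- 2 * real (card V) * energy) / real (CARD('a) ^ card V) = exp (- ?k) / (real (CARD('a) ^ card V) * exp ?k)"
    by (simp add: field_simps flip: exp_add)
  also have "\<dots> \<le> weight V b \<zeta>"
    unfolding weight_def
    by (intro frac_le Z partition_pos assms) (use hamiltonian_abs_le[OF assms, of \<zeta> b] in auto)
  finally show ?thesis .
qed

text \<open>By the Gibbs property \<open>weight\<close> is the conditional probability of the
  pattern given the outside; integrated over an outside event, bounds uniform in the boundary
  condition become bounds on joint probabilities.\<close>

lemma weight_bounds_prob:
  assumes V: "finite V" "V \<noteq> {}" and E: "E \<in> sets (local_sigma (- V))"
    and w: "\<And>\<zeta>. l \<le> weight V b \<zeta>" "\<And>\<zeta>. weight V b \<zeta> \<le> u"
  shows "l * prob E \<le> prob (agree V b \<inter> E)" "prob (agree V b \<inter> E) \<le> u * prob E"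
proof -
  let ?F = "local_sigma (- V) :: ('d, 'a) config measure"
  interpret S: finite_measure_subalgebra M ?F
    by unfold_locales (use local_sigma_sets in \<open>auto simp: subalgebra_def\<close>)
  let ?a = "restrict b V"
  let ?c = "real_cond_exp M ?F (indicator (agree V b))"
  \<comment> \<open>The Gibbs property speaks of extensional patterns only, while b is a total
    configuration.\<close>
  have w_restrict: "weight V ?a \<zeta> = weight V b \<zeta>" for \<zeta>
  proof -
    have "override_on \<zeta> ?a V = override_on \<zeta> b V" for \<zeta> by (auto simp: override_on_def)
    then show ?thesis by (simp add: weight_def hamiltonian_def)
  qed
  have "AE \<zeta> in M. \<forall>a\<in>patterns V. real_cond_exp M ?F (indicator (cylinder V a)) \<zeta> = weight V a \<zeta>"
    using gibbs_field V by (simp add: gibbs_field_def weight_def)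
  then have ae: "AE \<zeta> in M. l \<le> ?c \<zeta> \<and> ?c \<zeta> \<le> u"
  proof eventually_elim
    case (elim \<zeta>)
    then have "real_cond_exp M ?F (indicator (cylinder V ?a)) \<zeta> = weight V ?a \<zeta>"
      using restrict_in_patterns by blast
    then show ?case using w by (simp add: cylinder_restrict w_restrict)
  qed
  have EM: "E \<in> sets M" by (rule local_sigma_sets[OF E])
  have ind_int: "integrable M (indicator (agree V b) :: _ \<Rightarrow> real)"
    by (rule integrable_real_indicator) (use V in \<open>auto simp: emeasure_eq_measure\<close>)
  have "prob (agree V b \<inter> E) = (\<integral>\<zeta>\<in>E. indicator (agree V b) \<zeta> \<partial>M)"
    unfolding set_lebesgue_integral_def
    using V EM by (simp add: indicator_inter_arith[symmetric] Int_commute mult.commute)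
  also have "\<dots> = (\<integral>\<zeta>\<in>E. ?c \<zeta> \<partial>M)" by (rule S.real_cond_exp_intA[OF ind_int E])
  finally have eq: "prob (agree V b \<inter> E) = (\<integral>\<zeta>. indicator E \<zeta> * ?c \<zeta> \<partial>M)"
    by (simp add: set_lebesgue_integral_def)
  have c_int: "integrable M (\<lambda>\<zeta>. indicator E \<zeta> * ?c \<zeta>)"
    using integrable_mult_indicator[OF EM S.real_cond_exp_int(1)[OF ind_int]] by simp
  have const_int: "integrable M (\<lambda>\<zeta>. indicator E \<zeta> * k)" for k :: real
    using EM by (intro integrable_mult_left integrable_real_indicator) (auto simp: emeasure_eq_measure)
  have const: "(\<integral>\<zeta>. indicator E \<zeta> * k \<partial>M) = k * prob E" for k :: real
    using EM by simp
  show "l * prob E \<le> prob (agree V b \<inter> E)"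
    unfolding eq const[symmetric]
  proof (rule integral_mono_AE[OF const_int c_int])
    show "AE \<zeta> in M. indicator E \<zeta> * l \<le> indicator E \<zeta> * ?c \<zeta>"
      using ae by eventually_elim (auto simp: indicator_def)
  qed
  show "prob (agree V b \<inter> E) \<le> u * prob E"
    unfolding eq const[symmetric]
  proof (rule integral_mono_AE[OF c_int const_int])
    show "AE \<zeta> in M. indicator E \<zeta> * ?c \<zeta> \<le> indicator E \<zeta> * u"
      using ae by eventually_elim (auto simp: indicator_def)
  qed
qed

text \<open>The constant 8 is twice 4: the conditional and the unconditional probability of the
  pattern both lie within a factor \<open>exp (4 * boundary V)\<close> of one reference weight. Only
  the boundary of V enters, however complicated E is.\<close>

lemma almost_product:
  assumes V: "finite V" "V \<noteq> {}" and E: "E \<in> sets (local_sigma (- V))"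
  shows "prob (agree V b \<inter> E) \<le> exp (8 * boundary V) * (prob (agree V b) * prob E)"
    and "exp (- 8 * boundary V) * (prob (agree V b) * prob E) \<le> prob (agree V b \<inter> E)"
proof -
  define \<gamma> where "\<gamma> = weight V b undefined"
  let ?e = "exp (4 * boundary V)" and ?p = "prob (agree V b)"
  have \<gamma>: "\<gamma> \<ge> 0" using partition_pos[OF V(1), of undefined] by (simp add: \<gamma>_def weight_def)
  have up: "weight V b \<zeta> \<le> ?e * \<gamma>" for \<zeta> unfolding \<gamma>_def by (rule weight_ratio[OF V(1)])
  have low: "\<gamma> / ?e \<le> weight V b \<zeta>" for \<zeta>
    using weight_ratio[OF V(1), of b undefined \<zeta>] by (simp add: \<gamma>_def field_simps)
  note bnd = weight_bounds_prob[OF V _ low up]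
  have p: "\<gamma> / ?e \<le> ?p" "?p \<le> ?e * \<gamma>"
    using bnd[of UNIV] prob_space by auto
  have ee: "exp (8 * boundary V) = ?e * ?e" "exp (- 8 * boundary V) = 1 / (?e * ?e)"
    by (simp_all flip: exp_add add: exp_minus inverse_eq_divide)
  have "prob (agree V b \<inter> E) \<le> ?e * \<gamma> * prob E" by (rule bnd(2)[OF E])
  also have "\<dots> \<le> ?e * (?e * ?p) * prob E"
    using p(1) by (intro mult_right_mono mult_left_mono) (auto simp: field_simps)
  finally show "prob (agree V b \<inter> E) \<le> exp (8 * boundary V) * (?p * prob E)"
    unfolding ee(1) by (simp only: mult_ac)
  have "?p / ?e / ?e \<le> \<gamma> / ?e" using p(2) by (intro divide_right_mono) (auto simp: field_simps)
  then have "?p / ?e / ?e * prob E \<le> \<gamma> / ?e * prob E" by (rule mult_right_mono) simp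
  also have "\<dots> \<le> prob (agree V b \<inter> E)" by (rule bnd(1)[OF E])
  finally show "exp (- 8 * boundary V) * (?p * prob E) \<le> prob (agree V b \<inter> E)"
    by (simp only: ee) (simp add: field_simps)
qed

text \<open>The bound of \<open>weight_lower\<close> for a single site, uniform in the symbol and in
  the boundary condition: the finite-energy constant of the field.\<close>

definition \<delta> :: real where "\<delta> = exp (- 2 * energy) / real CARD('a)"

lemma \<delta>_pos: "\<delta> > 0"
  by (simp add: \<delta>_def)

lemma agree_single: "agree {x} b = {\<sigma>. \<sigma> x = b x}"
  by (simp add: agree_def)

lemma site_lower:
  assumes "E \<in> sets (local_sigma (- {x}))"
  shows "\<delta> * prob E \<le> prob ({\<sigma>. \<sigma> x = s} \<inter> E)"
proof -
  have up: "weight {x} (\<lambda>_. s) \<zeta> \<le> exp (4 * boundary {x}) * weight {x} (\<lambda>_. s) undefined" for \<zeta>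
    by (rule weight_ratio) simp
  have low: "\<delta> \<le> weight {x} (\<lambda>_. s) \<zeta>" for \<zeta>
    using weight_lower[of "{x}"] by (simp add: \<delta>_def)
  from weight_bounds_prob(1)[OF _ _ assms low up] show ?thesis by (simp add: agree_single)
qed

text \<open>Some other symbol t takes at least the proportion \<delta> of E, and the events for s
  and t are disjoint.\<close>

lemma site_upper:
  assumes E: "E \<in> sets (local_sigma (- {x}))" and card: "CARD('a) \<ge> 2"
  shows "prob ({\<sigma>. \<sigma> x = s} \<inter> E) \<le> (1 - \<delta>) * prob E"
proof -
  have "\<exists>t :: 'a. t \<noteq> s"
  proof (rule ccontr)
    assume "\<not> (\<exists>t :: 'a. t \<noteq> s)"
    then have "(UNIV :: 'a set) = {s}" by auto
    then have "CARD('a) = card {s}" by simp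
    then show False using card by simp
  qed
  then obtain t where t: "t \<noteq> s" by blast
  have sets: "{\<sigma>. \<sigma> x = s} \<inter> E \<in> sets M" "{\<sigma>. \<sigma> x = t} \<inter> E \<in> sets M" "E \<in> sets M" for s t
    using local_sigma_sets[OF E] site_in_config_space sets_M by auto
  have "prob ({\<sigma>. \<sigma> x = s} \<inter> E) + prob ({\<sigma>. \<sigma> x = t} \<inter> E) =
      prob (({\<sigma>. \<sigma> x = s} \<inter> E) \<union> ({\<sigma>. \<sigma> x = t} \<inter> E))"
    by (rule finite_measure_Union[symmetric]) (use sets t in auto)
  also have "\<dots> \<le> prob E" by (rule finite_measure_mono) (use sets in auto)
  finally show ?thesis using site_lower[OF E, of t] by (simp add: algebra_simps)
qed

text \<open>Sites are added one at a time: the agreement on the previous sites, intersected with E,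
  is an event off the next site.\<close>

lemma agree_bounds:
  assumes "finite D" "E \<in> sets (local_sigma W)" "D \<inter> W = {}"
  shows "\<delta> ^ card D * prob E \<le> prob (agree D b \<inter> E)"
    and "CARD('a) \<ge> 2 \<Longrightarrow> prob (agree D b \<inter> E) \<le> (1 - \<delta>) ^ card D * prob E"
proof -
  have "\<delta> ^ card D * prob E \<le> prob (agree D b \<inter> E) \<and>
    (CARD('a) \<ge> 2 \<longrightarrow> prob (agree D b \<inter> E) \<le> (1 - \<delta>) ^ card D * prob E)"
    using assms(1,3)
  proof (induction D rule: finite_induct)
    case (insert x D)
    have D: "agree D b \<inter> E \<in> sets (local_sigma (- {x}))"
    proof (rule sets.Int)
      show "agree D b \<in> sets (local_sigma (- {x}))"
        by (rule agree_in_local_sigma) (use insert.hyps in auto)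
      show "E \<in> sets (local_sigma (- {x}))"
        using local_sigma_mono[of W "- {x}"] assms(2) insert.prems by blast
    qed
    have eq: "agree (insert x D) b \<inter> E = {\<sigma>. \<sigma> x = b x} \<inter> (agree D b \<inter> E)"
      by (auto simp: agree_insert)
    have IH: "\<delta> ^ card D * prob E \<le> prob (agree D b \<inter> E)"
      "CARD('a) \<ge> 2 \<Longrightarrow> prob (agree D b \<inter> E) \<le> (1 - \<delta>) ^ card D * prob E"
      using insert.IH insert.prems by blast+
    have c: "card (insert x D) = Suc (card D)" using insert.hyps by simp
    have "\<delta> ^ card (insert x D) * prob E = \<delta> * (\<delta> ^ card D * prob E)" by (simp add: c)
    also have "\<dots> \<le> \<delta> * prob (agree D b \<inter> E)" by (rule mult_left_mono[OF IH(1)]) (use \<delta>_pos in simp)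
    also have "\<dots> \<le> prob (agree (insert x D) b \<inter> E)" unfolding eq by (rule site_lower[OF D])
    finally have low: "\<delta> ^ card (insert x D) * prob E \<le> prob (agree (insert x D) b \<inter> E)" .
    have "prob (agree (insert x D) b \<inter> E) \<le> (1 - \<delta>) ^ card (insert x D) * prob E"
      if card: "CARD('a) \<ge> 2"
    proof -
      from site_upper[OF UNIV_local_sigma card, of x undefined]
      have "prob {\<sigma>. \<sigma> x = undefined} \<le> 1 - \<delta>" using prob_space by simp
      then have "\<delta> \<le> 1" using measure_nonneg[of M "{\<sigma>. \<sigma> x = undefined}"] by linarith
      have "prob (agree (insert x D) b \<inter> E) \<le> (1 - \<delta>) * prob (agree D b \<inter> E)"
        unfolding eq by (rule site_upper[OF D card])
      also have "\<dots> \<le> (1 - \<delta>) * ((1 - \<delta>) ^ card D * prob E)"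
        by (rule mult_left_mono[OF IH(2)[OF card]]) (use \<open>\<delta> \<le> 1\<close> in simp)
      finally show ?thesis by (simp add: c)
    qed
    with low show ?case by blast
  qed simp
  then show "\<delta> ^ card D * prob E \<le> prob (agree D b \<inter> E)"
    "CARD('a) \<ge> 2 \<Longrightarrow> prob (agree D b \<inter> E) \<le> (1 - \<delta>) ^ card D * prob E" by auto
qed

lemma measure_agree_lower: "finite D \<Longrightarrow> \<delta> ^ card D \<le> prob (agree D b)"
  using agree_bounds(1)[of D UNIV "{}" b] prob_space
  by simp

lemma measure_agree_pos: "finite D \<Longrightarrow> 0 < prob (agree D b)"
  using measure_agree_lower[of D b] \<delta>_pos by (smt (verit) zero_less_power)

definition info :: "('d, 'a) config \<Rightarrow> 'd site set \<Rightarrow> real" where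
  "info \<xi> V = - ln (prob (agree V \<xi>))"

lemma info_nonneg: "0 \<le> info \<xi> V"
  using measure_ln_le by (simp add: info_def)

lemma info_le:
  assumes "finite V" shows "info \<xi> V \<le> \<bar>ln \<delta>\<bar> * real (card V)"
proof -
  have "ln (\<delta> ^ card V) \<le> ln (prob (agree V \<xi>))"
    using measure_agree_lower[OF assms, of \<xi>] \<delta>_pos by (subst ln_le_cancel_iff) (auto intro: measure_agree_pos[OF assms])
  then have "info \<xi> V \<le> real (card V) * (- ln \<delta>)" using \<delta>_pos by (simp add: info_def ln_realpow)
  also have "\<dots> \<le> real (card V) * \<bar>ln \<delta>\<bar>" by (rule mult_left_mono) auto
  finally show ?thesis by (simp add: mult.commute)
qed

text \<open>The logarithm of \<open>almost_product\<close>, with agreement on D as the outside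
  event. The asymmetry between V and D is what the tiling estimate tolerates.\<close>

lemma info_almost_additive:
  assumes "finite V" "V \<noteq> {}" "finite D" "D \<inter> V = {}"
  shows "\<bar>info \<xi> (V \<union> D) - info \<xi> V - info \<xi> D\<bar> \<le> 8 * boundary V"
proof -
  have D: "agree D \<xi> \<in> sets (local_sigma (- V))" by (rule agree_in_local_sigma) (use assms in auto)
  let ?a = "prob (agree V \<xi>)" and ?b = "prob (agree D \<xi>)" and ?c = "prob (agree (V \<union> D) \<xi>)"
  have pos: "?a > 0" "?b > 0" "?c > 0" using assms by (auto intro: measure_agree_pos)
  have up: "?c \<le> exp (8 * boundary V) * (?a * ?b)" and low: "exp (- 8 * boundary V) * (?a * ?b) \<le> ?c"
    using almost_product[OF assms(1,2) D, of \<xi>] by (simp_all add: agree_Un)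
  have "ln ?c \<le> ln (exp (8 * boundary V) * (?a * ?b))" using up pos by (subst ln_le_cancel_iff) auto
  moreover have "ln (exp (- 8 * boundary V) * (?a * ?b)) \<le> ln ?c" using low pos by (subst ln_le_cancel_iff) auto
  ultimately show ?thesis using pos by (simp add: info_def ln_mult abs_le_iff)
qed

end

section \<open>Occurrences of a pattern\<close>

text \<open>Ratio test. Summability also yields convergence to 0, so this serves wherever
  exponential decay must beat a polynomial.\<close>

lemma summable_poly_geometric:
  fixes a q :: real
  assumes "a \<ge> 0" "0 < q" "q < 1"
  shows "summable (\<lambda>r. (a * real r + 1) ^ d * q ^ r)"
proof -
  define k where "k = (1 + q) / 2"
  have k: "q < k" "k < 1" using assms by (auto simp: k_def)
  have pos: "a * real r + 1 > 0" for r using assms by (simp add: add_nonneg_pos)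
  have "(\<lambda>r. 1 + a / (a * real r + 1)) \<longlonglongrightarrow> 1"
  proof (cases "a = 0")
    case False
    then have "a > 0" using assms by simp
    then have "(\<lambda>r. a / (a * real r + 1)) \<longlonglongrightarrow> 0" by real_asymp
    from tendsto_add[OF tendsto_const[of 1] this] show ?thesis by simp
  qed simp
  then have "(\<lambda>r. (1 + a / (a * real r + 1)) ^ d * q) \<longlonglongrightarrow> 1 ^ d * q"
    by (intro tendsto_intros)
  then have "\<forall>\<^sub>F r in sequentially. (1 + a / (a * real r + 1)) ^ d * q < k"
    by (rule order_tendstoD) (use k in simp)
  then obtain N where N: "\<And>r. r \<ge> N \<Longrightarrow> (1 + a / (a * real r + 1)) ^ d * q < k"
    by (auto simp: eventually_sequentially)
  show ?thesis
  proof (rule summable_ratio_test[OF k(2)])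
    fix r assume "N \<le> r"
    let ?f = "\<lambda>r. (a * real r + 1) ^ d * q ^ r"
    have "a * real (Suc r) + 1 = (1 + a / (a * real r + 1)) * (a * real r + 1)"
      using pos[of r] by (simp add: field_simps)
    then have "?f (Suc r) = ((1 + a / (a * real r + 1)) ^ d * q) * ?f r"
      by (simp only: power_mult_distrib power_Suc mult_ac)
    also have "\<dots> \<le> k * ?f r"
      by (rule mult_right_mono) (use N[OF \<open>N \<le> r\<close>] pos[of r] assms in auto)
    finally have le: "?f (Suc r) \<le> k * ?f r" .
    have "?f r \<ge> 0" for r using pos[of r] assms by simp
    then have "norm (?f r) = ?f r" for r by (simp only: real_norm_def abs_of_nonneg)
    then show "norm (?f (Suc r)) \<le> k * norm (?f r)" using le by (simp only:)
  qed
qed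

text \<open>At most (2 r + 1)^d sites have norm r, so grouping by norm leaves a polynomial against a
  geometric factor. The bound is uniform over finite sets of sites.\<close>

lemma exp_l1_sum_bounded:
  assumes "c > 0"
  shows "\<exists>S. \<forall>F :: 'd::finite site set. finite F \<longrightarrow> (\<Sum>z\<in>F. exp (- c * real_of_int (l1_norm z))) \<le> S"
proof (intro exI allI impI)
  let ?f = "\<lambda>r. (2 * real r + 1) ^ CARD('d) * exp (- c) ^ r"
  have sm: "summable ?f" by (rule summable_poly_geometric) (use assms in auto)
  fix F :: "'d site set" assume F: "finite F"
  let ?n = "\<lambda>z :: 'd site. nat (l1_norm z)"
  have e: "exp (- c * real_of_int (l1_norm z)) = exp (- c) ^ ?n z" for z :: "'d site"
    using l1_norm_nonneg[of z] by (simp flip: exp_of_nat_mult add: mult.commute)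
  have "(\<Sum>z\<in>F. exp (- c * real_of_int (l1_norm z))) = (\<Sum>r\<in>?n ` F. \<Sum>z\<in>{z \<in> F. ?n z = r}. exp (- c) ^ ?n z)"
    unfolding e by (rule sum.image_gen[OF F])
  also have "\<dots> \<le> (\<Sum>r\<in>?n ` F. ?f r)"
  proof (rule sum_mono)
    fix r
    let ?S = "{z \<in> F. ?n z = r}"
    have near: "\<bar>z $ i - (0 :: 'd site) $ i\<bar> \<le> int r" if "z \<in> ?S" for z i
      using that abs_le_l1_norm[of z i] l1_norm_nonneg[of z] by auto
    have "card ?S \<le> (2 * r + 1) ^ CARD('d)" by (rule card_box_le(2)[OF near])
    then have "real (card ?S) \<le> real ((2 * r + 1) ^ CARD('d))" by (simp only: of_nat_le_iff)
    also have "\<dots> = (2 * real r + 1) ^ CARD('d)" by (simp add: add.commute)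
    finally have "real (card ?S) * exp (- c) ^ r \<le> ?f r" by (rule mult_right_mono) simp
    moreover have "(\<Sum>z\<in>?S. exp (- c) ^ ?n z) = real (card ?S) * exp (- c) ^ r" by simp
    ultimately show "(\<Sum>z\<in>?S. exp (- c) ^ ?n z) \<le> ?f r" by simp
  qed
  also have "\<dots> \<le> suminf ?f"
    by (rule sum_le_suminf[OF sm]) (use F in auto)
  finally show "(\<Sum>z\<in>F. exp (- c * real_of_int (l1_norm z))) \<le> suminf ?f" .
qed

section \<open>Hitting events and waiting times\<close>

definition occurs :: "nat \<Rightarrow> ('d::finite, 'a) config \<Rightarrow> 'd site \<Rightarrow> ('d, 'a) config set" where
  "occurs n a x = shift x -` agree (cube n) a"

definition hit :: "nat \<Rightarrow> ('d::finite, 'a) config \<Rightarrow> 'd site set \<Rightarrow> ('d, 'a) config set" where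
  "hit n a B = (\<Union>x\<in>B. occurs n a x)"

lemma occurs_local:
  "(+) x ` cube n \<subseteq> W \<Longrightarrow> occurs n a x \<in> sets (local_sigma W)"
  unfolding occurs_def vimage_shift_agree by (rule agree_in_local_sigma) auto

lemma hit_local:
  assumes "finite B" "\<And>x. x \<in> B \<Longrightarrow> (+) x ` cube n \<subseteq> W"
  shows "hit n a B \<in> sets (local_sigma W)"
  unfolding hit_def by (rule sets.finite_UN[OF assms(1)]) (rule occurs_local[OF assms(2)])

lemma hit_mono: "B \<subseteq> C \<Longrightarrow> hit n a B \<subseteq> hit n a C"
  by (auto simp: hit_def)

lemma mem_hit_iff: "\<sigma> \<in> hit n \<xi> B \<longleftrightarrow> (\<exists>x\<in>B. restrict (shift x \<sigma>) (cube n) = restrict \<xi> (cube n))"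
  by (auto simp: hit_def occurs_def agree_def restrict_eq_iff)

lemma waiting_time_alt:
  "waiting_time n \<xi> \<sigma> = Inf {enat k | k. \<sigma> \<in> hit n \<xi> (cube k - {0})}"
  unfolding waiting_time_def mem_hit_iff l1_norm_pos_iff
  by (rule arg_cong[where f = Inf]) (auto simp: cube_def)

lemma waiting_time_le: "\<sigma> \<in> hit n \<xi> (cube k - {0}) \<Longrightarrow> waiting_time n \<xi> \<sigma> \<le> enat k"
  unfolding waiting_time_alt by (rule Inf_lower) auto

text \<open>An infimum of extended naturals is attained on a nonempty set, and on the empty set it
  is infinite; a finite waiting time is therefore witnessed.\<close>

lemma waiting_time_hit:
  assumes "waiting_time n \<xi> \<sigma> = enat k" shows "\<sigma> \<in> hit n \<xi> (cube k - {0})"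
proof -
  let ?A = "{enat k | k. \<sigma> \<in> hit n \<xi> (cube k - {0})}"
  have "?A \<noteq> {}"
  proof
    assume "?A = {}"
    then have "waiting_time n \<xi> \<sigma> = Inf {}" unfolding waiting_time_alt by (simp only:)
    then show False using assms by (simp add: top_enat_def)
  qed
  then obtain u where "u \<in> ?A" by blast
  then have "(LEAST u. u \<in> ?A) \<in> ?A" by (rule LeastI)
  then have "Inf ?A \<in> ?A" using \<open>?A \<noteq> {}\<close> by (simp only: Inf_enat_def if_False)
  then show ?thesis using assms unfolding waiting_time_alt by auto
qed

lemma cube_0: "cube 0 = {0 :: 'd::finite site}"
  by (auto simp: cube_def vec_eq_iff order_class.order_eq_iff)

text \<open>The box of side 0 holds only the excluded origin. Positivity is what allows logarithms
  of waiting times.\<close>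

lemma waiting_time_pos: "waiting_time n \<xi> \<sigma> = enat k \<Longrightarrow> k \<ge> 1"
  using waiting_time_hit[of n \<xi> \<sigma> k] by (cases k) (auto simp: cube_0 hit_def)

context shift_field
begin

lemma occurs_sets: "occurs n a x \<in> sets M"
  unfolding occurs_def vimage_shift_agree by simp

lemma hit_sets: "finite B \<Longrightarrow> hit n a B \<in> sets M"
  unfolding hit_def by (rule sets.finite_UN) (auto simp: occurs_sets)

lemma measure_occurs: "prob (occurs n a x) = prob (agree (cube n) a)"
  unfolding occurs_def by (rule measure_vimage_shift) simp

text \<open>The witness bounds the waiting time from below: a waiting time \<open>w\<close> with \<open>w\<^sup>d p < \<theta>\<close> forces
  an occurrence within the largest box satisfying this inequality.\<close>

lemma early_hit:
  assumes p: "prob (agree (cube n) \<xi>) > 0" and \<theta>: "\<theta> > 0"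
  shows "\<exists>k. (\<forall>\<sigma> w. waiting_time n \<xi> \<sigma> = enat w \<longrightarrow> real w ^ CARD('d) * prob (agree (cube n) \<xi>) < \<theta>
      \<longrightarrow> \<sigma> \<in> hit n \<xi> (cube k - {0})) \<and>
    prob (hit n \<xi> (cube k - {0})) \<le> 2 ^ CARD('d) * \<theta>"
proof -
  let ?p = "prob (agree (cube n) \<xi>)" and ?d = "CARD('d)"
  define K where "K = {k. real k ^ ?d * ?p < \<theta>}"
  have "K \<subseteq> {..nat \<lceil>\<theta> / ?p\<rceil>}"
  proof
    fix k assume "k \<in> K"
    then have "real k ^ ?d < \<theta> / ?p" using p by (simp add: K_def field_simps)
    moreover have "real k \<le> real k ^ ?d" by (cases k) (auto intro: self_le_power)
    ultimately have "real k \<le> \<theta> / ?p" by linarith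
    then show "k \<in> {..nat \<lceil>\<theta> / ?p\<rceil>}" by (simp add: le_nat_iff) linarith
  qed
  then have fin: "finite K" by (rule finite_subset) simp
  have "0 \<in> K" using \<theta> by (simp add: K_def power_0_left)
  define k where "k = Max K"
  have k: "k \<in> K" unfolding k_def by (rule Max_in) (use fin \<open>0 \<in> K\<close> in auto)
  \<comment> \<open>The factor 2^d absorbs (k + 1)^d \<le> (2 k)^d for k \<ge> 1; for k = 0 no
    position is left once the origin is removed.\<close>
  have "prob (hit n \<xi> (cube k - {0})) \<le> 2 ^ ?d * \<theta>"
  proof (cases "k = 0")
    case True
    then show ?thesis using \<theta> by (simp add: cube_0 hit_def)
  next
    case False
    have "prob (hit n \<xi> (cube k - {0})) \<le> (\<Sum>x\<in>cube k - {0 :: 'd site}. prob (occurs n \<xi> x))"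
      unfolding hit_def by (rule finite_measure_subadditive_finite) (auto simp: occurs_sets)
    also have "\<dots> = real (card (cube k - {0 :: 'd site})) * ?p" by (simp add: measure_occurs)
    also have "\<dots> \<le> real ((2 * k) ^ ?d) * ?p"
    proof (intro mult_right_mono)
      have "card (cube k - {0 :: 'd site}) \<le> card (cube k :: 'd site set)" by (rule card_mono) auto
      also have "\<dots> \<le> (2 * k) ^ ?d" unfolding card_cube by (rule power_mono) (use False in auto)
      finally show "real (card (cube k - {0 :: 'd site})) \<le> real ((2 * k) ^ ?d)" by (simp only: of_nat_le_iff)
    qed simp
    also have "\<dots> = 2 ^ ?d * (real k ^ ?d * ?p)" by (simp add: power_mult_distrib)
    also have "\<dots> \<le> 2 ^ ?d * \<theta>" using k by (intro mult_left_mono) (auto simp: K_def)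
    finally show ?thesis .
  qed
  moreover have "\<sigma> \<in> hit n \<xi> (cube k - {0})"
    if w: "waiting_time n \<xi> \<sigma> = enat w" "real w ^ ?d * ?p < \<theta>" for \<sigma> w
  proof -
    have "w \<le> k" unfolding k_def by (rule Max_ge[OF fin]) (use w in \<open>simp add: K_def\<close>)
    then have "cube w - {0} \<subseteq> (cube k - {0} :: 'd site set)" using cube_mono[of w k] by blast
    then show ?thesis using hit_mono waiting_time_hit[OF w(1)] by blast
  qed
  ultimately show ?thesis by blast
qed

text \<open>With \<open>N\<close> the number of occurrences in \<open>B\<close>, the indicator of \<open>N > 0\<close>
  dominates \<open>2 t N - t\<^sup>2 N\<^sup>2\<close> for every \<open>t\<close>.\<close>

lemma second_moment:
  assumes B: "finite B"
    and pairs: "\<And>x. x \<in> B \<Longrightarrow> (\<Sum>y\<in>B. prob (occurs n a x \<inter> occurs n a y)) \<le> c * prob (agree (cube n) a)"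
    and c: "c > 0"
  shows "prob (hit n a B) \<ge> real (card B) * prob (agree (cube n) a) / c"
proof -
  let ?p = "prob (agree (cube n) a)"
  define N where "N \<sigma> = (\<Sum>x\<in>B. indicator (occurs n a x) \<sigma> :: real)" for \<sigma>
  have iint: "integrable M (\<lambda>\<sigma>. indicator (occurs n a x) \<sigma> :: real)" for x
    by (rule integrable_real_indicator) (auto simp: occurs_sets emeasure_eq_measure)
  have iint2: "integrable M (\<lambda>\<sigma>. indicator (occurs n a x \<inter> occurs n a y) \<sigma> :: real)" for x y
    by (rule integrable_real_indicator) (auto simp: occurs_sets emeasure_eq_measure)
  have Nint: "integrable M N" unfolding N_def[abs_def] by (rule Bochner_Integration.integrable_sum) (rule iint)
  have EN: "(\<integral>\<sigma>. N \<sigma> \<partial>M) = real (card B) * ?p"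
    unfolding N_def by (subst Bochner_Integration.integral_sum[OF iint]) (simp add: occurs_sets measure_occurs)
  have N2: "N \<sigma> * N \<sigma> = (\<Sum>x\<in>B. \<Sum>y\<in>B. indicator (occurs n a x \<inter> occurs n a y) \<sigma>)" for \<sigma>
    unfolding N_def sum_product by (simp add: indicator_inter_arith)
  have N2int: "integrable M (\<lambda>\<sigma>. N \<sigma> * N \<sigma>)"
    unfolding N2 by (intro Bochner_Integration.integrable_sum iint2)
  have "(\<integral>\<sigma>. N \<sigma> * N \<sigma> \<partial>M) = (\<Sum>x\<in>B. \<Sum>y\<in>B. prob (occurs n a x \<inter> occurs n a y))"
    unfolding N2
    by (subst Bochner_Integration.integral_sum, intro Bochner_Integration.integrable_sum iint2)
      (simp add: Bochner_Integration.integral_sum[OF iint2] occurs_sets)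
  also have "\<dots> \<le> (\<Sum>x\<in>B. c * ?p)" by (rule sum_mono) (rule pairs)
  finally have EN2: "(\<integral>\<sigma>. N \<sigma> * N \<sigma> \<partial>M) \<le> c * (real (card B) * ?p)" by (simp add: mult_ac)
  have H: "hit n a B \<in> sets M" by (rule hit_sets[OF B])
  \<comment> \<open>The parameter is t = 1 / c, the best choice when the second moment is bounded by
    c times the mean.\<close>
  have "(\<integral>\<sigma>. 2 / c * N \<sigma> - 1 / (c * c) * (N \<sigma> * N \<sigma>) \<partial>M) \<le> (\<integral>\<sigma>. indicator (hit n a B) \<sigma> \<partial>M)"
  proof (rule integral_mono)
    show "integrable M (\<lambda>\<sigma>. 2 / c * N \<sigma> - 1 / (c * c) * (N \<sigma> * N \<sigma>))"
      by (intro Bochner_Integration.integrable_diff integrable_mult_right Nint N2int)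
    show "integrable M (\<lambda>\<sigma>. indicator (hit n a B) \<sigma> :: real)"
      by (rule integrable_real_indicator[OF H]) (simp add: emeasure_eq_measure)
    fix \<sigma>
    show "2 / c * N \<sigma> - 1 / (c * c) * (N \<sigma> * N \<sigma>) \<le> indicator (hit n a B) \<sigma>"
    proof (cases "\<sigma> \<in> hit n a B")
      case True
      have "0 \<le> (N \<sigma> / c - 1) * (N \<sigma> / c - 1)" by simp
      then show ?thesis using True c by (simp add: field_simps)
    next
      case False
      then have "N \<sigma> = 0" by (simp add: N_def hit_def)
      then show ?thesis using False by simp
    qed
  qed
  then have "2 / c * (\<integral>\<sigma>. N \<sigma> \<partial>M) - 1 / (c * c) * (\<integral>\<sigma>. N \<sigma> * N \<sigma> \<partial>M) \<le> prob (hit n a B)"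
    using Nint N2int H by simp
  moreover have "1 / (c * c) * (\<integral>\<sigma>. N \<sigma> * N \<sigma> \<partial>M) \<le> 1 / (c * c) * (c * (real (card B) * ?p))"
    by (rule mult_left_mono[OF EN2]) (use c in simp)
  moreover have "1 / (c * c) * (c * (real (card B) * ?p)) = real (card B) * ?p / c"
    "2 / c * (real (card B) * ?p) = real (card B) * ?p / c + real (card B) * ?p / c"
    using c by (simp_all add: field_simps)
  ultimately show ?thesis unfolding EN by linarith
qed

end

text \<open>A real supremum dominates its members only if they are bounded, here by 1; the rest
  clears denominators. The form keeps the factor \<open>measure M E2\<close> on the error, which is
  the gain of conditional mixing.\<close>

lemma phi_mix_ineq:
  fixes M :: "('d::finite, 'a::finite) config measure"
  assumes "random_field M" and A: "finite A1" "A1 \<noteq> {}" "finite A2" "A2 \<noteq> {}"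
    and m: "m \<le> real_of_int (site_dist A1 A2)"
    and E: "E1 \<in> sets (local_sigma A1)" "E2 \<in> sets (local_sigma A2)"
  shows "measure M (E1 \<inter> E2) \<le> measure M E1 * measure M E2 + real (card A1) * phi_mix M m * measure M E2"
proof -
  interpret prob_space M using assms(1) by (simp add: random_field_def)
  have setsM: "sets M = sets config_space" using assms(1) by (simp add: random_field_def)
  then have sp: "space M = UNIV" using sets_eq_imp_space_eq by fastforce
  have EM: "E1 \<in> sets M" "E2 \<in> sets M"
    using E local_sigma_subset_config_space setsM by auto
  show ?thesis
  proof (cases "measure M E2 = 0")
    case True
    have "measure M (E1 \<inter> E2) \<le> measure M E2" by (rule finite_measure_mono) (use EM in auto)
    then show ?thesis using True measure_nonneg[of M "E1 \<inter> E2"] by simp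
  next
    case False
    then have pos: "measure M E2 > 0" by (simp add: zero_less_measure_iff)
    let ?S = "{1 / real (card A1) * \<bar>\<P>(\<sigma> in M. \<sigma> \<in> E1 \<bar> \<sigma> \<in> E2) - measure M E1\<bar> | A1 A2 E1 E2.
     finite A1 \<and> A1 \<noteq> {} \<and> finite A2 \<and> A2 \<noteq> {} \<and> m \<le> real_of_int (site_dist A1 A2) \<and>
     E1 \<in> sets (local_sigma A1) \<and> E2 \<in> sets (local_sigma A2) \<and> measure M E2 > 0}"
    have cond01: "0 \<le> \<P>(\<sigma> in M. \<sigma> \<in> E \<bar> \<sigma> \<in> F)" "\<P>(\<sigma> in M. \<sigma> \<in> E \<bar> \<sigma> \<in> F) \<le> 1"
      if "E \<in> sets M" "F \<in> sets M" for E F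
    proof -
      have "measure M {\<sigma> \<in> space M. \<sigma> \<in> E \<and> \<sigma> \<in> F} \<le> measure M {\<sigma> \<in> space M. \<sigma> \<in> F}"
        by (rule finite_measure_mono) (use that sp in auto)
      then show "0 \<le> \<P>(\<sigma> in M. \<sigma> \<in> E \<bar> \<sigma> \<in> F)" "\<P>(\<sigma> in M. \<sigma> \<in> E \<bar> \<sigma> \<in> F) \<le> 1"
        by (simp_all add: cond_prob_def divide_le_eq_1 zero_less_measure_iff)
    qed
    have bdd: "bdd_above ?S"
    proof (rule bdd_aboveI)
      fix v assume "v \<in> ?S"
      then obtain A :: "'d site set" and B E F where v: "v = 1 / real (card A) * \<bar>\<P>(\<sigma> in M. \<sigma> \<in> E \<bar> \<sigma> \<in> F) - measure M E\<bar>"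
        "finite A" "A \<noteq> {}" "E \<in> sets (local_sigma A)" "F \<in> sets (local_sigma B)" by blast
      have "E \<in> sets M" "F \<in> sets M" using v local_sigma_subset_config_space setsM by blast+
      from cond01[OF this] have "\<bar>\<P>(\<sigma> in M. \<sigma> \<in> E \<bar> \<sigma> \<in> F) - measure M E\<bar> \<le> 1"
        using prob_le_1[of E] measure_nonneg[of M E] by linarith
      moreover have "card A \<ge> 1" using v by (simp add: Suc_le_eq card_gt_0_iff)
      then have "1 / real (card A) \<le> 1" by simp
      ultimately have "v \<le> 1 * 1" unfolding v(1) by (intro mult_mono) auto
      then show "v \<le> 1" by simp
    qed
    have "1 / real (card A1) * \<bar>\<P>(\<sigma> in M. \<sigma> \<in> E1 \<bar> \<sigma> \<in> E2) - measure M E1\<bar> \<in> ?S"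
      using A m E pos by blast
    then have "1 / real (card A1) * \<bar>\<P>(\<sigma> in M. \<sigma> \<in> E1 \<bar> \<sigma> \<in> E2) - measure M E1\<bar> \<le> phi_mix M m"
      unfolding phi_mix_def by (rule cSup_upper[OF _ bdd])
    moreover have "real (card A1) > 0" using A by (simp add: card_gt_0_iff)
    ultimately have "\<bar>\<P>(\<sigma> in M. \<sigma> \<in> E1 \<bar> \<sigma> \<in> E2) - measure M E1\<bar> \<le> real (card A1) * phi_mix M m"
      by (simp add: field_simps)
    moreover have "\<P>(\<sigma> in M. \<sigma> \<in> E1 \<bar> \<sigma> \<in> E2) = measure M (E1 \<inter> E2) / measure M E2"
      unfolding cond_prob_def sp by (simp add: Int_def)
    ultimately have "measure M (E1 \<inter> E2) / measure M E2 \<le> measure M E1 + real (card A1) * phi_mix M m"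
      by linarith
    then show ?thesis using pos by (simp add: field_simps)
  qed
qed

section \<open>Pair correlations of occurrences under mixing\<close>

locale gibbs_mixing = gibbs U M
  for U :: "'d::finite site set \<Rightarrow> ('d, 'a::finite) config \<Rightarrow> real" and M +
  fixes C1 C2 :: real
  assumes dim: "CARD('d) \<ge> 2" and C1: "C1 > 0" and C2: "C2 > 0"
    and phi: "\<And>m. m > 0 \<Longrightarrow> phi_mix M m \<le> C1 * exp (- C2 * m)"
begin

lemma mixing:
  assumes A: "finite A1" "A1 \<noteq> {}" "finite A2" "A2 \<noteq> {}" and m: "m > 0"
    and dist: "\<And>x y. x \<in> A1 \<Longrightarrow> y \<in> A2 \<Longrightarrow> m \<le> real_of_int (l1_norm (x - y))"
    and E: "E1 \<in> sets (local_sigma A1)" "E2 \<in> sets (local_sigma A2)"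
  shows "prob (E1 \<inter> E2) \<le> (prob E1 + real (card A1) * (C1 * exp (- C2 * m))) * prob E2"
proof -
  have "prob (E1 \<inter> E2) \<le> prob E1 * prob E2 + real (card A1) * phi_mix M m * prob E2"
    by (rule phi_mix_ineq[OF random_field A le_site_distI[OF A dist] E])
  also have "real (card A1) * phi_mix M m * prob E2 \<le> real (card A1) * (C1 * exp (- C2 * m)) * prob E2"
    by (intro mult_right_mono mult_left_mono phi m) auto
  finally show ?thesis by (simp add: algebra_simps)
qed

text \<open>A window has l1-diameter at most d n, so windows whose corners are l \<ge> 2 d n apart
  are still at distance l / 2. The occurrence at y plays the conditioning event, which puts
  \<open>p\<close> in front of the mixing error.\<close>

lemma far_pair:
  assumes far: "2 * int CARD('d) * int n \<le> l1_norm (x - y)" and "x \<noteq> y"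
  shows "prob (occurs n a x \<inter> occurs n a y) \<le>
    (prob (agree (cube n) a) + real (n + 1) ^ CARD('d) * (C1 * exp (- C2 * (real_of_int (l1_norm (x - y)) / 2)))) *
      prob (agree (cube n) a)"
proof -
  let ?A = "(+) x ` cube n" and ?B = "(+) y ` cube n" and ?m = "real_of_int (l1_norm (x - y)) / 2"
  have "prob (occurs n a x \<inter> occurs n a y) \<le>
      (prob (occurs n a x) + real (card ?A) * (C1 * exp (- C2 * ?m))) * prob (occurs n a y)"
  proof (rule mixing)
    show "?A \<noteq> {}" "?B \<noteq> {}" using zero_in_cube by blast+
    show "?m > 0" using \<open>x \<noteq> y\<close> l1_norm_pos_iff[of "x - y"] by simp
    fix u w assume "u \<in> ?A" "w \<in> ?B"
    then obtain s t where st: "s \<in> cube n" "t \<in> cube n" "u = x + s" "w = y + t" by auto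
    have "x - y = (u - w) + (t - s)" using st by simp
    then have "l1_norm (x - y) \<le> l1_norm (u - w) + l1_norm (t - s)" using l1_norm_triangle by metis
    moreover have "l1_norm (t - s) \<le> int CARD('d) * int n" by (rule l1_norm_cube_diff) (use st in auto)
    ultimately have "l1_norm (x - y) \<le> 2 * l1_norm (u - w)" using far by linarith
    then show "?m \<le> real_of_int (l1_norm (u - w))" by linarith
  qed (auto intro: occurs_local)
  then show ?thesis by (simp only: measure_occurs card_translate card_cube of_nat_power)
qed

text \<open>In a coordinate i where x and y differ, one of the two opposite faces of the window at y
  misses the window at x. A second direction j supplies n + 1 sites inside this face.\<close>

lemma near_pair:
  assumes "x \<noteq> y" and card: "CARD('a) \<ge> 2"
  shows "prob (occurs n a x \<inter> occurs n a y) \<le> (1 - \<delta>) ^ (n + 1) * prob (agree (cube n) a)"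
proof -
  obtain i where i: "x $ i \<noteq> y $ i" using \<open>x \<noteq> y\<close> by (auto simp: vec_eq_iff)
  have "\<exists>j. j \<noteq> i"
  proof (rule ccontr)
    assume "\<not> (\<exists>j. j \<noteq> i)"
    then have "(UNIV :: 'd set) = {i}" by auto
    then have "CARD('d) = card {i}" by simp
    then show False using dim by simp
  qed
  then obtain j where j: "j \<noteq> i" by blast
  \<comment> \<open>The face away from x: the lower one when y lies below x in direction i, the
    upper one otherwise.\<close>
  define s where "s = (if x $ i > y $ i then 0 else int n)"
  define e where "e t = (\<chi> k. if k = i then s else if k = j then int t else 0)" for t :: nat
  define D where "D = (\<lambda>t. y + e t) ` {..n}"
  have e: "e t $ i = s" "e t $ j = int t" for t using j by (auto simp: e_def)
  have "inj_on (\<lambda>t. y + e t) {..n}"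
  proof (rule inj_onI)
    fix t t' assume "y + e t = y + e t'"
    then have "e t $ j = e t' $ j" by simp
    then show "t = t'" by (simp add: e)
  qed
  then have cD: "card D = n + 1" unfolding D_def by (simp add: card_image)
  have D_sub: "D \<subseteq> (+) y ` cube n"
    unfolding D_def by (auto simp: cube_def e_def s_def)
  have D_disj: "D \<inter> (+) x ` cube n = {}"
  proof (rule ccontr)
    assume "D \<inter> (+) x ` cube n \<noteq> {}"
    then obtain t c where tc: "c \<in> cube n" "y + e t = x + c" unfolding D_def by auto
    then have "(y + e t) $ i = (x + c) $ i" by simp
    then have "y $ i + s = x $ i + c $ i" by (simp add: e)
    moreover have "0 \<le> c $ i" "c $ i \<le> int n" using tc by (auto simp: cube_def)
    ultimately show False using i by (auto simp: s_def split: if_splits)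
  qed
  have "occurs n a y \<subseteq> agree D (\<lambda>u. a (u - y))"
    unfolding occurs_def vimage_shift_agree using D_sub by (auto simp: agree_def)
  then have "prob (occurs n a x \<inter> occurs n a y) \<le> prob (agree D (\<lambda>u. a (u - y)) \<inter> occurs n a x)"
    by (intro finite_measure_mono sets.Int agree_sets occurs_sets) (auto simp: D_def)
  also have "\<dots> \<le> (1 - \<delta>) ^ card D * prob (occurs n a x)"
    by (rule agree_bounds(2)[OF _ _ D_disj card]) (auto simp: D_def intro: occurs_local)
  finally show ?thesis by (simp only: cD measure_occurs)
qed

lemma delta_less_1:
  assumes "CARD('a) \<ge> 2" shows "\<delta> < 1"
proof -
  have "0 < (1 - \<delta>) ^ card {0 :: 'd site} * prob UNIV"
    using agree_bounds(2)[of "{0}" UNIV "{}" undefined] assms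
      measure_agree_pos[of "{0}" undefined] by simp
  then show ?thesis using prob_space by simp
qed

lemma delta_le_1: "CARD('a) \<ge> 2 \<Longrightarrow> \<delta> \<le> 1"
  using delta_less_1 by simp

text \<open>Far pairs decay at rate C2 / 2 in the distance. Half of that rate, over a distance of at
  least 2 d n, yields the factor exp(- C2 d n / 2); the other half, C2 / 4, remains for summing over
  positions.\<close>

definition exp_sum where
  "exp_sum = (SOME S. \<forall>F :: 'd site set. finite F \<longrightarrow> (\<Sum>z\<in>F. exp (- (C2 / 4) * real_of_int (l1_norm z))) \<le> S)"

lemma exp_sum: "finite (F :: 'd site set) \<Longrightarrow> (\<Sum>z\<in>F. exp (- (C2 / 4) * real_of_int (l1_norm z))) \<le> exp_sum"
  using someI_ex[OF exp_l1_sum_bounded[of "C2 / 4"]] C2 unfolding exp_sum_def by auto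

text \<open>Relative error against independence in the sum over pairs: at most (4 d n + 1)^d near
  translates at the price of \<open>near_pair\<close>, plus all mixing errors of far ones. It
  depends neither on the pattern nor on the box.\<close>

definition \<eta> :: "nat \<Rightarrow> real" where
  "\<eta> n = (4 * real CARD('d) * real n + 1) ^ CARD('d) * (1 - \<delta>) ^ (n + 1) +
    real (n + 1) ^ CARD('d) * (C1 * (exp (- (C2 * real CARD('d) * real n / 2)) * exp_sum))"

lemma \<eta>_tendsto:
  assumes "CARD('a) \<ge> 2" shows "\<eta> \<longlonglongrightarrow> 0"
proof -
  let ?d = "CARD('d)"
  have "summable (\<lambda>n. (4 * real ?d * real n + 1) ^ ?d * (1 - \<delta>) ^ n)"
    by (rule summable_poly_geometric) (use \<delta>_pos delta_less_1[OF assms] in auto)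
  from tendsto_mult_right[OF summable_LIMSEQ_zero[OF this], of "1 - \<delta>"]
  have 1: "(\<lambda>n. (4 * real ?d * real n + 1) ^ ?d * (1 - \<delta>) ^ (n + 1)) \<longlonglongrightarrow> 0"
    by (simp add: mult_ac)
  have "summable (\<lambda>n. (1 * real n + 1) ^ ?d * exp (- (C2 * real ?d / 2)) ^ n)"
    by (rule summable_poly_geometric) (use C2 in auto)
  from tendsto_mult_right[OF summable_LIMSEQ_zero[OF this], of "C1 * exp_sum"]
  have 2: "(\<lambda>n. real (n + 1) ^ ?d * (C1 * (exp (- (C2 * real ?d * real n / 2)) * exp_sum))) \<longlonglongrightarrow> 0"
    by (simp add: mult_ac add.commute flip: exp_of_nat_mult)
  show ?thesis unfolding \<eta>_def[abs_def] using tendsto_add[OF 1 2] by simp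
qed

text \<open>The diagonal gives 1, near pairs and mixing errors give \<open>\<eta> n\<close>, and the
  independent part of the far pairs gives at most the expected number of occurrences.\<close>

lemma pair_sum:
  assumes card: "CARD('a) \<ge> 2" and B: "finite B" "x \<in> B"
  shows "(\<Sum>y\<in>B. prob (occurs n a x \<inter> occurs n a y)) \<le>
    (1 + \<eta> n + real (card B) * prob (agree (cube n) a)) * prob (agree (cube n) a)"
proof -
  let ?d = "CARD('d)" and ?p = "prob (agree (cube n) a)"
  let ?q = "\<lambda>y. prob (occurs n a x \<inter> occurs n a y)"
  define near where "near = {y \<in> B. y \<noteq> x \<and> l1_norm (x - y) < 2 * int ?d * int n}"
  define far where "far = {y \<in> B. y \<noteq> x \<and> 2 * int ?d * int n \<le> l1_norm (x - y)}"
  have fin: "finite near" "finite far" using B by (auto simp: near_def far_def)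
  have B_eq: "B = insert x (near \<union> far)" using B by (auto simp: near_def far_def)
  have "sum ?q B = ?q x + (sum ?q near + sum ?q far)"
    unfolding B_eq using fin
    by (subst sum.insert) (auto simp: near_def far_def intro!: sum.union_disjoint)
  moreover have "?q x = ?p" by (simp add: measure_occurs)
  moreover have "sum ?q near \<le> (4 * real ?d * real n + 1) ^ ?d * (1 - \<delta>) ^ (n + 1) * ?p"
  proof -
    have nr: "\<bar>y $ i - x $ i\<bar> \<le> int (2 * ?d * n)" if "y \<in> near" for y i
    proof -
      have "\<bar>(x - y) $ i\<bar> \<le> l1_norm (x - y)" by (rule abs_le_l1_norm)
      then show ?thesis using that by (simp add: near_def abs_minus_commute)
    qed
    have "card near \<le> (2 * (2 * ?d * n) + 1) ^ ?d" by (rule card_box_le(2)[OF nr])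
    then have "real (card near) \<le> real ((2 * (2 * ?d * n) + 1) ^ ?d)" by (simp only: of_nat_le_iff)
    also have "\<dots> = (4 * real ?d * real n + 1) ^ ?d" by (simp add: add.commute mult.assoc)
    finally have cn: "real (card near) \<le> (4 * real ?d * real n + 1) ^ ?d" .
    have "sum ?q near \<le> real (card near) * ((1 - \<delta>) ^ (n + 1) * ?p)"
      by (rule sum_bounded_above) (rule near_pair[OF _ card], auto simp: near_def)
    also have "\<dots> \<le> (4 * real ?d * real n + 1) ^ ?d * ((1 - \<delta>) ^ (n + 1) * ?p)"
      by (rule mult_right_mono[OF cn]) (use delta_le_1[OF card] in simp)
    finally show ?thesis by (simp only: mult.assoc)
  qed
  moreover have "sum ?q far \<le> (real (card B) * ?p +
      real (n + 1) ^ ?d * (C1 * (exp (- (C2 * real ?d * real n / 2)) * exp_sum))) * ?p"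
  proof -
    let ?K = "real (n + 1) ^ ?d * C1" and ?E = "exp (- (C2 * real ?d * real n / 2))"
    let ?e = "\<lambda>y. exp (- (C2 / 4) * real_of_int (l1_norm (y - x)))"
    have "?q y \<le> (?p + ?K * (?E * ?e y)) * ?p" if y: "y \<in> far" for y
    proof -
      have "?q y \<le> (?p + real (n + 1) ^ ?d * (C1 * exp (- C2 * (real_of_int (l1_norm (x - y)) / 2)))) * ?p"
        by (rule far_pair) (use y in \<open>auto simp: far_def\<close>)
      also have "\<dots> \<le> (?p + real (n + 1) ^ ?d * (C1 * (?E * ?e y))) * ?p"
      proof (intro mult_right_mono add_left_mono mult_left_mono)
        let ?l = "real_of_int (l1_norm (x - y))"
        have "2 * int ?d * int n \<le> l1_norm (x - y)" using y by (simp add: far_def)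
        then have "real_of_int (2 * int ?d * int n) \<le> ?l" by (simp only: of_int_le_iff)
        then have "2 * real ?d * real n \<le> ?l" by simp
        then have "C2 * (2 * real ?d * real n) \<le> C2 * ?l" by (rule mult_left_mono) (use C2 in simp)
        then have "- C2 * (?l / 2) \<le> - (C2 * real ?d * real n / 2) + - (C2 / 4) * ?l" by simp
        then show "exp (- C2 * (?l / 2)) \<le> ?E * ?e y"
          unfolding l1_norm_minus_commute[of y x] exp_add[symmetric] by (simp only: exp_le_cancel_iff)
      qed (use C1 in auto)
      finally show ?thesis by (simp only: mult.assoc)
    qed
    then have "sum ?q far \<le> (\<Sum>y\<in>far. (?p + ?K * (?E * ?e y)) * ?p)" by (intro sum_mono)
    also have "\<dots> = (real (card far) * ?p + ?K * (?E * (\<Sum>y\<in>far. ?e y))) * ?p"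
      unfolding sum_distrib_right[symmetric] sum.distrib sum_distrib_left[symmetric] by simp
    also have "\<dots> \<le> (real (card B) * ?p + ?K * (?E * exp_sum)) * ?p"
    proof (intro mult_right_mono add_mono mult_left_mono)
      have "card far \<le> card B" by (rule card_mono) (use B in \<open>auto simp: far_def\<close>)
      then show "real (card far) \<le> real (card B)" by simp
      have "(\<Sum>y\<in>far. ?e y) = (\<Sum>z\<in>(\<lambda>y. y - x) ` far. exp (- (C2 / 4) * real_of_int (l1_norm z)))"
        by (subst sum.reindex) (auto simp: inj_on_def)
      also have "\<dots> \<le> exp_sum" by (rule exp_sum) (use fin in simp)
      finally show "(\<Sum>y\<in>far. ?e y) \<le> exp_sum" .
    qed (use C1 in auto)
    finally show ?thesis by (simp only: mult.assoc)
  qed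
  ultimately have "sum ?q B \<le> ?p + ((4 * real ?d * real n + 1) ^ ?d * (1 - \<delta>) ^ (n + 1) * ?p +
      (real (card B) * ?p + real (n + 1) ^ ?d * (C1 * (exp (- (C2 * real ?d * real n / 2)) * exp_sum))) * ?p)"
    by linarith
  also have "\<dots> = (1 + \<eta> n + real (card B) * ?p) * ?p"
  proof -
    have "p + (X * p + (b * p + Y) * p) = (1 + (X + Y) + b * p) * p" for p X b Y :: real
      by (simp add: algebra_simps)
    then show ?thesis unfolding \<eta>_def .
  qed
  finally show ?thesis .
qed

lemma hit_lower:
  assumes card: "CARD('a) \<ge> 2" and B: "finite B"
    and big: "real (card B) * prob (agree (cube n) a) \<ge> 1" and small: "\<bar>\<eta> n\<bar> \<le> 1"
  shows "prob (hit n a B) \<ge> 1 / 3"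
proof -
  let ?p = "prob (agree (cube n) a)"
  let ?b = "real (card B) * ?p"
  let ?c = "1 + \<eta> n + ?b"
  have c: "?c > 0" using big small by linarith
  \<comment> \<open>With mean b \<ge> 1 and error at most 1, the quotient is at least b / (b +
    2).\<close>
  have "1 / 3 \<le> ?b / ?c" using big small c by (simp add: field_simps)
  also have "\<dots> \<le> prob (hit n a B)"
    by (rule second_moment[OF B _ c]) (rule pair_sum[OF card B])
  finally show ?thesis .
qed

text \<open>Boxes are peeled off one at a time with the new box as the first set of the mixing
  bound, so the error involves its volume only, not that of the union of the others. Each box then
  contributes 2 / 3 + 1 / 12 = 3 / 4.\<close>

lemma separated_misses:
  fixes v :: "'d site \<Rightarrow> 'd site"
  assumes "finite J" and g: "g > 0"
    and one: "\<And>j. j \<in> J \<Longrightarrow> prob (hit n a ((+) (v j) ` cube s)) \<ge> 1 / 3"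
    and sep: "\<And>i j u w. i \<in> J \<Longrightarrow> j \<in> J \<Longrightarrow> i \<noteq> j \<Longrightarrow> u \<in> (+) (v i) ` cube (s + n) \<Longrightarrow>
      w \<in> (+) (v j) ` cube (s + n) \<Longrightarrow> g \<le> real_of_int (l1_norm (u - w))"
    and err: "real (s + n + 1) ^ CARD('d) * (C1 * exp (- C2 * g)) \<le> 1 / 12"
  shows "prob (\<Inter>j\<in>J. UNIV - hit n a ((+) (v j) ` cube s)) \<le> (3 / 4) ^ card J"
  using assms(1) one sep
proof (induction J rule: finite_induct)
  case empty
  then show ?case using prob_space by simp
next
  case (insert j J)
  let ?N = "\<lambda>j. UNIV - hit n a ((+) (v j) ` cube s)" and ?A = "\<lambda>j. (+) (v j) ` (cube (s + n) :: 'd site set)"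
  have loc: "?N j \<in> sets (local_sigma (?A j))" for j
  proof -
    have "hit n a ((+) (v j) ` cube s) \<in> sets (local_sigma (?A j))"
    proof (rule hit_local)
      fix x assume "x \<in> (+) (v j) ` cube s"
      then obtain c where c: "c \<in> cube s" "x = v j + c" by auto
      show "(+) x ` cube n \<subseteq> ?A j"
      proof clarify
        fix y :: "'d site" assume y: "y \<in> cube n"
        have "c + y \<in> cube (s + n)" using c(1) y by (auto simp: cube_def intro: add_mono)
        then show "x + y \<in> ?A j" using c(2) by (auto simp: add.assoc)
      qed
    qed simp
    then show ?thesis using sets.compl_sets[of _ "local_sigma (?A j)"] by auto
  qed
  have Nj: "prob (?N j) \<le> 2 / 3"
    using insert.prems(1)[of j] prob_compl[OF hit_sets[of "(+) (v j) ` cube s" n a]] by simp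
  have IH: "prob (\<Inter>i\<in>J. ?N i) \<le> (3 / 4) ^ card J"
  proof (rule insert.IH)
    show "1 / 3 \<le> prob (hit n a ((+) (v i) ` cube s))" if "i \<in> J" for i
      by (rule insert.prems(1)) (use that in simp)
    show "g \<le> real_of_int (l1_norm (u - w))"
      if "i \<in> J" "k \<in> J" "i \<noteq> k" "u \<in> ?A i" "w \<in> ?A k" for i k u w
      by (rule insert.prems(2)[OF _ _ that(3-5)]) (use that in auto)
  qed
  show ?case
  proof (cases "J = {}")
    case True
    then show ?thesis using Nj by simp
  next
    case False
    have "prob (?N j \<inter> (\<Inter>i\<in>J. ?N i)) \<le>
        (prob (?N j) + real (card (?A j)) * (C1 * exp (- C2 * g))) * prob (\<Inter>i\<in>J. ?N i)"
    proof (rule mixing[where ?A2.0 = "\<Union>i\<in>J. ?A i"])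
      show "?A j \<noteq> {}" using zero_in_cube by blast
      show "(\<Union>i\<in>J. ?A i) \<noteq> {}" using zero_in_cube False by blast
      show "(\<Inter>i\<in>J. ?N i) \<in> sets (local_sigma (\<Union>i\<in>J. ?A i))"
      proof (rule sets.finite_INT[OF insert.hyps(1) False])
        fix i assume "i \<in> J"
        then have "?A i \<subseteq> (\<Union>i\<in>J. ?A i)" by blast
        then show "?N i \<in> sets (local_sigma (\<Union>i\<in>J. ?A i))" using local_sigma_mono loc by blast
      qed
      fix u w assume "u \<in> ?A j" "w \<in> (\<Union>i\<in>J. ?A i)"
      then obtain i where "i \<in> J" "w \<in> ?A i" by blast
      then show "g \<le> real_of_int (l1_norm (u - w))"
        using insert.prems(2)[of j i u w] insert.hyps(2) \<open>u \<in> ?A j\<close> by blast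
    qed (use insert.hyps g loc in auto)
    also have "\<dots> \<le> (2 / 3 + 1 / 12) * (3 / 4) ^ card J"
      using err by (intro mult_mono add_mono Nj IH) (auto simp: card_cube)
    also have "\<dots> = (3 / 4) ^ card (insert j J)" using insert.hyps by simp
    also have "?N j \<inter> (\<Inter>i\<in>J. ?N i) = (\<Inter>i\<in>insert j J. ?N i)" by auto
    finally show ?thesis .
  qed
qed

lemma miss_large_cube:
  assumes card: "CARD('a) \<ge> 2" and s: "n \<le> s" "1 \<le> s" and M: "r \<ge> 1"
    and big: "1 \<le> real s ^ CARD('d) * prob (agree (cube n) a)" and small: "\<bar>\<eta> n\<bar> \<le> 1"
    and err: "(2 * real s + 1) ^ CARD('d) * (C1 * exp (- C2 * real s)) \<le> 1 / 12"
  shows "prob (UNIV - hit n a (cube (3 * s * r) - {0})) \<le> (3 / 4) ^ (r ^ CARD('d))"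
proof -
  \<comment> \<open>Spacing 3 s leaves a gap of s between enlarged boxes: windows starting in a box
    of side s reach over s + n \<le> 2 s. The offset 1 keeps the origin out, and since 1 + s \<le> 3
    s the r^d boxes still fit into \<open>cube (3 * s * r)\<close>.\<close>
  define v :: "'d site \<Rightarrow> 'd site" where "v j = (\<chi> i. 3 * int s * (j $ i) + 1)" for j
  have v: "v j $ i = 3 * int s * (j $ i) + 1" for i j by (simp add: v_def)
  let ?J = "cube (r - 1) :: 'd site set"
  have sub: "(+) (v j) ` cube s \<subseteq> cube (3 * s * r) - {0}" if j: "j \<in> ?J" for j
  proof
    fix y assume "y \<in> (+) (v j) ` cube s"
    then obtain c where c: "c \<in> cube s" "y = v j + c" by auto
    have "1 \<le> y $ i \<and> y $ i \<le> int (3 * s * r)" for i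
    proof -
      have j0: "0 \<le> j $ i" "j $ i \<le> int r - 1" and c0: "0 \<le> c $ i" "c $ i \<le> int s"
        using j c M by (auto simp: cube_def of_nat_diff)
      have "0 \<le> 3 * int s * (j $ i)" using j0 by simp
      moreover have "3 * int s * (j $ i) \<le> 3 * int s * (int r - 1)" by (rule mult_left_mono) (use j0 in auto)
      moreover have "3 * int s * (int r - 1) = int (3 * s * r) - 3 * int s" by (simp add: algebra_simps)
      moreover have "int s \<ge> 1" using s by simp
      ultimately show ?thesis unfolding c(2) vector_add_component v using c0 by linarith
    qed
    note * = this
    then have "y \<in> cube (3 * s * r)" by (auto simp: cube_def) (smt (verit))
    moreover have "y \<noteq> 0" using *[of undefined] by auto
    ultimately show "y \<in> cube (3 * s * r) - {0}" by blast
  qed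
  have "UNIV - hit n a (cube (3 * s * r) - {0}) \<subseteq> (\<Inter>j\<in>?J. UNIV - hit n a ((+) (v j) ` cube s))"
    using hit_mono[OF sub, of _ n a] by blast
  then have "prob (UNIV - hit n a (cube (3 * s * r) - {0})) \<le>
      prob (\<Inter>j\<in>?J. UNIV - hit n a ((+) (v j) ` cube s))"
  proof (rule finite_measure_mono)
    show "(\<Inter>j\<in>?J. UNIV - hit n a ((+) (v j) ` cube s)) \<in> sets M"
    proof (rule sets.finite_INT)
      show "?J \<noteq> {}" using zero_in_cube by blast
      show "UNIV - hit n a ((+) (v j) ` cube s) \<in> sets M" for j
        using sets.compl_sets[OF hit_sets[of "(+) (v j) ` cube s" n a]] by simp
    qed simp
  qed
  also have "\<dots> \<le> (3 / 4) ^ card ?J"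
  proof (rule separated_misses[where g = "real s"])
    show "real s > 0" using s by simp
    show "1 / 3 \<le> prob (hit n a ((+) (v j) ` cube s))" for j
    proof (rule hit_lower[OF card _ _ small])
      have "1 \<le> real s ^ CARD('d) * prob (agree (cube n) a)" by (rule big)
      also have "\<dots> \<le> real (card ((+) (v j) ` cube s)) * prob (agree (cube n) a)"
        by (rule mult_right_mono) (auto simp: card_cube intro: power_mono)
      finally show "1 \<le> real (card ((+) (v j) ` cube s)) * prob (agree (cube n) a)" .
    qed simp
    show "real (s + n + 1) ^ CARD('d) * (C1 * exp (- C2 * real s)) \<le> 1 / 12"
    proof (rule order_trans[OF _ err])
      show "real (s + n + 1) ^ CARD('d) * (C1 * exp (- C2 * real s)) \<le>
          (2 * real s + 1) ^ CARD('d) * (C1 * exp (- C2 * real s))"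
        by (intro mult_right_mono power_mono) (use s C1 in auto)
    qed
    fix i j u w :: "'d site"
    assume ij: "i \<noteq> j" and u: "u \<in> (+) (v i) ` cube (s + n)" and w: "w \<in> (+) (v j) ` cube (s + n)"
    from u obtain b where b: "b \<in> cube (s + n)" "u = v i + b" by (rule imageE) simp
    from w obtain c where c: "c \<in> cube (s + n)" "w = v j + c" by (rule imageE) simp
    obtain k where k: "i $ k \<noteq> j $ k" using ij by (auto simp: vec_eq_iff)
    have "0 \<le> b $ k" "b $ k \<le> int (s + n)" "0 \<le> c $ k" "c $ k \<le> int (s + n)"
      using b c by (auto simp: cube_def)
    then have bc: "\<bar>b $ k - c $ k\<bar> \<le> 2 * int s" using s by (simp add: abs_le_iff)
    have "1 \<le> \<bar>i $ k - j $ k\<bar>" using k by linarith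
    then have "3 * int s * 1 \<le> 3 * int s * \<bar>i $ k - j $ k\<bar>" by (rule mult_left_mono) simp
    also have "\<dots> = \<bar>3 * int s * (i $ k) - 3 * int s * (j $ k)\<bar>"
      by (simp add: abs_mult flip: right_diff_distrib)
    finally have "int s \<le> \<bar>(u - w) $ k\<bar>"
      unfolding b(2) c(2) vector_minus_component vector_add_component v using bc by linarith
    also have "\<dots> \<le> l1_norm (u - w)" by (rule abs_le_l1_norm)
    finally show "real s \<le> real_of_int (l1_norm (u - w))" by linarith
  qed simp
  also have "card ?J = r ^ CARD('d)" using M by (simp add: card_cube)
  finally show ?thesis .
qed

text \<open>All thresholds on n come from \<eta>, \<delta>, C1 and C2, so one n0 serves every
  pattern. The number r of boxes per direction stays free, to be matched to log n later.\<close>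

lemma late_hit_large:
  assumes card: "CARD('a) \<ge> 2"
  shows "\<exists>n0. \<forall>n\<ge>n0. \<forall>a. \<forall>r\<ge>1. \<exists>k. real k ^ CARD('d) * prob (agree (cube n) a) \<le> 6 ^ CARD('d) * real r ^ CARD('d)
    \<and> prob (UNIV - hit n a (cube k - {0})) \<le> (3 / 4) ^ (r ^ CARD('d))"
proof -
  let ?d = "CARD('d)"
  have "\<forall>\<^sub>F n in sequentially. \<bar>\<eta> n\<bar> < 1"
    using \<eta>_tendsto[OF card] by (auto simp: tendsto_iff dist_real_def)
  moreover have "\<forall>\<^sub>F n in sequentially. real n ^ ?d * (1 - \<delta>) ^ (n + 1) < 1"
  proof -
    have "summable (\<lambda>n. (1 * real n + 1) ^ ?d * (1 - \<delta>) ^ n)"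
      by (rule summable_poly_geometric) (use \<delta>_pos delta_less_1[OF card] in auto)
    then have "\<forall>\<^sub>F n in sequentially. (1 * real n + 1) ^ ?d * (1 - \<delta>) ^ n < 1"
      by (intro order_tendstoD(2)[OF summable_LIMSEQ_zero]) auto
    then show ?thesis
    proof eventually_elim
      case (elim n)
      have "real n ^ ?d * (1 - \<delta>) ^ (n + 1) \<le> (1 * real n + 1) ^ ?d * (1 - \<delta>) ^ n"
        by (intro mult_mono power_mono power_decreasing) (use \<delta>_pos delta_le_1[OF card] in auto)
      then show ?case using elim by linarith
    qed
  qed
  \<comment> \<open>The estimate will be used at a side s that depends on the pattern but exceeds n,
    hence the uniformity over s \<ge> n.\<close>
  moreover have "\<forall>\<^sub>F n in sequentially. \<forall>s\<ge>n. (2 * real s + 1) ^ ?d * (C1 * exp (- C2 * real s)) \<le> 1 / 12"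
  proof -
    have "summable (\<lambda>s. (2 * real s + 1) ^ ?d * exp (- C2) ^ s)"
      by (rule summable_poly_geometric) (use C2 in auto)
    from tendsto_mult_left[OF summable_LIMSEQ_zero[OF this], of C1]
    have "(\<lambda>s. (2 * real s + 1) ^ ?d * (C1 * exp (- C2 * real s))) \<longlonglongrightarrow> 0"
      by (simp add: mult_ac flip: exp_of_nat_mult)
    then have "\<forall>\<^sub>F s in sequentially. (2 * real s + 1) ^ ?d * (C1 * exp (- C2 * real s)) < 1 / 12"
      by (rule order_tendstoD) simp
    then obtain N where "\<And>s. s \<ge> N \<Longrightarrow> (2 * real s + 1) ^ ?d * (C1 * exp (- C2 * real s)) < 1 / 12"
      by (auto simp: eventually_sequentially)
    then show ?thesis unfolding eventually_sequentially by (meson less_imp_le order_trans)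
  qed
  moreover have "\<forall>\<^sub>F n in sequentially. n \<ge> (1 :: nat)" by (rule eventually_ge_at_top)
  ultimately have "\<forall>\<^sub>F n in sequentially. \<forall>a. \<forall>r\<ge>1. \<exists>k. real k ^ ?d * prob (agree (cube n) a) \<le> 6 ^ ?d * real r ^ ?d
    \<and> prob (UNIV - hit n a (cube k - {0})) \<le> (3 / 4) ^ (r ^ ?d)"
  proof eventually_elim
    case (elim n)
    show ?case
    proof (intro allI impI)
      fix a :: "('d, 'a) config" and r :: nat assume r: "1 \<le> r"
      let ?p = "prob (agree (cube n) a)"
      have p: "?p > 0" by (rule measure_agree_pos) simp
      have p_le: "?p \<le> (1 - \<delta>) ^ (n + 1)"
      proof -
        have "?p \<le> (1 - \<delta>) ^ card (cube n :: 'd site set)"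
          using agree_bounds(2)[of "cube n" UNIV "{}" a] card
            prob_space by simp
        also have "\<dots> \<le> (1 - \<delta>) ^ (n + 1)"
        proof (rule power_decreasing)
          show "n + 1 \<le> card (cube n :: 'd site set)" unfolding card_cube by (rule self_le_power) auto
        qed (use \<delta>_pos delta_le_1[OF card] in auto)
        finally show ?thesis .
      qed
      define P where "P s \<longleftrightarrow> 1 \<le> real s ^ ?d * ?p" for s :: nat
      have "P (nat \<lceil>1 / ?p\<rceil>)"
      proof -
        let ?s = "nat \<lceil>1 / ?p\<rceil>"
        have s1: "1 / ?p \<le> real ?s" by (rule real_nat_ceiling_ge)
        moreover have "1 / ?p > 0" using p by simp
        ultimately have "?s \<ge> 1" by linarith
        then have "1 \<le> real ?s" by linarith
        then have "real ?s \<le> real ?s ^ ?d" by (rule self_le_power) simp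
        then have "1 / ?p \<le> real ?s ^ ?d" using s1 by linarith
        then show ?thesis using p by (simp add: P_def field_simps)
      qed
      \<comment> \<open>Least side with s^d p \<ge> 1. As p decays exponentially, s exceeds n;
        minimality and s \<le> 2 (s - 1) give s^d p \<le> 2^d, and with the spacing factor 3 this is
        the origin of 6^d.\<close>
      define s where "s = (LEAST s. P s)"
      have Ps: "P s" unfolding s_def by (rule LeastI) fact
      have n_s: "n < s"
      proof (rule ccontr)
        assume "\<not> n < s"
        then have "real s ^ ?d * ?p \<le> real n ^ ?d * (1 - \<delta>) ^ (n + 1)"
          by (intro mult_mono power_mono p_le) auto
        then show False using Ps elim(2) by (simp add: P_def)
      qed
      have "s - 1 < s" using n_s by simp
      then have "\<not> P (s - 1)" unfolding s_def by (rule not_less_Least)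
      then have s1: "real (s - 1) ^ ?d * ?p < 1" by (simp add: P_def)
      have "real s \<le> 2 * real (s - 1)" using n_s elim(4) by linarith
      then have "real s ^ ?d \<le> (2 * real (s - 1)) ^ ?d" by (rule power_mono) simp
      then have "real s ^ ?d * ?p \<le> (2 * real (s - 1)) ^ ?d * ?p" by (rule mult_right_mono) simp
      also have "\<dots> = 2 ^ ?d * (real (s - 1) ^ ?d * ?p)" by (simp only: power_mult_distrib mult.assoc)
      also have "\<dots> \<le> 2 ^ ?d * 1" by (rule mult_left_mono) (use s1 in auto)
      finally have sp: "real s ^ ?d * ?p \<le> 2 ^ ?d" by simp
      have "real (3 * s * r) ^ ?d * ?p = (3 * real r) ^ ?d * (real s ^ ?d * ?p)"
        by (simp add: power_mult_distrib)
      also have "\<dots> \<le> (3 * real r) ^ ?d * 2 ^ ?d" by (rule mult_left_mono[OF sp]) simp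
      also have "\<dots> = 6 ^ ?d * real r ^ ?d"
      proof -
        have "3 * real r * 2 = 6 * real r" by simp
        then show ?thesis by (simp only: power_mult_distrib[symmetric])
      qed
      finally have "real (3 * s * r) ^ ?d * ?p \<le> 6 ^ ?d * real r ^ ?d" .
      moreover have "prob (UNIV - hit n a (cube (3 * s * r) - {0})) \<le> (3 / 4) ^ (r ^ ?d)"
      proof (rule miss_large_cube[OF card _ _ r])
        show "n \<le> s" "1 \<le> s" using n_s by auto
        show "1 \<le> real s ^ ?d * ?p" using Ps by (simp add: P_def)
        show "\<bar>\<eta> n\<bar> \<le> 1" using elim(1) by simp
        show "(2 * real s + 1) ^ ?d * (C1 * exp (- C2 * real s)) \<le> 1 / 12" using elim(3) n_s by simp
      qed
      ultimately show "\<exists>k. real k ^ ?d * ?p \<le> 6 ^ ?d * real r ^ ?d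
        \<and> prob (UNIV - hit n a (cube k - {0})) \<le> (3 / 4) ^ (r ^ ?d)" by blast
    qed
  qed
  then show ?thesis by (simp add: eventually_sequentially)
qed

lemma late_hit:
  "\<exists>n0. \<forall>n\<ge>n0. \<forall>a. \<forall>r\<ge>1. \<exists>k. real k ^ CARD('d) * prob (agree (cube n) a) \<le> 6 ^ CARD('d) * real r ^ CARD('d)
    \<and> prob (UNIV - hit n a (cube k - {0})) \<le> (3 / 4) ^ (r ^ CARD('d))"
proof (cases "CARD('a) \<ge> 2")
  case True
  then show ?thesis by (rule late_hit_large)
next
  case False
  then have "CARD('a) = 1" using zero_less_card_finite[where 'a = 'a] by linarith
  then obtain s :: 'a where "(UNIV :: 'a set) = {s}" by (rule card_1_singletonE)
  then have single: "x = y" for x y :: 'a by (metis UNIV_I singletonD)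
  have all: "agree V b = (UNIV :: ('d, 'a) config set)" for V b by (auto simp: agree_def intro: single)
  have "prob (agree (cube n) a) = 1" for n and a :: "('d, 'a) config" using prob_space by (simp add: all)
  moreover have "hit n a (cube 1 - {0}) = UNIV" for n and a :: "('d, 'a) config"
  proof -
    have "(1 :: 'd site) \<in> cube 1 - {0}" by (auto simp: cube_def vec_eq_iff)
    then show ?thesis unfolding hit_def occurs_def all by auto
  qed
  moreover have "1 \<le> 6 ^ CARD('d) * real r ^ CARD('d)" if "r \<ge> 1" for r
    using mult_mono[of 1 "6 ^ CARD('d)" 1 "real r ^ CARD('d)"] that by simp
  ultimately show ?thesis by (intro exI[of _ 0] allI impI exI[of _ 1]) simp
qed

end

section \<open>Waiting times\<close>

text \<open>The information is that of the Gibbs field while the averaging is under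
  \<open>Q\<close>. Almost additivity makes the information of a large cube a box average of the
  bounded local function \<open>f L\<close> up to an error density b L, so the ergodic theorem for
  each fixed L suffices.\<close>

lemma (in gibbs) info_density_converges:
  fixes Q :: "('d, 'a) config measure"
  assumes "ergodic_field Q"
  shows "\<exists>l. (\<lambda>n. (\<integral>\<xi>. info \<xi> (cube n) \<partial>Q) / real n ^ CARD('d)) \<longlonglongrightarrow> l \<and>
    (AE \<xi> in Q. (\<lambda>n. info \<xi> (cube n) / real n ^ CARD('d)) \<longlonglongrightarrow> l)"
proof -
  interpret Q: ergodic_field_locale Q by unfold_locales (rule assms)
  let ?d = "CARD('d)"
  define f where "f L \<xi> = info \<xi> (cube L)" for L \<xi>
  define c where "c L = (\<integral>\<xi>. f L \<xi> \<partial>Q) / real (Suc L) ^ ?d" for L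
  define b where "b L = 8 * boundary (cube L) / real (Suc L) ^ ?d" for L
  let ?K = "\<bar>ln \<delta>\<bar>"
  have f_cong: "f L \<xi> = f L \<eta>" if "\<And>y. y \<in> cube L \<Longrightarrow> \<xi> y = \<eta> y" for L \<xi> \<eta>
    using measure_agree_cong[OF that] by (simp add: f_def info_def)
  have f_meas: "f L \<in> borel_measurable Q" for L
    by (rule Q.pattern_measurable(2)[OF finite_cube]) (rule f_cong)
  have f_bd: "\<bar>f L \<xi>\<bar> \<le> ?K * real (card (cube L :: 'd site set))" for L \<xi>
    using info_nonneg[of \<xi> "cube L"] info_le[OF finite_cube, of \<xi> L] by (simp add: f_def)
  have b_lim: "b \<longlonglongrightarrow> 0"
    using tendsto_mult_left[OF LIMSEQ_Suc[OF boundary_cube_tendsto], of 8] by (simp add: b_def[abs_def])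
  have info_transl: "info \<xi> ((+) x ` cube L) = f L (shift x \<xi>)" for \<xi> x L
    by (simp add: info_def f_def measure_agree_translate)
  have "AE \<xi> in Q. \<forall>L. (\<lambda>n. box_average n (f L) \<xi>) \<longlonglongrightarrow> (\<integral>\<xi>. f L \<xi> \<partial>Q)"
    unfolding AE_all_countable using Q.pointwise_ergodic[OF f_meas f_bd] by simp
  then have ae: "AE \<xi> in Q. \<exists>l. c \<longlonglongrightarrow> l \<and> (\<lambda>n. info \<xi> (cube n) / real n ^ ?d) \<longlonglongrightarrow> l"
  proof eventually_elim
    case (elim \<xi>)
    show ?case
    proof (rule tendsto_from_approximations[OF _ b_lim])
      fix L :: nat and \<eta> :: real assume \<eta>: "\<eta> > 0"
      let ?L = "Suc L" and ?e = "8 * boundary (cube L)"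
      let ?r = "vol_ratio TYPE('d) ?L" and ?s = "\<lambda>n. vol_ratio TYPE('d) 1 n - vol_ratio TYPE('d) (Suc L) n"
      \<comment> \<open>The main term of the tiling estimate, rewritten as a box average so that its
        limit is c L.\<close>
      define A where "A n = box_average (n + 1 - ?L) (f L) \<xi> * ?r n / real ?L ^ ?d" for n
      have bound: "\<bar>info \<xi> (cube n) / real n ^ ?d - A n\<bar> \<le> b L * ?r n + ?K * ?s n" if n: "n \<ge> ?L" for n
      proof -
        have "n + 1 - ?L + 1 = n + 2 - ?L" using n by simp
        then have sum_eq: "(\<Sum>x\<in>cube (n + 1 - ?L). f L (shift x \<xi>)) / (real ?L ^ ?d * real n ^ ?d) = A n"
          using n unfolding A_def box_average_def vol_ratio_def by (simp add: field_simps)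
        have add: "\<bar>info \<xi> ((+) x ` cube (?L - 1) \<union> D) - info \<xi> ((+) x ` cube (?L - 1)) - info \<xi> D\<bar> \<le> ?e"
          if "finite D" "D \<inter> (+) x ` cube (?L - 1) = {}" for x D
        proof -
          have "(+) x ` (cube L :: 'd site set) \<noteq> {}" using zero_in_cube by blast
          then show ?thesis
            using info_almost_additive[of "(+) x ` cube L" D \<xi>] that by (simp add: boundary_translate)
        qed
        have "info \<xi> (cube n) / real n ^ ?d \<le>
            (\<Sum>x\<in>cube (n + 1 - ?L). info \<xi> ((+) x ` cube (?L - 1))) / (real ?L ^ ?d * real n ^ ?d) +
            ?e / real ?L ^ ?d * ?r n + ?K * ?s n"
        proof (rule cube_tiling_density)
          show "info \<xi> ((+) x ` cube (?L - 1) \<union> D) \<le> info \<xi> ((+) x ` cube (?L - 1)) + info \<xi> D + ?e"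
            if "finite D" "D \<inter> (+) x ` cube (?L - 1) = {}" for x D
            using add[OF that] by linarith
        qed (use n info_le in auto)
        \<comment> \<open>The lower bound is the same tiling estimate for the negated information,
          which is also subadditive up to ?e.\<close>
        moreover have "- info \<xi> (cube n) / real n ^ ?d \<le>
            (\<Sum>x\<in>cube (n + 1 - ?L). - info \<xi> ((+) x ` cube (?L - 1))) / (real ?L ^ ?d * real n ^ ?d) +
            ?e / real ?L ^ ?d * ?r n + ?K * ?s n"
        proof (rule cube_tiling_density[where F = "\<lambda>V. - info \<xi> V"])
          show "- info \<xi> ((+) x ` cube (?L - 1) \<union> D) \<le> - info \<xi> ((+) x ` cube (?L - 1)) + - info \<xi> D + ?e"
            if "finite D" "D \<inter> (+) x ` cube (?L - 1) = {}" for x D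
            using add[OF that] by linarith
          show "- info \<xi> D \<le> ?K * real (card D)" for D
          proof -
            have "0 \<le> ?K * real (card D)" by simp
            then show ?thesis using info_nonneg[of \<xi> D] by linarith
          qed
        qed (use n in auto)
        ultimately show ?thesis
          unfolding sum_negf diff_Suc_1 info_transl minus_divide_left[symmetric] sum_eq b_def
          by (intro abs_leI) linarith+
      qed
      have "filterlim (\<lambda>n. n + 1 - ?L) sequentially sequentially"
        unfolding filterlim_at_top
      proof
        fix Z show "\<forall>\<^sub>F n in sequentially. Z \<le> n + 1 - ?L"
          using eventually_ge_at_top[of "Z + ?L"] by eventually_elim simp
      qed
      from filterlim_compose[OF elim[rule_format, of L] this]
      have "A \<longlonglongrightarrow> (\<integral>\<xi>. f L \<xi> \<partial>Q) * 1 / real ?L ^ ?d"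
        unfolding A_def[abs_def] by (intro tendsto_intros vol_ratio_tendsto) auto
      then have "A \<longlonglongrightarrow> c L" by (simp add: c_def)
      then have "(\<lambda>n. \<bar>A n - c L\<bar> + (b L * ?r n + ?K * ?s n)) \<longlonglongrightarrow> \<bar>c L - c L\<bar> + (b L * 1 + ?K * (1 - 1))"
        by (intro tendsto_intros vol_ratio_tendsto)
      then have "\<forall>\<^sub>F n in sequentially. \<bar>A n - c L\<bar> + (b L * ?r n + ?K * ?s n) < b L + \<eta>"
        by (rule order_tendstoD) (use \<eta> in simp)
      with eventually_ge_at_top[of ?L]
      show "\<forall>\<^sub>F n in sequentially. \<bar>info \<xi> (cube n) / real n ^ ?d - c L\<bar> \<le> b L + \<eta>"
      proof eventually_elim
        case (elim n)
        then show ?case using bound[of n] by linarith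
      qed
    qed
  qed
  \<comment> \<open>The sequence c does not involve \<xi>, so one good configuration settles its
    convergence, and almost every configuration is good.\<close>
  have "\<exists>l. c \<longlonglongrightarrow> l"
  proof (rule ccontr)
    assume "\<nexists>l. c \<longlonglongrightarrow> l"
    with ae have "AE \<xi> in Q. False" by simp
    then show False by simp
  qed
  then obtain l where l: "c \<longlonglongrightarrow> l" by blast
  have "AE \<xi> in Q. (\<lambda>n. info \<xi> (cube n) / real n ^ ?d) \<longlonglongrightarrow> l"
    using ae by eventually_elim (use l LIMSEQ_unique in blast)
  moreover have "(\<lambda>n. (\<integral>\<xi>. info \<xi> (cube n) \<partial>Q) / real n ^ ?d) \<longlonglongrightarrow> l"
  proof -
    \<comment> \<open>Changes the normalisation of c from (n + 1)^d to n^d.\<close>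
    have "(\<lambda>n. c n * vol_ratio TYPE('d) 1 n) \<longlonglongrightarrow> l * 1" by (intro tendsto_intros l vol_ratio_tendsto)
    moreover have "c n * vol_ratio TYPE('d) 1 n = (\<integral>\<xi>. info \<xi> (cube n) \<partial>Q) / real n ^ ?d" for n
      by (simp add: c_def vol_ratio_def f_def del: of_nat_Suc)
    ultimately show ?thesis by simp
  qed
  ultimately show ?thesis by blast
qed

text \<open>All terms are finite because a Gibbs field charges every pattern, and terms of
  \<open>Q\<close>-weight 0 vanish since 0 times minus infinity is 0 in the extended reals.\<close>

lemma (in gibbs) block_rel_entropy_eq:
  fixes Q :: "('d, 'a) config measure"
  assumes "random_field Q" "translation_invariant Q"
  shows "block_rel_entropy Q M n =
    ereal ((\<integral>\<xi>. info \<xi> (cube n) \<partial>Q) / real n ^ CARD('d) - block_entropy Q n)"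
proof -
  interpret Q: shift_field Q by unfold_locales (rule assms)+
  let ?q = "\<lambda>a. measure Q (agree (cube n) a)" and ?p = "\<lambda>a. prob (agree (cube n) a)"
  let ?A = "patterns (cube n) :: ('d, 'a) config set"
  have cross: "(\<integral>\<xi>. info \<xi> (cube n) \<partial>Q) = (\<Sum>a\<in>?A. - ln (?p a) * ?q a)"
    unfolding info_def
  proof (rule Q.pattern_integral(2)[OF finite_cube])
    fix \<xi> \<eta> :: "('d, 'a) config" assume "\<And>y. y \<in> cube n \<Longrightarrow> \<xi> y = \<eta> y"
    then have "?p \<xi> = ?p \<eta>" by (rule measure_agree_cong)
    then show "- ln (?p \<xi>) = - ln (?p \<eta>)" by simp
  qed
  have "ereal (measure Q (cylinder (cube n) a)) *
      ext_ln (ereal (measure Q (cylinder (cube n) a)) / ereal (prob (cylinder (cube n) a))) =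
      ereal (?q a * ln (?q a) + - ln (?p a) * ?q a)" if a: "a \<in> ?A" for a
  proof (cases "?q a = 0")
    case True
    then show ?thesis by (simp add: cylinder_pattern[OF a] ext_ln_def)
  next
    case False
    then have q: "?q a > 0" by (simp add: zero_less_measure_iff)
    have p: "?p a > 0" by (rule measure_agree_pos) simp
    have "ext_ln (ereal (?q a) / ereal (?p a)) = ereal (ln (?q a) - ln (?p a))"
      using p q by (simp add: ext_ln_def ln_div divide_le_0_iff not_le)
    then show ?thesis unfolding cylinder_pattern[OF a] by (simp add: algebra_simps)
  qed
  then have "block_rel_entropy Q M n =
      ereal (1 / real n ^ CARD('d)) * (\<Sum>a\<in>?A. ereal (?q a * ln (?q a) + - ln (?p a) * ?q a))"
    unfolding block_rel_entropy_def by (simp only: cong: sum.cong)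
  also have "\<dots> = ereal (1 / real n ^ CARD('d) * ((\<Sum>a\<in>?A. ?q a * ln (?q a)) + (\<Sum>a\<in>?A. - ln (?p a) * ?q a)))"
    by (simp only: sum_ereal times_ereal.simps sum.distrib)
  also have "(\<Sum>a\<in>?A. ?q a * ln (?q a)) = - Q.shannon (cube n)"
    unfolding Q.shannon_eq[OF finite_cube] sum_negf[symmetric] by (rule sum.cong) auto
  finally show ?thesis
    unfolding cross[symmetric] Q.block_entropy_eq by (simp add: diff_divide_distrib add_divide_distrib)
qed

text \<open>The bound 6^d m^d of \<open>late_hit\<close> must stay below \<epsilon> log n while m^d
  remains of that order. Rounding to an integer costs at most a factor 2 in m once m \<ge> 2, which
  turns 6 into 12.\<close>

lemma log_scale:
  assumes d: "d > (0 :: nat)" and "\<epsilon> > (0 :: real)"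
  shows "\<exists>m :: nat \<Rightarrow> nat. \<forall>\<^sub>F n in sequentially. m n \<ge> 1 \<and> 6 ^ d * real (m n) ^ d \<le> \<epsilon> * ln (real n) \<and>
    \<epsilon> * ln (real n) / 12 ^ d \<le> real (m n ^ d)"
proof -
  define P where "P n k \<longleftrightarrow> \<epsilon> * ln (real n) \<le> 12 ^ d * real k ^ d" for n k :: nat
  define m where "m n = (LEAST k. P n k)" for n
  have "filterlim (\<lambda>n. \<epsilon> * ln (real n)) at_top sequentially"
    using \<open>\<epsilon> > 0\<close> by real_asymp
  then have "\<forall>\<^sub>F n in sequentially. \<epsilon> * ln (real n) > 12 ^ d"
    unfolding filterlim_at_top_dense by blast
  then have "\<forall>\<^sub>F n in sequentially. m n \<ge> 1 \<and> 6 ^ d * real (m n) ^ d \<le> \<epsilon> * ln (real n) \<and>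
    \<epsilon> * ln (real n) / 12 ^ d \<le> real (m n ^ d)"
  proof eventually_elim
    case (elim n)
    let ?e = "\<epsilon> * ln (real n)"
    have "P n (nat \<lceil>?e\<rceil>)"
    proof -
      have e1: "?e \<ge> 1" using elim by (smt (verit) one_le_power)
      let ?k = "real (nat \<lceil>?e\<rceil>)"
      have "?e \<le> ?k" by (rule real_nat_ceiling_ge)
      also have "?k \<le> ?k ^ d" by (rule self_le_power) (use e1 \<open>?e \<le> ?k\<close> d in auto)
      also have "\<dots> \<le> 12 ^ d * ?k ^ d" using mult_right_mono[of 1 "12 ^ d" "?k ^ d"] by simp
      finally show ?thesis by (simp add: P_def)
    qed
    then have Pm: "P n (m n)" unfolding m_def by (rule LeastI)
    have "m n \<ge> 2"
    proof (rule ccontr)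
      assume "\<not> m n \<ge> 2"
      then have "real (m n) ^ d \<le> 1" by (intro power_le_one) auto
      then have "12 ^ d * real (m n) ^ d \<le> 12 ^ d * 1" by (rule mult_left_mono) simp
      then show False using Pm elim unfolding P_def by linarith
    qed
    then have "\<not> P n (m n - 1)" unfolding m_def by (intro not_less_Least) simp
    then have "12 ^ d * real (m n - 1) ^ d < ?e" by (simp add: P_def)
    moreover have "6 ^ d * real (m n) ^ d \<le> 12 ^ d * real (m n - 1) ^ d"
    proof -
      have "6 * real (m n) \<le> 12 * real (m n - 1)" using \<open>m n \<ge> 2\<close> by linarith
      then have "(6 * real (m n)) ^ d \<le> (12 * real (m n - 1)) ^ d" by (rule power_mono) simp
      then show ?thesis by (simp only: power_mult_distrib)
    qed
    ultimately show ?case using Pm \<open>m n \<ge> 2\<close> by (simp add: P_def field_simps)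
  qed
  then show ?thesis by blast
qed

context gibbs_mixing
begin

text \<open>Chosen so that (3 / 4)^(m^d) is at most n^(-2) when m^d \<ge> \<epsilon> ln n / 12^d and
  \<epsilon> exceeds this value. Being at least 2, it also makes n^(-\<epsilon>) summable for the
  lower bound.\<close>

definition eps0 :: real where "eps0 = 2 * 12 ^ CARD('d) / ln (4 / 3)"

lemma eps0: "eps0 \<ge> 2"
proof -
  have "ln (4 / 3 :: real) \<le> 4 / 3 - 1" by (rule ln_le_minus_one) simp
  then have "ln (4 / 3 :: real) \<le> 1" by simp
  also have "1 \<le> (12 :: real) ^ CARD('d)" by simp
  finally have "ln (4 / 3 :: real) \<le> 12 ^ CARD('d)" .
  moreover have "ln (4 / 3 :: real) > 0" by simp
  ultimately show ?thesis unfolding eps0_def by (simp add: field_simps)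
qed

text \<open>Both exceptional sets are finite unions of rectangles over the patterns of \<open>\<xi>\<close>, so their
  \<open>Q \<times> P\<close> measure is bounded by the worst pattern and Borel-Cantelli applies.\<close>

lemma waiting_time_bounds:
  fixes Q :: "('d, 'a) config measure"
  assumes "random_field Q" "translation_invariant Q" and \<epsilon>: "\<epsilon> > eps0"
  shows "AE (\<xi>, \<sigma>) in Q \<Otimes>\<^sub>M M. \<forall>\<^sub>F n in sequentially. \<exists>w. w \<ge> 1 \<and> waiting_time n \<xi> \<sigma> = enat w \<and>
    exp (- \<epsilon> * ln (real n)) \<le> real w ^ CARD('d) * prob (agree (cube n) \<xi>) \<and>
    real w ^ CARD('d) * prob (agree (cube n) \<xi>) \<le> \<epsilon> * ln (real n)"
proof -
  interpret Q: shift_field Q by unfold_locales (rule assms)+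
  interpret QM: pair_prob_space Q M ..
  let ?d = "CARD('d)" and ?p = "\<lambda>n a. prob (agree (cube n) a)"
  have \<epsilon>2: "\<epsilon> > 2" using eps0 \<epsilon> by linarith
  define \<theta> where "\<theta> n = exp (- \<epsilon> * ln (real n))" for n
  have "\<exists>k. (\<forall>\<sigma> w. waiting_time n a \<sigma> = enat w \<longrightarrow> real w ^ ?d * ?p n a < \<theta> n \<longrightarrow> \<sigma> \<in> hit n a (cube k - {0})) \<and>
    prob (hit n a (cube k - {0})) \<le> 2 ^ ?d * \<theta> n" for n a
    by (rule early_hit) (auto simp: \<theta>_def intro: measure_agree_pos)
  then obtain k1 where k1: "\<And>n a \<sigma> w. waiting_time n a \<sigma> = enat w \<Longrightarrow> real w ^ ?d * ?p n a < \<theta> n \<Longrightarrow>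
      \<sigma> \<in> hit n a (cube (k1 n a) - {0})"
    "\<And>n a. prob (hit n a (cube (k1 n a) - {0})) \<le> 2 ^ ?d * \<theta> n" by metis
  obtain m where m: "\<forall>\<^sub>F n in sequentially. m n \<ge> 1 \<and> 6 ^ ?d * real (m n) ^ ?d \<le> \<epsilon> * ln (real n) \<and>
    \<epsilon> * ln (real n) / 12 ^ ?d \<le> real (m n ^ ?d)"
    using log_scale[of ?d \<epsilon>] \<epsilon>2 by auto
  obtain n0 where "\<forall>n\<ge>n0. \<forall>a. \<forall>m\<ge>1. \<exists>k. real k ^ ?d * ?p n a \<le> 6 ^ ?d * real m ^ ?d
    \<and> prob (UNIV - hit n a (cube k - {0})) \<le> (3 / 4) ^ (m ^ ?d)" using late_hit by blast
  note late = this
  \<comment> \<open>Vacuous outside the range of \<open>late_hit\<close>, so that k2 can be chosen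
    for all n and all patterns together.\<close>
  define R where "R n a k \<longleftrightarrow> (n \<ge> n0 \<and> m n \<ge> 1 \<longrightarrow> real k ^ ?d * ?p n a \<le> 6 ^ ?d * real (m n) ^ ?d
    \<and> prob (UNIV - hit n a (cube k - {0})) \<le> (3 / 4) ^ (m n ^ ?d))" for n a k
  have "\<forall>n a. \<exists>k. R n a k"
  proof (intro allI)
    fix n a
    show "\<exists>k. R n a k"
    proof (cases "n \<ge> n0 \<and> m n \<ge> 1")
      case True
      then show ?thesis using late[rule_format, of n "m n" a] by (simp add: R_def)
    next
      case False
      then have "R n a 0" unfolding R_def by blast
      then show ?thesis ..
    qed
  qed
  then obtain k2 where "\<forall>n a. R n a (k2 n a)" by metis
  then have k2: "\<And>n a. n \<ge> n0 \<Longrightarrow> m n \<ge> 1 \<Longrightarrow> real (k2 n a) ^ ?d * ?p n a \<le> 6 ^ ?d * real (m n) ^ ?d"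
    "\<And>n a. n \<ge> n0 \<Longrightarrow> m n \<ge> 1 \<Longrightarrow> prob (UNIV - hit n a (cube (k2 n a) - {0})) \<le> (3 / 4) ^ (m n ^ ?d)"
    by (simp_all add: R_def)
  define T where "T n a = hit n a (cube (k1 n a) - {0}) \<union> (UNIV - hit n a (cube (k2 n a) - {0}))" for n a
  define Bad where "Bad n = (\<Union>a\<in>patterns (cube n). agree (cube n) a \<times> T n a)" for n
  have miss_sets: "UNIV - hit n a (cube k - {0}) \<in> sets M" for n a k
    using sets.compl_sets[OF hit_sets[of "cube k - {0}" n a]] by simp
  have T_sets: "T n a \<in> sets M" for n a
    unfolding T_def by (intro sets.Un hit_sets miss_sets) simp
  have rect: "measure (Q \<Otimes>\<^sub>M M) (A \<times> B) = measure Q A * prob B" if "A \<in> sets Q" "B \<in> sets M" for A B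
    using emeasure_pair_measure_Times[OF that] by (simp add: measure_def enn2real_mult)
  have rect_sets: "agree (cube n) a \<times> T n a \<in> sets (Q \<Otimes>\<^sub>M M)" for n a
    using T_sets by simp
  have fin: "finite (patterns (cube n) :: ('d, 'a) config set)" for n by (rule finite_patterns) simp
  have Bad_sets: "Bad n \<in> sets (Q \<Otimes>\<^sub>M M)" for n
    unfolding Bad_def by (rule sets.finite_UN[OF fin]) (rule rect_sets)
  have Bad_le: "measure (Q \<Otimes>\<^sub>M M) (Bad n) \<le> C" if C: "\<And>a. prob (T n a) \<le> C" for n C
  proof -
    have "measure (Q \<Otimes>\<^sub>M M) (Bad n) \<le> (\<Sum>a\<in>patterns (cube n). measure (Q \<Otimes>\<^sub>M M) (agree (cube n) a \<times> T n a))"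
      unfolding Bad_def by (rule QM.finite_measure_subadditive_finite[OF fin]) (use rect_sets in auto)
    also have "\<dots> \<le> (\<Sum>a\<in>patterns (cube n). measure Q (agree (cube n) a) * C)"
      by (intro sum_mono) (simp add: rect T_sets mult_left_mono[OF C])
    also have "\<dots> = C" by (simp add: sum_distrib_right[symmetric] Q.sum_patterns)
    finally show ?thesis .
  qed
  have theta_le: "\<theta> n \<le> 1 / real n ^ 2" if "n \<ge> 1" for n
  proof -
    have "2 * ln (real n) \<le> \<epsilon> * ln (real n)" by (rule mult_right_mono) (use \<epsilon>2 that in auto)
    then have "\<theta> n \<le> exp (- (2 * ln (real n)))" by (simp add: \<theta>_def)
    also have "\<dots> = 1 / real n ^ 2" using that by (simp add: exp_minus exp_double inverse_eq_divide)
    finally show ?thesis .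
  qed
  have "\<forall>\<^sub>F n in sequentially. norm (measure (Q \<Otimes>\<^sub>M M) (Bad n)) \<le> (2 ^ ?d + 1) * (1 / real n ^ 2)"
    using m eventually_ge_at_top[of "max 1 n0"]
  proof eventually_elim
    case (elim n)
    then have n: "n \<ge> 1" "n \<ge> n0" "m n \<ge> 1" by auto
    have geo: "(3 / 4 :: real) ^ (m n ^ ?d) \<le> 1 / real n ^ 2"
    proof -
      let ?k = "real (m n ^ ?d)"
      have "ln (4 / 3 :: real) > 0" by simp
      then have "2 * 12 ^ ?d \<le> \<epsilon> * ln (4 / 3)" using \<epsilon> unfolding eps0_def by (simp add: field_simps)
      then have "2 * 12 ^ ?d * ln (real n) \<le> \<epsilon> * ln (4 / 3) * ln (real n)"
        by (rule mult_right_mono) (use n in simp)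
      then have "2 * ln (real n) \<le> ln (4 / 3) * (\<epsilon> * ln (real n) / 12 ^ ?d)"
        by (simp add: field_simps)
      also have "\<dots> \<le> ln (4 / 3) * ?k" by (rule mult_left_mono) (use elim in auto)
      finally have le: "2 * ln (real n) \<le> ln (4 / 3) * ?k" .
      have neg: "ln (3 / 4 :: real) = - ln (4 / 3)" using ln_inverse[of "4 / 3 :: real"] by simp
      have pow: "(3 / 4 :: real) ^ j = exp (- (ln (4 / 3) * real j))" for j :: nat
      proof -
        have "(3 / 4 :: real) ^ j = exp (ln (3 / 4)) ^ j" by simp
        also have "\<dots> = exp (real j * ln (3 / 4))" by (rule exp_of_nat_mult[symmetric])
        finally show ?thesis unfolding neg by (simp add: mult.commute)
      qed
      have "(3 / 4 :: real) ^ (m n ^ ?d) = exp (- (ln (4 / 3) * ?k))" by (rule pow)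
      also have "\<dots> \<le> exp (- (2 * ln (real n)))" using le by simp
      also have "\<dots> = 1 / real n ^ 2" using n by (simp add: exp_minus exp_double inverse_eq_divide)
      finally show ?thesis .
    qed
    have "prob (T n a) \<le> (2 ^ ?d + 1) * (1 / real n ^ 2)" for a
    proof -
      have "prob (T n a) \<le> prob (hit n a (cube (k1 n a) - {0})) + prob (UNIV - hit n a (cube (k2 n a) - {0}))"
        unfolding T_def by (intro measure_Un_le miss_sets hit_sets) simp
      also have "\<dots> \<le> 2 ^ ?d * (1 / real n ^ 2) + 1 / real n ^ 2"
        using k1(2)[of n a] k2(2)[OF n(2,3), of a] geo mult_left_mono[OF theta_le[OF n(1)], of "2 ^ ?d"] by simp
      finally show ?thesis by (simp only: distrib_right mult_1_left)
    qed
    then show ?case using Bad_le by simp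
  qed
  then have "summable (\<lambda>n. measure (Q \<Otimes>\<^sub>M M) (Bad n))"
    by (rule summable_comparison_test_ev) (intro summable_mult inverse_power_summable[of 2, simplified inverse_eq_divide], simp)
  then have "AE \<omega> in Q \<Otimes>\<^sub>M M. \<forall>\<^sub>F n in sequentially. \<omega> \<in> space (Q \<Otimes>\<^sub>M M) - Bad n"
    by (intro borel_cantelli_AE1 Bad_sets) (auto simp: QM.emeasure_eq_measure)
  then show ?thesis
  proof eventually_elim
    case (elim \<omega>)
    obtain \<xi> \<sigma> where \<omega>: "\<omega> = (\<xi>, \<sigma>)" by (cases \<omega>)
    from elim m eventually_ge_at_top[of n0]
    have "\<forall>\<^sub>F n in sequentially. \<exists>w. w \<ge> 1 \<and> waiting_time n \<xi> \<sigma> = enat w \<and>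
      \<theta> n \<le> real w ^ ?d * ?p n \<xi> \<and> real w ^ ?d * ?p n \<xi> \<le> \<epsilon> * ln (real n)"
    proof eventually_elim
      case (elim n)
      \<comment> \<open>\<open>Bad\<close> ranges over extensional patterns; restricting \<xi>
        changes neither its cylinder nor the hits nor the waiting time.\<close>
      define a where "a = restrict \<xi> (cube n)"
      have "a \<in> patterns (cube n)" by (simp add: a_def)
      moreover have ag: "agree (cube n) a = agree (cube n) \<xi>" by (rule agree_cong) (simp add: a_def)
      moreover have "\<xi> \<in> agree (cube n) \<xi>" by (simp add: agree_def)
      ultimately have "\<sigma> \<notin> T n a" using elim(1) unfolding \<omega> Bad_def by blast
      then have s: "\<sigma> \<notin> hit n a (cube (k1 n a) - {0})" "\<sigma> \<in> hit n a (cube (k2 n a) - {0})"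
        by (auto simp: T_def)
      have hit_eq: "hit n a B = hit n \<xi> B" for B by (simp add: hit_def occurs_def ag)
      have wt: "waiting_time n a \<sigma> = waiting_time n \<xi> \<sigma>" unfolding waiting_time_alt hit_eq ..
      have "waiting_time n \<xi> \<sigma> \<le> enat (k2 n a)" using waiting_time_le[OF s(2)] wt by simp
      then obtain w where w: "waiting_time n \<xi> \<sigma> = enat w" "w \<le> k2 n a"
        by (cases "waiting_time n \<xi> \<sigma>") auto
      have "\<theta> n \<le> real w ^ ?d * ?p n \<xi>"
        using k1(1)[of n a \<sigma> w] s(1) w(1) by (auto simp: wt ag not_less[symmetric])
      moreover have "real w ^ ?d * ?p n \<xi> \<le> real (k2 n a) ^ ?d * ?p n \<xi>"
        by (intro mult_right_mono power_mono) (use w in auto)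
      then have "real w ^ ?d * ?p n \<xi> \<le> \<epsilon> * ln (real n)"
        using k2(1)[of n a] elim by (simp add: ag)
      ultimately show ?case using w(1) waiting_time_pos[OF w(1)] by blast
    qed
    then show ?case by (simp add: \<omega> \<theta>_def)
  qed
qed

end

lemma AE_pair_fst:
  assumes "prob_space Q" "prob_space P" "AE \<xi> in Q. R \<xi>"
  shows "AE (\<xi>, \<sigma>) in Q \<Otimes>\<^sub>M P. R \<xi>"
proof -
  interpret Q: prob_space Q by fact
  interpret P: prob_space P by fact
  from assms(3) obtain N where N: "{\<xi> \<in> space Q. \<not> R \<xi>} \<subseteq> N" "emeasure Q N = 0" "N \<in> sets Q"
    by (rule AE_E)
  have "emeasure (Q \<Otimes>\<^sub>M P) (N \<times> space P) = 0"
    using P.emeasure_pair_measure_Times[OF N(3) sets.top] N(2) by simp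
  then have "N \<times> space P \<in> null_sets (Q \<Otimes>\<^sub>M P)" using N(3) by auto
  then show ?thesis by (rule AE_I') (use N(1) in \<open>auto simp: space_pair_measure\<close>)
qed

lemma ext_ln_ereal: "x > 0 \<Longrightarrow> ext_ln (ereal x) = ereal (ln x)"
  by (simp add: ext_ln_def)

lemma waiting_product:
  assumes "waiting_time n \<xi> \<sigma> = enat w"
  shows "ereal_of_enat (waiting_time n \<xi> \<sigma>) ^ k * ereal p = ereal (real w ^ k * p)"
  by (simp add: assms)

text \<open>Convergence of the two block sequences is part of the conclusion because the rates are
  defined by \<open>lim\<close>, which is meaningful only for convergent sequences.\<close>

theorem theorem4:
  fixes U :: "'d::finite site set \<Rightarrow> ('d, 'a::finite) config \<Rightarrow> real"
    and P Q :: "('d, 'a) config measure"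
  assumes dim: "CARD('d) \<ge> 2"
    and inter: "interaction U"
    and gibbs: "gibbs_field U P"
    and mixing: "exp_phi_mixing P"
    and ergodic: "ergodic_field Q"
  shows "(\<exists>\<epsilon>0>0. \<forall>\<epsilon>>\<epsilon>0. AE (\<xi>, \<sigma>) in Q \<Otimes>\<^sub>M P. \<forall>\<^sub>F n in sequentially.
            ereal (- \<epsilon> * ln (real n)) \<le>
              ext_ln (ereal_of_enat (waiting_time n \<xi> \<sigma>) ^ CARD('d) *
                      ereal (measure P (cylinder (cube n) (restrict \<xi> (cube n))))) \<and>
            ext_ln (ereal_of_enat (waiting_time n \<xi> \<sigma>) ^ CARD('d) *
                    ereal (measure P (cylinder (cube n) (restrict \<xi> (cube n))))) \<le>
              ereal (ln (ln (real n powr \<epsilon>))))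
       \<and> convergent (block_entropy Q) \<and> convergent (block_rel_entropy Q P)
       \<and> (AE (\<xi>, \<sigma>) in Q \<Otimes>\<^sub>M P.
            (\<lambda>n. ereal (real CARD('d) / real n ^ CARD('d)) *
                  ext_ln (ereal_of_enat (waiting_time n \<xi> \<sigma>)))
              \<longlonglongrightarrow> ereal (entropy_rate Q) + rel_entropy_rate Q P)"
proof -
  let ?d = "CARD('d)"
  obtain C1 C2 where "C1 > 0" "C2 > 0" "\<And>m. m > 0 \<Longrightarrow> phi_mix P m \<le> C1 * exp (- C2 * m)"
    using mixing by (auto simp: exp_phi_mixing_def)
  then interpret P: gibbs_mixing U P C1 C2
    using inter gibbs dim by unfold_locales auto
  interpret Q: ergodic_field_locale Q by unfold_locales (rule ergodic)
  let ?p = "\<lambda>n \<xi>. measure P (agree (cube n) \<xi>)"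
  have Qf: "random_field Q" "translation_invariant Q" using ergodic by (auto simp: ergodic_field_def)
  have bounds: "AE (\<xi>, \<sigma>) in Q \<Otimes>\<^sub>M P. \<forall>\<^sub>F n in sequentially.
            ereal (- \<epsilon> * ln (real n)) \<le>
              ext_ln (ereal_of_enat (waiting_time n \<xi> \<sigma>) ^ CARD('d) *
                      ereal (measure P (cylinder (cube n) (restrict \<xi> (cube n))))) \<and>
            ext_ln (ereal_of_enat (waiting_time n \<xi> \<sigma>) ^ CARD('d) *
                    ereal (measure P (cylinder (cube n) (restrict \<xi> (cube n))))) \<le>
              ereal (ln (ln (real n powr \<epsilon>)))" if \<epsilon>: "\<epsilon> > P.eps0" for \<epsilon>
    using P.waiting_time_bounds[OF Qf \<epsilon>]
  proof eventually_elim
    case (elim \<omega>)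
    obtain \<xi> \<sigma> where \<omega>: "\<omega> = (\<xi>, \<sigma>)" by (cases \<omega>)
    from elim[unfolded \<omega> prod.case] eventually_ge_at_top[of 1]
    show ?case unfolding \<omega> prod.case
    proof eventually_elim
      case (elim n)
      then obtain w where w: "w \<ge> 1" "waiting_time n \<xi> \<sigma> = enat w"
        "exp (- \<epsilon> * ln (real n)) \<le> real w ^ ?d * ?p n \<xi>" "real w ^ ?d * ?p n \<xi> \<le> \<epsilon> * ln (real n)" by blast
      let ?x = "real w ^ ?d * ?p n \<xi>"
      have pos: "?x > 0" using w(3) exp_gt_zero less_le_trans by blast
      have "- \<epsilon> * ln (real n) \<le> ln ?x" using w(3) pos by (simp only: ln_ge_iff)
      moreover have "ln ?x \<le> ln (ln (real n powr \<epsilon>))"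
        using w(4) pos elim(2) by (simp add: ln_powr)
      ultimately show ?case
        unfolding waiting_product[OF w(2)] cylinder_restrict ext_ln_ereal[OF pos] by simp
    qed
  qed
  obtain l where l: "(\<lambda>n. (\<integral>\<xi>. P.info \<xi> (cube n) \<partial>Q) / real n ^ ?d) \<longlonglongrightarrow> l"
    "AE \<xi> in Q. (\<lambda>n. P.info \<xi> (cube n) / real n ^ ?d) \<longlonglongrightarrow> l"
    using P.info_density_converges[OF ergodic] by blast
  have ent: "convergent (block_entropy Q)"
    using Q.shannon_density_convergent by (simp add: Q.block_entropy_eq[abs_def])
  then have ent_lim: "block_entropy Q \<longlonglongrightarrow> entropy_rate Q"
    by (simp add: entropy_rate_def convergent_LIMSEQ_iff)
  have "(\<lambda>n. ereal ((\<integral>\<xi>. P.info \<xi> (cube n) \<partial>Q) / real n ^ ?d - block_entropy Q n)) \<longlonglongrightarrow> ereal (l - entropy_rate Q)"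
    by (intro tendsto_intros l(1) ent_lim)
  then have rel_lim: "block_rel_entropy Q P \<longlonglongrightarrow> ereal (l - entropy_rate Q)"
    by (simp add: P.block_rel_entropy_eq[OF Qf, abs_def])
  then have rel_rate: "rel_entropy_rate Q P = ereal (l - entropy_rate Q)"
    unfolding rel_entropy_rate_def by (rule limI)
  define \<epsilon> where "\<epsilon> = P.eps0 + 1"
  have "\<epsilon> > P.eps0" by (simp add: \<epsilon>_def)
  note main = P.waiting_time_bounds[OF Qf this]
  have "AE (\<xi>, \<sigma>) in Q \<Otimes>\<^sub>M P. (\<lambda>n. P.info \<xi> (cube n) / real n ^ ?d) \<longlonglongrightarrow> l"
    by (rule AE_pair_fst[OF Q.prob_space_axioms P.prob_space_axioms l(2)])
  with main have "AE (\<xi>, \<sigma>) in Q \<Otimes>\<^sub>M P.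
      (\<lambda>n. ereal (real ?d / real n ^ ?d) * ext_ln (ereal_of_enat (waiting_time n \<xi> \<sigma>))) \<longlonglongrightarrow> ereal l"
  proof eventually_elim
    case (elim \<omega>)
    obtain \<xi> \<sigma> where \<omega>: "\<omega> = (\<xi>, \<sigma>)" by (cases \<omega>)
    note ev = elim(1)[unfolded \<omega> prod.case] and lim = elim(2)[unfolded \<omega> prod.case]
    \<comment> \<open>A real version of the sequence in question; \<open>the_enat\<close> is
      harmless because the waiting time is eventually finite.\<close>
    define y where "y n = real ?d / real n ^ ?d * ln (real (the_enat (waiting_time n \<xi> \<sigma>)))" for n
    from ev eventually_ge_at_top[of 1]
    have close: "\<forall>\<^sub>F n in sequentially. ereal (y n) = ereal (real ?d / real n ^ ?d) * ext_ln (ereal_of_enat (waiting_time n \<xi> \<sigma>)) \<and>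
        norm (y n - P.info \<xi> (cube n) / real n ^ ?d) \<le> \<epsilon> * (ln (real n) / real n)"
    proof eventually_elim
      case (elim n)
      then obtain w where w: "w \<ge> 1" "waiting_time n \<xi> \<sigma> = enat w"
        "exp (- \<epsilon> * ln (real n)) \<le> real w ^ ?d * ?p n \<xi>" "real w ^ ?d * ?p n \<xi> \<le> \<epsilon> * ln (real n)" by blast
      let ?x = "real w ^ ?d * ?p n \<xi>"
      have n: "real n \<ge> 1" using elim(2) by simp
      have p: "?p n \<xi> > 0" by (rule P.measure_agree_pos) simp
      have pos: "?x > 0" using p w(1) by simp
      have low: "- \<epsilon> * ln (real n) \<le> ln ?x" using w(3) pos by (simp only: ln_ge_iff)
      \<comment> \<open>This gives up the iterated logarithm, but the order log n is already
        negligible after division by n^d.\<close>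
      have "ln ?x \<le> ?x - 1" by (rule ln_le_minus_one[OF pos])
      then have "\<bar>ln ?x\<bar> \<le> \<epsilon> * ln (real n)" using low w(4) by simp
      then have "\<bar>ln ?x\<bar> / real n ^ ?d \<le> \<epsilon> * ln (real n) / real n ^ ?d"
        by (rule divide_right_mono) simp
      also have "\<dots> \<le> \<epsilon> * ln (real n) / real n"
      proof (rule divide_left_mono)
        show "real n \<le> real n ^ ?d" by (rule self_le_power[OF n]) simp
        show "0 \<le> \<epsilon> * ln (real n)" using P.eps0 n by (simp add: \<epsilon>_def)
      qed (use n in auto)
      finally have err: "\<bar>ln ?x\<bar> / real n ^ ?d \<le> \<epsilon> * ln (real n) / real n" .
      have "ln ?x = real ?d * ln (real w) - P.info \<xi> (cube n)"
        using p w(1) by (simp add: ln_mult ln_realpow P.info_def)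
      then have "y n - P.info \<xi> (cube n) / real n ^ ?d = ln ?x / real n ^ ?d"
        by (simp add: y_def w(2) diff_divide_distrib)
      then have "norm (y n - P.info \<xi> (cube n) / real n ^ ?d) \<le> \<epsilon> * (ln (real n) / real n)"
        using err by (simp add: abs_divide)
      moreover have "ereal (y n) = ereal (real ?d / real n ^ ?d) * ext_ln (ereal_of_enat (waiting_time n \<xi> \<sigma>))"
        using w(1) by (simp add: y_def w(2) ext_ln_ereal)
      ultimately show ?case by blast
    qed
    have "(\<lambda>n. \<epsilon> * (ln (real n) / real n)) \<longlonglongrightarrow> 0" by real_asymp
    moreover have "\<forall>\<^sub>F n in sequentially. norm (y n - P.info \<xi> (cube n) / real n ^ ?d) \<le> \<epsilon> * (ln (real n) / real n)"
      using close by eventually_elim blast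
    ultimately have "(\<lambda>n. y n - P.info \<xi> (cube n) / real n ^ ?d) \<longlonglongrightarrow> 0"
      by (rule Lim_null_comparison[rotated])
    from tendsto_add[OF this lim] have "y \<longlonglongrightarrow> l" by simp
    then have "(\<lambda>n. ereal (y n)) \<longlonglongrightarrow> ereal l" by (rule tendsto_ereal)
    moreover have "\<forall>\<^sub>F n in sequentially. ereal (y n) =
        ereal (real ?d / real n ^ ?d) * ext_ln (ereal_of_enat (waiting_time n \<xi> \<sigma>))"
      using close by eventually_elim blast
    ultimately show ?case unfolding \<omega> prod.case by (rule Lim_transform_eventually)
  qed
  then have "AE (\<xi>, \<sigma>) in Q \<Otimes>\<^sub>M P.
      (\<lambda>n. ereal (real ?d / real n ^ ?d) * ext_ln (ereal_of_enat (waiting_time n \<xi> \<sigma>)))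
        \<longlonglongrightarrow> ereal (entropy_rate Q) + rel_entropy_rate Q P"
    by (simp add: rel_rate)
  moreover have "P.eps0 > 0" using P.eps0 by linarith
  moreover have "convergent (block_rel_entropy Q P)" using rel_lim by (auto simp: convergent_def)
  ultimately show ?thesis using bounds ent by blast
qed

end
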